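(* Let the potential be $\kappa=0$. Suppose a signed graph $\Gamma$ has $k+l$ connected components $\Gamma_1,\dots,\Gamma_{k+l}$, of which $\Gamma_1,\dots,\Gamma_k$ are balanced while $\Gamma_{k+1},\dots,\Gamma_{k+l}$ are not balanced. Then the smallest positive eigenvalue of the $1$-Laplacian $\Delta_1^\sigma$ on $\Gamma$ is the variational eigenvalue $\lambda_{k+1}(\Delta_1^\sigma)$, and it is expressed via signed Cheeger constants as $$\lambda_{k+1}(\Delta_1^\sigma)=h_{k+1}^\sigma(\Gamma)=\min\Big\{\min_{i=1,\dots,k}h_2^\sigma(\Gamma_i),\ \min_{j=k+1,\dots,k+l}h_1^\sigma(\Gamma_j)\Big\}.$$
   Context: Setting. $G=(V,E)$ is a finite simple undirected graph, $n=|V|$, with edge measure $w:E\to(0,\infty)$, vertex weight $\mu:V\to(0,\infty)$ and signature $\sigma:E\to\{-1,1\}$ (potential $\kappa=0$); values are written $w_{xy},\sigma_{xy},\mu_x$, and $x\sim y$ means $\{x,y\}\in E$. $\Gamma=(G,\sigma)$ is balanced if there is $\tau:V\to\{-1,1\}$ with $\tau(x)\sigma_{xy}\tau(y)=1$ for all $\{x,y\}\in E$. Components carry the restricted $w,\mu,\sigma$. Eigenpairs. Let $\mathrm{Sgn}(t)=\{1\}$ if $t>0$, $[-1,1]$ if $t=0$, $\{-1\}$ if $t<0$. A nonzero $f:V\to\mathbb R$ is an eigenfunction of $\Delta_1^\sigma$ with eigenvalue $\lambda$ if there are numbers $z_{xy}\in\mathrm{Sgn}(f(x)-\sigma_{xy}f(y))$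 (for all ordered pairs $x\sim y$) with $z_{xy}=-\sigma_{xy}z_{yx}$, and $z_x'\in\mathrm{Sgn}(f(x))$, such that $\sum_{y\sim x}w_{xy}z_{xy}=\lambda\mu_xz'_x$ for all $x\in V$. Variational eigenvalues. $\mathcal S_1=\{f\in\mathbb R^V:\sum_x\mu_x|f(x)|=1\}$. For a compact set $S=-S$ its index (Krasnoselskii genus) $\gamma(S)$ is $0$ if $S=\emptyset$, otherwise the least positive integer $k$ for which an odd continuous map $S\to\mathbb R^k\setminus\{0\}$ exists ($\infty$ if none). $\mathcal F_k(\mathcal S_1)$ is the family of compact $A=-A\subset\mathcal S_1$ with $\gamma(A)\ge k$. With $\mathcal R_1^\sigma(f)=\frac{\sum_{\{x,y\}\in E}w_{xy}|f(x)-\sigma_{xy}f(y)|}{\sum_{x\in V}\mu_x|f(x)|}$, set $\lambda_k(\Delta_1^\sigma)=\inf_{S\in\mathcal F_k(\mathcal S_1)}\sup_{f\in S}\mathcal R_1^\sigma(f)$, $k=1,\dots,n$. Signed Cheeger constants (of a signed graph). For $V_1,V_2\subset V$: $|E^{\pm}(V_1,V_2)|=\sum_{x\in V_1}\sum_{y\in V_2,\,y\sim x,\,\sigma_{xy}=\pm1}w_{xy}$, $|E^\pm(V_1)|=|E^\pm(V_1,V_1)|$, $|\partial V_1|=\sum_{x\in V_1}\sum_{y\notin V_1,\,y\sim x}w_{xy}$, $\mathrm{vol}_\mu(V_1)=\sum_{x\in V_1}\mu_x$. For disjoint $V_1,V_2$ with nonempty union, $\beta^\sigma(V_1,V_2)=\frac{2|E^+(V_1,V_2)|+|E^-(V_1)|+|E^-(V_2)|+|\partial(V_1\cup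 V_2)|}{\mathrm{vol}_\mu(V_1\cup V_2)}$. Then $h_k^\sigma=\min\max_{i=1,\dots,k}\beta^\sigma(V_{2i-1},V_{2i})$, the minimum over all families $\{(V_{2i-1},V_{2i})\}_{i=1}^k$ with $V_{2i-1}\cap V_{2i}=\emptyset$, $V_{2i-1}\cup V_{2i}\neq\emptyset$, and $(V_{2i-1}\cup V_{2i})\cap(V_{2j-1}\cup V_{2j})=\emptyset$ for $i\ne j$. Conventions: $\lambda_s$ and $h_s^\sigma$ of a signed graph with fewer than $s$ vertices are $+\infty$, and a minimum over the empty set is $+\infty$ (including the smallest positive eigenvalue when there is none). *)

theory Defs
  imports "HOL-Analysis.Analysis" "HOL-Library.Extended_Nat" "HOL-Library.Extended_Real"
begin

section \<open>Weighted signed graphs\<close>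

text \<open>The weight and the signature are functions on unordered pairs; only their values on
  \<open>edges\<close> (and those of the vertex weight on \<open>verts\<close>) are meaningful.\<close>

record 'v signed_graph =
  verts :: "'v set"
  edges :: "'v set set"
  weight :: "'v set \<Rightarrow> real"
  mass :: "'v \<Rightarrow> real"
  signature :: "'v set \<Rightarrow> real"

definition wf_signed_graph :: "'v signed_graph \<Rightarrow> bool" where
  "wf_signed_graph G \<longleftrightarrow>
     finite (verts G) \<and>
     (\<forall>e\<in>edges G. \<exists>x\<in>verts G. \<exists>y\<in>verts G. x \<noteq> y \<and> e = {x, y}) \<and>
     (\<forall>e\<in>edges G. 0 < weight G e) \<and>
     (\<forall>x\<in>verts G. 0 < mass G x) \<and>
     (\<forall>e\<in>edges G. signature G e \<in> {-1, 1})"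

definition nbrs :: "'v signed_graph \<Rightarrow> 'v \<Rightarrow> 'v set" where
  "nbrs G x = {y. {x, y} \<in> edges G}"

definition balanced :: "'v signed_graph \<Rightarrow> bool" where
  "balanced G \<longleftrightarrow>
     (\<exists>\<tau> :: 'v \<Rightarrow> real. (\<forall>x\<in>verts G. \<tau> x \<in> {-1, 1}) \<and>
        (\<forall>x y. {x, y} \<in> edges G \<longrightarrow> \<tau> x * signature G {x, y} * \<tau> y = 1))"

definition induced :: "'v signed_graph \<Rightarrow> 'v set \<Rightarrow> 'v signed_graph" where
  "induced G U = G\<lparr>verts := U, edges := {e \<in> edges G. e \<subseteq> U}\<rparr>"

definition conn_components :: "'v signed_graph \<Rightarrow> 'v signed_graph set" where
  "conn_components G = induced G ` (verts G // {(x, y). {x, y} \<in> edges G}\<^sup>*)"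

section \<open>Eigenpairs of the signed 1-Laplacian\<close>

definition Sgn :: "real \<Rightarrow> real set" where
  "Sgn t = (if t > 0 then {1} else if t = 0 then {-1..1} else {-1})"

text \<open>The space of real functions on \<open>V = verts G\<close> is realised by the functions vanishing off
  \<open>V\<close>. The topology of the function type is the product topology, which induces the usual
  topology of \<open>\<real>\<^sup>V\<close> on this subspace.\<close>

definition vfuns :: "'v signed_graph \<Rightarrow> ('v \<Rightarrow> real) set" where
  "vfuns G = {f. \<forall>x. x \<notin> verts G \<longrightarrow> f x = 0}"

definition eigenfunction :: "'v signed_graph \<Rightarrow> real \<Rightarrow> ('v \<Rightarrow> real) \<Rightarrow> bool" where
  "eigenfunction G ev f \<longleftrightarrow>
     f \<in> vfuns G \<and> f \<noteq> (\<lambda>_. 0) \<and>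
     (\<exists>z :: 'v \<Rightarrow> 'v \<Rightarrow> real. \<exists>z' :: 'v \<Rightarrow> real.
        (\<forall>x y. {x, y} \<in> edges G \<longrightarrow>
           z x y \<in> Sgn (f x - signature G {x, y} * f y) \<and>
           z x y = - signature G {x, y} * z y x) \<and>
        (\<forall>x\<in>verts G. z' x \<in> Sgn (f x)) \<and>
        (\<forall>x\<in>verts G. (\<Sum>y\<in>nbrs G x. weight G {x, y} * z x y) = ev * mass G x * z' x))"

definition eigenvalue :: "'v signed_graph \<Rightarrow> real \<Rightarrow> bool" where
  "eigenvalue G ev \<longleftrightarrow> (\<exists>f. eigenfunction G ev f)"

text \<open>The minimum is required to be attained, unless the set is empty.\<close>

definition is_minimum :: "ereal \<Rightarrow> real set \<Rightarrow> bool" where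
  "is_minimum v A \<longleftrightarrow> (A = {} \<and> v = \<infinity>) \<or> (\<exists>m\<in>A. v = ereal m \<and> (\<forall>a\<in>A. m \<le> a))"

definition is_smallest_pos_eigenvalue :: "'v signed_graph \<Rightarrow> ereal \<Rightarrow> bool" where
  "is_smallest_pos_eigenvalue G v \<longleftrightarrow> is_minimum v {ev. 0 < ev \<and> eigenvalue G ev}"

section \<open>Variational eigenvalues\<close>

text \<open>The infimum of the empty set of extended naturals is \<open>\<infinity>\<close>.\<close>

definition genus :: "('v \<Rightarrow> real) set \<Rightarrow> enat" where
  "genus S = (if S = {} then 0 else
     Inf {enat k | k. 0 < k \<and>
       (\<exists>\<phi>. continuous_map (top_of_set S) (Euclidean_space k) \<phi> \<and>
            (\<forall>f\<in>S. \<phi> f \<noteq> (\<lambda>_. 0)) \<and>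
            (\<forall>f\<in>S. \<phi> (\<lambda>x. - f x) = (\<lambda>i. - \<phi> f i)))})"

definition unit_sphere :: "'v signed_graph \<Rightarrow> ('v \<Rightarrow> real) set" where
  "unit_sphere G = {f \<in> vfuns G. (\<Sum>x\<in>verts G. mass G x * \<bar>f x\<bar>) = 1}"

definition sym_sets :: "'v signed_graph \<Rightarrow> nat \<Rightarrow> ('v \<Rightarrow> real) set set" where
  "sym_sets G k = {A. A \<subseteq> unit_sphere G \<and> compact A \<and>
     (\<lambda>f x. - f x) ` A = A \<and> enat k \<le> genus A}"

text \<open>In the numerator every edge is visited twice by the double sum, with equal summands since
  \<open>signature G {x, y}\<close> is \<open>1\<close> or \<open>-1\<close>.\<close>

definition rayleigh :: "'v signed_graph \<Rightarrow> ('v \<Rightarrow> real) \<Rightarrow> real" where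
  "rayleigh G f =
     (1/2 * (\<Sum>x\<in>verts G. \<Sum>y\<in>nbrs G x. weight G {x, y} * \<bar>f x - signature G {x, y} * f y\<bar>))
     / (\<Sum>x\<in>verts G. mass G x * \<bar>f x\<bar>)"

definition var_eigenvalue :: "'v signed_graph \<Rightarrow> nat \<Rightarrow> ereal" where
  "var_eigenvalue G k =
     (if k \<le> card (verts G) then INF A\<in>sym_sets G k. SUP f\<in>A. ereal (rayleigh G f) else \<infinity>)"

section \<open>Signed Cheeger constants\<close>

definition edge_vol :: "'v signed_graph \<Rightarrow> real \<Rightarrow> 'v set \<Rightarrow> 'v set \<Rightarrow> real" where
  "edge_vol G s U W = (\<Sum>x\<in>U. \<Sum>y\<in>{y \<in> W \<inter> nbrs G x. signature G {x, y} = s}. weight G {x, y})"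

definition boundary_vol :: "'v signed_graph \<Rightarrow> 'v set \<Rightarrow> real" where
  "boundary_vol G U = (\<Sum>x\<in>U. \<Sum>y\<in>nbrs G x - U. weight G {x, y})"

definition signed_beta :: "'v signed_graph \<Rightarrow> 'v set \<Rightarrow> 'v set \<Rightarrow> real" where
  "signed_beta G U W =
     (2 * edge_vol G 1 U W + edge_vol G (-1) U U + edge_vol G (-1) W W + boundary_vol G (U \<union> W))
     / (\<Sum>x\<in>U \<union> W. mass G x)"

definition cheeger_families :: "'v signed_graph \<Rightarrow> nat \<Rightarrow> (nat \<Rightarrow> 'v set) set" where
  "cheeger_families G k = {U.
     (\<forall>i\<in>{1..2 * k}. U i \<subseteq> verts G) \<and>
     (\<forall>i\<in>{1..k}. U (2 * i - 1) \<inter> U (2 * i) = {} \<and> U (2 * i - 1) \<union> U (2 * i) \<noteq> {}) \<and>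
     (\<forall>i\<in>{1..k}. \<forall>j\<in>{1..k}. i \<noteq> j \<longrightarrow>
        (U (2 * i - 1) \<union> U (2 * i)) \<inter> (U (2 * j - 1) \<union> U (2 * j)) = {})}"

text \<open>Only finitely many values occur for a finite graph, so the infimum is a minimum; it is
  \<open>\<infinity>\<close> if there is no family, i.e. if \<open>G\<close> has fewer than \<open>k\<close> vertices.\<close>

definition cheeger :: "'v signed_graph \<Rightarrow> nat \<Rightarrow> ereal" where
  "cheeger G k = (INF U\<in>cheeger_families G k.
     ereal (MAX i\<in>{1..k}. signed_beta G (U (2 * i - 1)) (U (2 * i))))"

end

theory Submission
  imports Defs "HOL-Homology.Brouwer_Degree"
begin

text \<open>
  Write \<open>N f\<close> for the numerator of the Rayleigh quotient, the total variation of \<open>f\<close>. For disjoint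
  \<open>P\<close> and \<open>Q\<close> the signed Cheeger quotient is the Rayleigh quotient of \<open>1\<^sub>P - 1\<^sub>Q\<close>
  (\<open>signed_beta_eq\<close>), and peeling off the smallest nonzero level of \<open>\<bar>f\<bar>\<close> writes \<open>f\<close> as a positive
  combination of such indicators along which \<open>N\<close> is additive (\<open>signed_layer_inequality\<close>).

  The proof is organised around one finite family of pairs. A pair \<open>(P, Q)\<close> inside a component \<open>K\<close> is
  \<^emph>\<open>admissible\<close> if \<open>K\<close> is unbalanced or \<open>P \<union> Q\<close> has at most half of the volume of \<open>K\<close>. Let
  \<open>\<eta>\<close> be the least Cheeger quotient of an admissible pair; every quantity of the theorem equals \<open>\<eta>\<close>.

  For the Cheeger constants: of two disjoint pairs in a balanced component one has at most half of
  the volume; conversely, in a balanced component the rest \<open>K - (P \<union> Q)\<close>, split by a switching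
  function, has no larger quotient than \<open>(P, Q)\<close>, since it has the same boundary and at least
  the same volume. Splitting the other balanced components in the same way costs nothing, which
  gives \<open>k + 1\<close> pairs in the whole graph.

  For the eigenvalues: if \<open>f\<close> is an eigenfunction of a positive eigenvalue, testing the eigenvalue
  equation against a switching function \<open>\<tau>\<close> of a balanced component shows that \<open>0\<close> is a median of
  \<open>\<tau> f\<close> there. All level sets of \<open>f\<close> then split into admissible pairs, so the eigenvalue is at least
  \<open>\<eta>\<close>. Conversely a minimising admissible pair yields a linear functional below \<open>N\<close> that touches
  \<open>N\<close> at the (switched) indicator of the pair; a finite-dimensional Hahn--Banach argument turns this
  functional into the flow \<open>z\<close> of an eigenpair (\<open>flow_of_calibration\<close>), so \<open>\<eta>\<close> is an eigenvalue.

  For the variational eigenvalue: \<open>k + 1\<close> disjoint pairs span a sphere of dimension \<open>k\<close> on which the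
  Rayleigh quotient is at most the largest of their quotients, and its genus is at least \<open>k + 1\<close> by
  the Borsuk--Ulam theorem. On the other hand the \<open>k\<close> medians on the balanced components
  form an odd continuous map into \<open>\<real>\<^sup>k\<close>, so every symmetric set of genus at least
  \<open>k + 1\<close> contains a function all of whose medians vanish, and its Rayleigh quotient is at least \<open>\<eta>\<close>.

  The Borsuk--Ulam theorem is derived from the homology of spheres
  (\<open>no_odd_map_to_smaller_sphere\<close>).\<close>

section \<open>The Borsuk--Ulam theorem and the genus of spheres\<close>

definition neg_fun :: "(nat \<Rightarrow> real) \<Rightarrow> nat \<Rightarrow> real" where
  "neg_fun x = (\<lambda>i. - x i)"

lemma neg_fun_involution: "neg_fun \<circ> neg_fun = id"
  by (auto simp: neg_fun_def)

lemma continuous_map_neg_fun: "continuous_map (nsphere m) (nsphere m) neg_fun"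
proof -
  have "\<And>k. continuous_map (powertop_real UNIV) euclideanreal (\<lambda>x. - x k)"
    by (metis UNIV_I continuous_map_product_projection continuous_map_minus)
  then show ?thesis
    by (force simp: nsphere continuous_map_in_subtopology neg_fun_def continuous_map_componentwise_UNIV
        intro: continuous_map_from_subtopology)
qed

text \<open>The operator \<open>T - s\<close> on chains, where \<open>T\<close> is induced by the antipodal map. As \<open>T\<close> is an
  involution, \<open>T - s\<close> and \<open>T + s\<close> annihilate each other for \<open>s = 1\<close> and \<open>s = -1\<close>.\<close>

definition skew :: "nat \<Rightarrow> int \<Rightarrow> (nat \<Rightarrow> real) chain \<Rightarrow> (nat \<Rightarrow> real) chain" where
  "skew p s c = chain_map p neg_fun c - frag_cmul s c"

lemma skew_diff: "skew p s (a - b) = skew p s a - skew p s b"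
  by (rule poly_mapping_eqI)
    (simp add: skew_def chain_map_diff lookup_minus, simp add: algebra_simps lookup_minus)

lemma skew_add: "skew p s (a + b) = skew p s a + skew p s b"
  by (rule poly_mapping_eqI)
    (simp add: skew_def chain_map_add lookup_minus lookup_add, simp add: algebra_simps lookup_add)

lemma singular_chain_skew:
  "singular_chain p (nsphere m) c \<Longrightarrow> singular_chain p (nsphere m) (skew p s c)"
  by (simp add: skew_def singular_chain_diff singular_chain_cmul
      singular_chain_chain_map[OF _ continuous_map_neg_fun])

lemma chain_boundary_skew:
  "singular_chain p (nsphere m) c \<Longrightarrow> chain_boundary p (skew p s c) = skew (p - Suc 0) s (chain_boundary p c)"
  by (simp add: skew_def chain_boundary_diff chain_boundary_cmul chain_boundary_chain_map)

lemma skew_skew: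
  assumes "singular_chain p (nsphere m) c" "s * s = 1"
  shows "skew p s (skew p (- s) c) = 0"
proof -
  have "chain_map p neg_fun (chain_map p neg_fun c) = c"
    using chain_map_compose[of p neg_fun neg_fun] chain_map_ident[OF assms(1)]
    by (simp add: neg_fun_involution fun_eq_iff)
  then show ?thesis
    using assms(2)
    by (intro poly_mapping_eqI)
      (simp add: skew_def chain_map_diff lookup_minus, simp add: algebra_simps lookup_minus lookup_add flip: mult.assoc)
qed

lemma skew_chain_map:
  assumes "singular_chain p (nsphere n) c"
    and "\<And>x. x \<in> topspace (nsphere n) \<Longrightarrow> f (neg_fun x) = neg_fun (f x)"
  shows "chain_map p f (skew p s c) = skew p s (chain_map p f c)"
proof -
  have "chain_map p (f \<circ> neg_fun) c = chain_map p (neg_fun \<circ> f) c"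
    by (rule chain_map_eq[OF assms(1)]) (simp add: assms(2))
  then show ?thesis
    by (simp add: skew_def chain_map_diff chain_map_compose)
qed

text \<open>The image of a chain in a one-point space: in degree \<open>0\<close> this is the sum of the coefficients.\<close>

abbreviation augment :: "nat \<Rightarrow> 'a chain \<Rightarrow> unit chain" where
  "augment p c \<equiv> chain_map p (\<lambda>_. ()) c"

text \<open>Reduced and ordinary homology agree in positive degrees; in degree \<open>0\<close> the reduced group is the
  kernel of the augmentation. Stating the condition as a disjunction treats both cases at once, so
  that the sphere of dimension \<open>0\<close> needs no separate argument later.\<close>

lemma cycle_class_in_reduced_homology:
  assumes cyc: "singular_relcycle p X {} c" and aug: "1 \<le> p \<or> augment p c = 0"
  shows "homologous_rel_set p X {} c \<in> carrier (reduced_homology_group (int p) X)"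
proof -
  have carr: "homologous_rel_set p X {} c \<in> carrier (homology_group (int p) X)"
    using cyc by (auto simp: carrier_relative_homology_group)
  show ?thesis
  proof (cases "p = 0")
    case True
    have "hom_induced (int p) X {} (discrete_topology {()}) {} (\<lambda>x. ()) (homologous_rel_set p X {} c)
        = homologous_rel_set p (discrete_topology {()}) {} (augment p c)"
      by (rule hom_induced_chain_map[OF _ _ cyc]) auto
    also have "\<dots> = \<one>\<^bsub>homology_group (int p) (discrete_topology {()})\<^esub>"
      using aug True unfolding one_relative_homology_group homologous_rel_set_eq_relboundary by simp
    finally show ?thesis
      using carr by (simp add: carrier_reduced_homology_group kernel_def)
  next
    case False
    then show ?thesis
      using carr by (simp add: un_reduced_homology_group)
  qed
qed

lemma boundary_if_trivial_reduced_homology: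
  assumes triv: "trivial_group (reduced_homology_group (int p) X)"
    and cyc: "singular_relcycle p X {} c" and aug: "1 \<le> p \<or> augment p c = 0"
  obtains d where "singular_chain (Suc p) X d" "chain_boundary (Suc p) d = c"
proof -
  have "homologous_rel_set p X {} c = \<one>\<^bsub>homology_group (int p) X\<^esub>"
    using cycle_class_in_reduced_homology[OF cyc aug] triv by (simp add: trivial_group_def one_reduced_homology_group)
  then have "singular_relboundary p X {} c"
    by (simp add: homologous_rel_set_eq_relboundary)
  then show ?thesis
    using that by (auto simp: singular_boundary)
qed

lemma cycle_class_int_pow:
  assumes "singular_relcycle p X {} c"
  shows "homologous_rel_set p X {} c [^]\<^bsub>homology_group (int p) X\<^esub> (k::int)
    = homologous_rel_set p X {} (frag_cmul k c)"
proof -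
  let ?Z = "relcycle_group p X {}"
  have hom: "(\<lambda>a. homologous_rel_set p X {} a) \<in> hom ?Z (homology_group (int p) X)"
    using normal.r_coset_hom_Mod[OF normal_subgroup_singular_relboundary_relcycle, of p X "{}"]
    by (simp add: right_coset_singular_relboundary nontrivial_relative_homology_group)
  have "homologous_rel_set p X {} c [^]\<^bsub>homology_group (int p) X\<^esub> k
      = homologous_rel_set p X {} (c [^]\<^bsub>?Z\<^esub> k)"
    by (rule hom_int_pow[OF hom, symmetric]) (use assms in auto)
  also have "c [^]\<^bsub>?Z\<^esub> k = c [^]\<^bsub>chain_group p X\<^esub> k"
    using assms unfolding relcycle_group_def
    by (intro group.int_pow_subgroup_generated)
       (simp_all add: carrier_relcycle_group[unfolded relcycle_group_def])
  also have "\<dots> = frag_cmul k c"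
    using assms unfolding chain_group_def
    by (intro int_pow_free_Abelian_group) (simp add: singular_relcycle singular_chain_def)
  finally show ?thesis .
qed

text \<open>The antipodal map is a homeomorphism, so its degree \<open>d\<close> is \<open>1\<close> or \<open>-1\<close>. Only the parity of
  \<open>d\<close> matters in what follows.\<close>

lemma antipode_on_cycle:
  assumes cyc: "singular_relcycle m (nsphere m) {} y" and aug: "1 \<le> m \<or> augment m y = 0"
  obtains d :: int and b where "\<bar>d\<bar> = 1" "singular_chain (Suc m) (nsphere m) b"
    "chain_map m neg_fun y = frag_cmul d y + chain_boundary (Suc m) b"
proof -
  let ?N = "nsphere m"
  define d where "d = Brouwer_degree2 m neg_fun"
  have "homeomorphic_map ?N ?N neg_fun"
    unfolding homeomorphic_map_maps
    by (metis continuous_map_neg_fun neg_fun_involution homeomorphic_maps_involution pointfree_idE)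
  then have d: "\<bar>d\<bar> = 1"
    by (simp add: d_def Brouwer_degree2_homeomorphic_map)
  have "homologous_rel_set m ?N {} (chain_map m neg_fun y)
      = hom_induced m ?N {} ?N {} neg_fun (homologous_rel_set m ?N {} y)"
    by (subst hom_induced_chain_map[OF continuous_map_neg_fun _ cyc]) auto
  also have "\<dots> = homologous_rel_set m ?N {} y [^]\<^bsub>reduced_homology_group (int m) ?N\<^esub> d"
    unfolding d_def by (rule Brouwer_degree2) (rule cycle_class_in_reduced_homology[OF cyc aug])
  also have "\<dots> = homologous_rel_set m ?N {} y [^]\<^bsub>homology_group (int m) ?N\<^esub> d"
    using cycle_class_in_reduced_homology[OF cyc aug] unfolding reduced_homology_group_def
    by (simp add: group.int_pow_subgroup_generated)
  also have "\<dots> = homologous_rel_set m ?N {} (frag_cmul d y)"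
    by (rule cycle_class_int_pow[OF cyc])
  finally have "singular_relboundary m ?N {} (chain_map m neg_fun y - frag_cmul d y)"
    unfolding homologous_rel_set_eq by (simp add: homologous_rel_def)
  then obtain b where "singular_chain (Suc m) ?N b"
      "chain_boundary (Suc m) b = chain_map m neg_fun y - frag_cmul d y"
    by (auto simp: singular_boundary)
  then show ?thesis
    using that[OF d] by (metis add_diff_cancel_left' diff_add_cancel add.commute)
qed

lemma augment_chain_map: "augment p (chain_map p g c) = augment p c"
  using chain_map_compose[of p "\<lambda>_. ()" g] by (simp add: fun_eq_iff o_def)

abbreviation upper_hemisphere :: "nat \<Rightarrow> (nat \<Rightarrow> real) topology" where
  "upper_hemisphere m \<equiv> subtopology (nsphere m) {x. 0 \<le> x m}"

lemma nsphere_in_upper_hemisphere: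
  "nsphere m = subtopology (upper_hemisphere (Suc m)) {x. x (Suc m) = 0}"
proof -
  have "{x. 0 \<le> x (Suc m)} \<inter> {x. x (Suc m) = 0} = {x. x (Suc m) = (0::real)}"
    by auto
  then show ?thesis
    by (simp add: subtopology_nsphere_equator subtopology_subtopology)
qed

lemma singular_chain_equator:
  "singular_chain p (nsphere m) c \<Longrightarrow> singular_chain p (upper_hemisphere (Suc m)) c"
  unfolding nsphere_in_upper_hemisphere[of m] subtopology_subtopology
  by (erule singular_chain_mono) simp

lemma singular_chain_upper_hemisphere:
  "singular_chain p (upper_hemisphere m) c \<Longrightarrow> singular_chain p (nsphere m) c"
  using singular_chain_mono[of p "nsphere m" "{x. 0 \<le> x m}" c UNIV] by simp

definition base_point :: "(nat \<Rightarrow> real) chain" where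
  "base_point = frag_of (restrict (\<lambda>_ i. if i = 0 then 1 else 0) (standard_simplex 0))"

lemma singular_chain_base_point: "singular_chain 0 (upper_hemisphere 0) base_point"
  using in_topspace_nsphere[of 0]
  by (simp add: base_point_def singular_chain_of singular_simplex_def)

text \<open>An explicit resolution of the antipodal action. Starting from a point, \<open>c (i + 1)\<close> is a chain in the
  upper hemisphere that fills the cycle \<open>T (c i) \<plusminus> c i\<close> of its equator; it exists because the
  hemisphere is contractible, and the alternating sign makes the next combination a cycle again.\<close>

lemma hemisphere_chains:
  obtains c where "c 0 = base_point"
    and "\<And>i. singular_chain i (upper_hemisphere i) (c i)"
    and "\<And>i. chain_boundary (Suc i) (c (Suc i)) = skew i ((-1) ^ i) (c i)"
proof -
  define P where "P = (\<lambda>i c. (i = 0 \<longrightarrow> c = base_point) \<and> singular_chain i (upper_hemisphere i) c \<and>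
    chain_boundary i (skew i ((-1) ^ i) c) = 0)"
  have "\<exists>c. \<forall>i. P i (c i) \<and> chain_boundary (Suc i) (c (Suc i)) = skew i ((-1) ^ i) (c i)"
  proof (rule dependent_nat_choice)
    show "\<exists>c. P 0 c"
      using singular_chain_base_point by (auto simp: P_def chain_boundary_def)
  next
    fix c i assume P: "P i c"
    let ?z = "skew i ((-1) ^ i) c"
    have c: "singular_chain i (nsphere i) c"
      using P singular_chain_upper_hemisphere by (auto simp: P_def)
    have z: "singular_chain i (nsphere i) ?z"
      by (rule singular_chain_skew[OF c])
    obtain d where d: "singular_chain (Suc i) (upper_hemisphere (Suc i)) d"
        "chain_boundary (Suc i) d = ?z"
    proof (rule boundary_if_trivial_reduced_homology)
      show "trivial_group (reduced_homology_group (int i) (upper_hemisphere (Suc i)))"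
        by (intro trivial_reduced_homology_group_contractible_space contractible_space_upper_hemisphere) simp
      show "singular_relcycle i (upper_hemisphere (Suc i)) {} ?z"
        using P singular_chain_equator[OF z] by (simp add: singular_cycle P_def)
      show "1 \<le> i \<or> augment i ?z = 0"
        by (cases i) (simp_all add: skew_def chain_map_diff augment_chain_map)
    qed
    have "chain_boundary (Suc i) (skew (Suc i) (- ((-1) ^ i)) d) = skew i (- ((-1) ^ i)) ?z"
      using chain_boundary_skew[OF singular_chain_upper_hemisphere[OF d(1)]] d(2) by simp
    also have "\<dots> = 0"
      using skew_skew[OF c, of "- ((-1) ^ i)"] by (simp flip: power_mult_distrib)
    finally show "\<exists>d. P (Suc i) d \<and> chain_boundary (Suc i) d = ?z"
      using d by (auto simp: P_def)
  qed
  then show ?thesis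
    using that by (auto simp: P_def)
qed

text \<open>The homology class of \<open>z\<close> in the sphere of dimension \<open>m\<close> is divisible by two.\<close>

definition even_class :: "nat \<Rightarrow> (nat \<Rightarrow> real) chain \<Rightarrow> bool" where
  "even_class m z \<longleftrightarrow> (\<exists>y b. singular_relcycle m (nsphere m) {} y \<and> singular_chain (Suc m) (nsphere m) b \<and>
     z = frag_cmul 2 y + chain_boundary (Suc m) b)"

text \<open>A singular 1-simplex in a two-point space is constant, so its two faces coincide.\<close>

lemma chain_boundary_nsphere_0:
  assumes "singular_chain (Suc 0) (nsphere 0) b"
  shows "chain_boundary (Suc 0) b = 0"
  using assms unfolding singular_chain_def
proof (induction b rule: frag_induction)
  case (one \<tau>)
  then have cont: "continuous_map (subtopology (powertop_real UNIV) (standard_simplex 1)) (nsphere 0) \<tau>"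
    by (simp add: singular_simplex_def)
  have val: "\<tau> t 0 = 1 \<or> \<tau> t 0 = -1" "\<And>i. i > 0 \<Longrightarrow> \<tau> t i = 0" if "t \<in> standard_simplex 1" for t
    using continuous_map_image_subset_topspace[OF cont] that
    by (auto simp: nsphere power2_eq_1_iff image_subset_iff)
  have "connectedin euclideanreal ((\<lambda>t. \<tau> t 0) ` standard_simplex 1)"
  proof (rule connectedin_continuous_map_image)
    show "continuous_map (subtopology (powertop_real UNIV) (standard_simplex 1)) euclideanreal (\<lambda>t. \<tau> t 0)"
      using continuous_map_compose[OF cont continuous_map_nsphere_projection[of 0 0]] by (simp add: o_def)
    show "connectedin (subtopology (powertop_real UNIV) (standard_simplex 1)) (standard_simplex 1)"
      using connectedin_standard_simplex[of 1] by (simp add: connectedin_subtopology)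
  qed
  then have conn: "connected ((\<lambda>t. \<tau> t 0) ` standard_simplex 1)"
    by simp
  have "\<tau> t = \<tau> u" if t: "t \<in> standard_simplex 1" and u: "u \<in> standard_simplex 1" for t u
  proof -
    have "\<tau> t 0 = \<tau> u 0"
    proof (rule ccontr)
      assume "\<tau> t 0 \<noteq> \<tau> u 0"
      then have "0 \<in> (\<lambda>t. \<tau> t 0) ` standard_simplex 1"
        using val(1)[OF t] val(1)[OF u] connectedD_interval[OF conn, of "\<tau> t 0" "\<tau> u 0" 0]
          connectedD_interval[OF conn, of "\<tau> u 0" "\<tau> t 0" 0] t u by force
      then show False
        using val(1) by force
    qed
    then show ?thesis
      using val(2)[OF t] val(2)[OF u] by (metis ext gr0I)
  qed
  then have "singular_face 1 0 \<tau> = singular_face 1 1 \<tau>"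
    unfolding singular_face_def
    by (intro restrict_ext) (use simplical_face_in_standard_simplex[of 1] in auto)
  then show ?case
    by (simp add: chain_boundary_of)
qed (simp_all add: chain_boundary_diff)

text \<open>The cycle is the difference of the two points of the sphere, whose coefficients are odd, while
  nothing nonzero is a boundary.\<close>

lemma not_even_class_0: "\<not> even_class 0 (skew 0 1 base_point)"
proof
  assume "even_class 0 (skew 0 1 base_point)"
  then obtain y b where "singular_chain (Suc 0) (nsphere 0) b"
      and eq: "skew 0 1 base_point = frag_cmul 2 y + chain_boundary (Suc 0) b"
    by (auto simp: even_class_def)
  define p :: "(nat \<Rightarrow> real) \<Rightarrow> nat \<Rightarrow> real"
    where "p = restrict (\<lambda>_ i. if i = 0 then 1 else 0) (standard_simplex 0)"
  have "simplex_map 0 neg_fun p (\<lambda>j. if j = 0 then 1 else 0) 0 \<noteq> p (\<lambda>j. if j = 0 then 1 else 0) 0"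
    by (simp add: p_def simplex_map_def standard_simplex_0 neg_fun_def)
  then have "p \<noteq> simplex_map 0 neg_fun p"
    by metis
  then have "poly_mapping.lookup (skew 0 1 base_point) p = -1"
    by (simp add: skew_def base_point_def lookup_minus flip: p_def)
  moreover have "poly_mapping.lookup (skew 0 1 base_point) p = 2 * poly_mapping.lookup y p"
    using \<open>singular_chain (Suc 0) (nsphere 0) b\<close> by (simp add: eq chain_boundary_nsphere_0)
  ultimately show False
    by presburger
qed

text \<open>Modulo chains of the lower hemisphere the cycle \<open>T c - s c\<close> becomes \<open>- s c\<close>. By excision the
  relative homology of the sphere modulo the lower hemisphere is that of the upper hemisphere modulo
  the equator, and the boundary map sends \<open>c\<close> there to \<open>chain_boundary (Suc m) c\<close>. Hence divisibility
  by two would descend to the equator.\<close>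

lemma not_even_class_Suc:
  assumes c: "singular_chain (Suc m) (upper_hemisphere (Suc m)) c"
    and z: "singular_chain m (nsphere m) (chain_boundary (Suc m) c)"
    and odd: "\<not> even_class m (chain_boundary (Suc m) c)"
    and s: "s * s = 1"
  shows "\<not> even_class (Suc m) (skew (Suc m) s c)"
proof
  let ?n = "Suc m"
  let ?S = "nsphere ?n" and ?U = "upper_hemisphere ?n"
  let ?L = "{x :: nat \<Rightarrow> real. x ?n \<le> 0}" and ?E = "{x :: nat \<Rightarrow> real. x ?n = 0}"
  let ?h = "hom_induced (int ?n) ?U ?E ?S ?L id"
  let ?G = "relative_homology_group (int ?n) ?U ?E" and ?H = "relative_homology_group (int ?n) ?S ?L"
  assume "even_class ?n (skew ?n s c)"
  then obtain y b where y: "singular_relcycle ?n ?S {} y" and b: "singular_chain (Suc ?n) ?S b"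
      and eq: "skew ?n s c = frag_cmul 2 y + chain_boundary (Suc ?n) b"
    by (auto simp: even_class_def)
  have iso: "?h \<in> iso ?G ?H"
    by (rule iso_relative_homology_group_upper_hemisphere)
  have h: "?h (homologous_rel_set ?n ?U ?E a) = homologous_rel_set ?n ?S ?L a"
    if "singular_relcycle ?n ?U ?E a" for a
  proof -
    have "chain_map ?n id a = a"
      using that by (intro chain_map_ident[of _ ?U]) (simp add: singular_relcycle)
    then show ?thesis
      by (subst hom_induced_chain_map[OF _ _ that]) (auto intro: continuous_map_from_subtopology)
  qed
  have "singular_relcycle ?n ?S ?L y"
    using y unfolding singular_cycle by (simp add: singular_relcycle)
  then have "homologous_rel_set ?n ?S ?L y \<in> carrier ?H"
    by (simp only: carrier_relative_homology_group) blast
  then have "homologous_rel_set ?n ?S ?L y \<in> ?h ` carrier ?G"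
    using iso by (simp add: iso_iff)
  then obtain y' where y': "singular_relcycle ?n ?U ?E y'"
      and "?h (homologous_rel_set ?n ?U ?E y') = homologous_rel_set ?n ?S ?L y"
    unfolding carrier_relative_homology_group by force
  then have "homologous_rel_set ?n ?S ?L y' = homologous_rel_set ?n ?S ?L y"
    by (simp only: h)
  then have yy': "singular_relboundary ?n ?S ?L (y' - y)"
    unfolding homologous_rel_set_eq by (simp add: homologous_rel_def)
  have cc: "singular_relcycle ?n ?U ?E c"
    using c z by (simp add: singular_relcycle flip: nsphere_in_upper_hemisphere)
  have "singular_chain ?n (subtopology ?S ?L) (chain_map ?n neg_fun c)"
  proof (rule singular_chain_chain_map[OF c])
    show "continuous_map ?U (subtopology ?S ?L) neg_fun"
      by (auto simp: continuous_map_in_subtopology neg_fun_def[abs_def] intro!: continuous_map_from_subtopology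
          continuous_map_neg_fun[unfolded neg_fun_def[abs_def]])
  qed
  then have "singular_relboundary ?n ?S ?L (chain_map ?n neg_fun c)"
    by (rule singular_chain_imp_relboundary)
  moreover have "singular_relboundary ?n ?S ?L (chain_boundary (Suc ?n) b)"
    unfolding singular_relboundary using b by (intro exI[of _ b] exI[of _ 0]) simp
  moreover have "frag_cmul (- s) c - frag_cmul 2 y'
      = - chain_map ?n neg_fun c + chain_boundary (Suc ?n) b - frag_cmul 2 (y' - y)"
  proof -
    have "chain_map ?n neg_fun c = frag_cmul s c + (frag_cmul 2 y + chain_boundary (Suc ?n) b)"
      using eq by (simp add: skew_def algebra_simps)
    then show ?thesis
      by (intro poly_mapping_eqI) (simp add: lookup_add lookup_minus)
  qed
  ultimately have "singular_relboundary ?n ?S ?L (frag_cmul (- s) c - frag_cmul 2 y')"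
    using yy' by (simp only: singular_relboundary_diff singular_relboundary_add singular_relboundary_minus
        singular_relboundary_cmul)
  then have "?h (homologous_rel_set ?n ?U ?E (frag_cmul (- s) c)) = ?h (homologous_rel_set ?n ?U ?E (frag_cmul 2 y'))"
    using cc y' by (simp only: h singular_relcycle_cmul homologous_rel_set_eq) (simp add: homologous_rel_def)
  moreover have "inj_on ?h (carrier ?G)"
    using iso by (simp add: iso_iff)
  moreover have "homologous_rel_set ?n ?U ?E (frag_cmul (- s) c) \<in> carrier ?G"
      "homologous_rel_set ?n ?U ?E (frag_cmul 2 y') \<in> carrier ?G"
    unfolding carrier_relative_homology_group using cc y' singular_relcycle_cmul by blast+
  ultimately have "homologous_rel_set ?n ?U ?E (frag_cmul (- s) c) = homologous_rel_set ?n ?U ?E (frag_cmul 2 y')"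
    by (meson inj_onD)
  then have "singular_relboundary ?n ?U ?E (frag_cmul (- s) c - frag_cmul 2 y')"
    unfolding homologous_rel_set_eq by (simp add: homologous_rel_def)
  then obtain d e where d: "singular_chain (Suc ?n) ?U d" and e: "singular_chain ?n (nsphere m) e"
      and de: "chain_boundary (Suc ?n) d + e = frag_cmul (- s) c - frag_cmul 2 y'"
    by (auto simp: singular_relboundary simp flip: nsphere_in_upper_hemisphere)
  have "chain_boundary ?n e = frag_cmul (- s) (chain_boundary ?n c) - frag_cmul 2 (chain_boundary ?n y')"
    using arg_cong[OF de, of "chain_boundary ?n"] chain_boundary_boundary_alt[OF d]
    by (simp add: chain_boundary_add chain_boundary_diff chain_boundary_cmul)
  then have lookup_e: "poly_mapping.lookup (chain_boundary ?n e) k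
      = - (s * poly_mapping.lookup (chain_boundary ?n c) k) - 2 * poly_mapping.lookup (chain_boundary ?n y') k" for k
    by (simp add: lookup_minus)
  have "chain_boundary ?n c = frag_cmul 2 (frag_cmul (- s) (chain_boundary ?n y')) + chain_boundary ?n (frag_cmul (- s) e)"
  proof (rule poly_mapping_eqI)
    fix k
    have "s * (s * v) = v" for v
      using s by (simp flip: mult.assoc)
    then show "poly_mapping.lookup (chain_boundary ?n c) k = poly_mapping.lookup (frag_cmul 2 (frag_cmul (- s) (chain_boundary ?n y'))
        + chain_boundary ?n (frag_cmul (- s) e)) k"
      by (simp add: chain_boundary_cmul lookup_add lookup_e algebra_simps)
  qed
  moreover have "singular_relcycle m (nsphere m) {} (frag_cmul (- s) (chain_boundary ?n y'))"
  proof (rule singular_relcycle_cmul)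
    have "singular_chain ?n ?U y'" "singular_chain m (nsphere m) (chain_boundary ?n y')"
      using y' by (simp_all add: singular_relcycle flip: nsphere_in_upper_hemisphere)
    then show "singular_relcycle m (nsphere m) {} (chain_boundary ?n y')"
      unfolding singular_cycle by (simp add: chain_boundary_boundary_alt)
  qed
  moreover have "singular_chain ?n (nsphere m) (frag_cmul (- s) e)"
    by (rule singular_chain_cmul[OF e])
  ultimately show False
    using odd unfolding even_class_def by blast
qed

text \<open>The Borsuk--Ulam theorem. An odd map \<open>f\<close> carries the hemisphere chains to chains \<open>c'\<close> with the same
  boundary relations in the smaller sphere. Two such systems in the sphere of dimension \<open>m\<close> differ, up to
  boundaries and up to terms that \<open>T \<plusminus> 1\<close> kills, by an \<open>m\<close>-cycle \<open>y\<close>, which changes the class of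
  \<open>T (c m) \<plusminus> c m\<close> by that of \<open>T y \<plusminus> y\<close>, an even multiple of the class of \<open>y\<close>. For \<open>c'\<close> this class vanishes, because \<open>c' (m + 1)\<close>
  bounds it; for \<open>c\<close> it is odd.\<close>

theorem no_odd_map_to_smaller_sphere:
  assumes f: "continuous_map (nsphere (Suc m)) (nsphere m) f"
    and odd: "\<And>x. x \<in> topspace (nsphere (Suc m)) \<Longrightarrow> f (neg_fun x) = neg_fun (f x)"
  shows False
proof -
  obtain c where c0: "c 0 = base_point" and cU: "\<And>i. singular_chain i (upper_hemisphere i) (c i)"
    and bd: "\<And>i. chain_boundary (Suc i) (c (Suc i)) = skew i ((-1) ^ i) (c i)"
    by (rule hemisphere_chains) (rule that)
  have c: "singular_chain i (nsphere j) (c i)" if "i \<le> j" for i j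
    using that
  proof (induction j rule: dec_induct)
    case base
    show ?case by (rule singular_chain_upper_hemisphere[OF cU])
  next
    case (step j)
    then show ?case
      by (simp add: singular_chain_upper_hemisphere[OF singular_chain_equator])
  qed
  have not_even: "\<not> even_class i (skew i ((-1) ^ i) (c i))" for i
  proof (induction i)
    case 0
    show ?case using not_even_class_0 by (simp add: c0)
  next
    case (Suc i)
    show ?case
      by (rule not_even_class_Suc[OF cU])
         (use Suc in \<open>simp_all add: bd singular_chain_skew c flip: power_mult_distrib\<close>)
  qed
  define c' where "c' i = chain_map i f (c i)" for i
  have c': "singular_chain i (nsphere m) (c' i)" if "i \<le> Suc m" for i
    unfolding c'_def by (rule singular_chain_chain_map[OF c[OF that] f])
  have bd': "chain_boundary (Suc i) (c' (Suc i)) = skew i ((-1) ^ i) (c' i)" if "i \<le> m" for i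
    using c[of "Suc i" "Suc m"] c[of i "Suc m"] that
    by (simp add: c'_def chain_boundary_chain_map bd skew_chain_map[where f = f and n = "Suc m", OF _ odd])
  have aug0: "augment 0 (c' 0 - c 0) = 0"
    by (simp add: c'_def chain_map_diff augment_chain_map)
  have compare: "\<exists>d y. singular_chain i (nsphere m) d \<and> singular_relcycle i (nsphere m) {} y \<and>
      (1 \<le> i \<or> augment i y = 0) \<and> c' i - c i = skew i (- ((-1) ^ i)) d + y" if "i \<le> m" for i
    using that
  proof (induction i)
    case 0
    then show ?case
      using c[of 0 m] c'[of 0] aug0
      by (intro exI[of _ 0] exI[of _ "c' 0 - c 0"])
        (simp add: singular_cycle singular_chain_diff skew_def chain_boundary_def)
  next
    case (Suc i)
    then obtain d y where d: "singular_chain i (nsphere m) d" and y: "singular_relcycle i (nsphere m) {} y"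
        "1 \<le> i \<or> augment i y = 0" and eq: "c' i - c i = skew i (- ((-1) ^ i)) d + y"
      by auto
    obtain e where e: "singular_chain (Suc i) (nsphere m) e" "chain_boundary (Suc i) e = y"
      by (rule boundary_if_trivial_reduced_homology[OF _ y])
        (use Suc in \<open>simp add: trivial_reduced_homology_group_nsphere\<close>)
    \<comment> \<open>The sign of \<open>skew\<close> at level \<open>i + 1\<close> is \<open>- (-1) ^ (i + 1)\<close>, that is \<open>(-1) ^ i\<close>, so that the boundaries
      cancel.\<close>
    let ?w = "c' (Suc i) - c (Suc i) - skew (Suc i) ((-1) ^ i) e"
    have "chain_boundary (Suc i) ?w = skew i ((-1) ^ i) (c' i - c i) - skew i ((-1) ^ i) y"
      using Suc by (simp add: chain_boundary_diff bd bd' chain_boundary_skew[OF e(1)] e(2) skew_diff)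
    also have "\<dots> = skew i ((-1) ^ i) (skew i (- ((-1) ^ i)) d)"
      unfolding eq by (simp add: skew_add)
    also have "\<dots> = 0"
      by (rule skew_skew[OF d]) (simp flip: power_mult_distrib)
    finally have "singular_relcycle (Suc i) (nsphere m) {} ?w"
      using Suc c[of "Suc i" m] c'[of "Suc i"] e(1)
      by (simp add: singular_cycle singular_chain_diff singular_chain_skew)
    then show ?case
      using e(1) by (intro exI[of _ e] exI[of _ ?w]) simp
  qed
  then obtain d y where d: "singular_chain m (nsphere m) d" and y: "singular_relcycle m (nsphere m) {} y"
      "1 \<le> m \<or> augment m y = 0" and eq: "c' m - c m = skew m (- ((-1) ^ m)) d + y"
    by blast
  obtain t b where t: "\<bar>t\<bar> = 1" and b: "singular_chain (Suc m) (nsphere m) b"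
      and ty: "chain_map m neg_fun y = frag_cmul t y + chain_boundary (Suc m) b"
    by (rule antipode_on_cycle[OF y])
  have "even (t - (-1) ^ m)"
    using t by (auto simp: abs_if minus_one_power_iff split: if_splits)
  then obtain r where r: "t - (-1) ^ m = 2 * r"
    by blast
  have "skew m ((-1) ^ m) (c' m - c m) = skew m ((-1) ^ m) y"
    unfolding eq using skew_skew[OF d, of "(-1) ^ m"] by (simp add: skew_add flip: power_mult_distrib)
  also have "\<dots> = frag_cmul (2 * r) y + chain_boundary (Suc m) b"
    unfolding skew_def ty r[symmetric] by (simp add: frag_cmul_diff_distrib)
  finally have "skew m ((-1) ^ m) (c m) = chain_boundary (Suc m) (c' (Suc m)) - (frag_cmul (2 * r) y + chain_boundary (Suc m) b)"
    by (simp add: skew_diff bd' algebra_simps)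
  also have "\<dots> = frag_cmul 2 (frag_cmul (- r) y) + chain_boundary (Suc m) (c' (Suc m) - b)"
    by (intro poly_mapping_eqI) (simp add: chain_boundary_diff lookup_add lookup_minus)
  finally have "even_class m (skew m ((-1) ^ m) (c m))"
    unfolding even_class_def using y(1) b c'[of "Suc m"]
    by (blast intro: singular_relcycle_cmul singular_chain_diff)
  then show False
    using not_even by blast
qed

lemma continuous_map_nsphere_id:
  assumes "j \<le> k"
  shows "continuous_map (nsphere j) (nsphere k) id"
proof -
  have "(\<Sum>i\<le>k. (x i)\<^sup>2) = (\<Sum>i\<le>j. (x i)\<^sup>2)" if "\<forall>i>j. x i = 0" for x :: "nat \<Rightarrow> real"
    using assms that by (intro sum.mono_neutral_right) auto
  then show ?thesis
    using assms by (auto simp: nsphere continuous_map_in_subtopology intro!: continuous_map_from_subtopology)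
qed

lemma continuous_map_normalize:
  "continuous_map (subtopology (Euclidean_space (Suc n)) {x. \<exists>i\<le>n. x i \<noteq> 0}) (nsphere n)
     (\<lambda>x i. x i / sqrt (\<Sum>j\<le>n. (x j)\<^sup>2))"
  unfolding Euclidean_space_def nsphere subtopology_subtopology continuous_map_in_subtopology
proof (intro continuous_intros conjI)
  show "continuous_map
     (subtopology (powertop_real UNIV) ({x. \<forall>i\<ge>Suc n. x i = 0} \<inter> {x. \<exists>i\<le>n. x i \<noteq> 0}))
     (powertop_real UNIV) (\<lambda>x i. x i / sqrt (\<Sum>j\<le>n. (x j)\<^sup>2))"
    unfolding continuous_map_componentwise
    by (intro continuous_intros conjI ballI) (auto simp: sum_nonneg_eq_0_iff)
next
  have "(\<Sum>i\<le>n. (x i / sqrt (\<Sum>j\<le>n. (x j)\<^sup>2))\<^sup>2) = 1" if "i \<le> n" "x i \<noteq> 0" for i and x :: "nat \<Rightarrow> real"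
    using that by (force simp: sum_nonneg sum_nonneg_eq_0_iff field_split_simps simp flip: sum_divide_distrib)
  then show "(\<lambda>x i. x i / sqrt (\<Sum>j\<le>n. (x j)\<^sup>2)) \<in>
      topspace (subtopology (powertop_real UNIV) ({x. \<forall>i\<ge>Suc n. x i = 0} \<inter> {x. \<exists>i\<le>n. x i \<noteq> 0}))
      \<rightarrow> {x. (\<Sum>i\<le>n. (x i)\<^sup>2) = 1 \<and> (\<forall>i>n. x i = 0)}"
    by auto
qed

text \<open>If \<open>A\<close> had genus at most \<open>k\<close>, composing with \<open>\<psi>\<close>, restricting to a subsphere and normalising would
  give an odd map that lowers the dimension of a sphere by one.\<close>

lemma genus_of_sphere_image:
  assumes cont: "continuous_map (nsphere k) (top_of_set A) \<psi>"
    and odd: "\<And>x. x \<in> topspace (nsphere k) \<Longrightarrow> \<psi> (neg_fun x) = (\<lambda>v. - \<psi> x v)"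
  shows "enat (Suc k) \<le> genus A"
proof -
  have im: "\<psi> x \<in> A" if "x \<in> topspace (nsphere k)" for x
    using continuous_map_image_subset_topspace[OF cont] that by auto
  then have "A \<noteq> {}" using in_topspace_nsphere[of k] by blast
  moreover have "Suc k \<le> j" if "0 < j" and \<phi>: "continuous_map (top_of_set A) (Euclidean_space j) \<phi>"
      "\<forall>f\<in>A. \<phi> f \<noteq> (\<lambda>_. 0)" "\<forall>f\<in>A. \<phi> (\<lambda>x. - f x) = (\<lambda>i. - \<phi> f i)" for j \<phi>
  proof (rule ccontr)
    assume "\<not> Suc k \<le> j"
    obtain m where j: "j = Suc m" using \<open>0 < j\<close> gr0_implies_Suc by blast
    let ?N = "\<lambda>(x :: nat \<Rightarrow> real) i. x i / sqrt (\<Sum>j\<le>m. (x j)\<^sup>2)"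
    have id: "continuous_map (nsphere (Suc m)) (nsphere k) id"
      using \<open>\<not> Suc k \<le> j\<close> j by (intro continuous_map_nsphere_id) simp
    then have sub: "x \<in> topspace (nsphere k)" if "x \<in> topspace (nsphere (Suc m))" for x
      using continuous_map_image_subset_topspace[OF id] that by auto
    have \<phi>\<psi>: "continuous_map (nsphere (Suc m)) (Euclidean_space (Suc m)) (\<phi> \<circ> \<psi>)"
      using continuous_map_compose[OF continuous_map_compose[OF id cont] \<phi>(1)] by (simp add: j)
    have "continuous_map (nsphere (Suc m)) (subtopology (Euclidean_space (Suc m)) {x. \<exists>i\<le>m. x i \<noteq> 0}) (\<phi> \<circ> \<psi>)"
      unfolding continuous_map_in_subtopology
    proof (intro conjI \<phi>\<psi> funcsetI CollectI)
      fix x assume x: "x \<in> topspace (nsphere (Suc m))"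
      have "\<forall>i\<ge>Suc m. (\<phi> \<circ> \<psi>) x i = 0"
        using continuous_map_image_subset_topspace[OF \<phi>\<psi>] x by (auto simp: topspace_Euclidean_space)
      moreover have "(\<phi> \<circ> \<psi>) x \<noteq> (\<lambda>_. 0)"
        using \<phi>(2) im[OF sub[OF x]] by auto
      ultimately show "\<exists>i\<le>m. (\<phi> \<circ> \<psi>) x i \<noteq> 0"
        by (metis ext not_less_eq_eq)
    qed
    from continuous_map_compose[OF this continuous_map_normalize]
    have "continuous_map (nsphere (Suc m)) (nsphere m) (?N \<circ> (\<phi> \<circ> \<psi>))" .
    moreover have "(?N \<circ> (\<phi> \<circ> \<psi>)) (neg_fun x) = neg_fun ((?N \<circ> (\<phi> \<circ> \<psi>)) x)"
      if "x \<in> topspace (nsphere (Suc m))" for x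
      using odd[OF sub[OF that]] \<phi>(3) im[OF sub[OF that]] by (simp add: neg_fun_def)
    ultimately show False
      by (rule no_odd_map_to_smaller_sphere)
  qed
  ultimately show ?thesis
    by (auto simp: genus_def intro!: Inf_greatest)
qed

lemma compactin_nsphere: "compactin (nsphere n) (topspace (nsphere n))"
proof -
  let ?S = "{x. (\<Sum>i\<le>n. (x i)\<^sup>2) = (1::real) \<and> (\<forall>i>n. x i = 0)}"
  have "compactin (powertop_real UNIV) ?S"
  proof (rule closed_compactin)
    show "compactin (powertop_real UNIV) (UNIV \<rightarrow>\<^sub>E {-1..1})"
      by (simp add: compactin_PiE)
    have "\<bar>x i\<bar> \<le> 1" if "x \<in> ?S" for x i
      using topspace_nsphere_1[of x n i] that by (simp add: nsphere abs_square_le_1)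
    then show "?S \<subseteq> UNIV \<rightarrow>\<^sub>E {-1..1}"
      by (auto simp: abs_le_iff PiE_iff)
    have "closed ({x. (\<Sum>i\<le>n. (x i)\<^sup>2) = (1::real)} \<inter> (\<Inter>i\<in>{n<..}. {x. x i = 0}))"
      by (intro closed_Int closed_INT ballI closed_Collect_eq continuous_intros continuous_on_product_coordinates)
    moreover have "{x. (\<Sum>i\<le>n. (x i)\<^sup>2) = (1::real)} \<inter> (\<Inter>i\<in>{n<..}. {x. x i = 0}) = ?S"
      by auto
    ultimately show "closedin (powertop_real UNIV) ?S"
      by (simp add: euclidean_product_topology)
  qed
  then show ?thesis
    by (simp add: nsphere compactin_subtopology)
qed

section \<open>Functionals dominated by sums of absolute values\<close>

text \<open>A Hahn--Banach theorem in coordinates: a linear functional below \<open>\<Sum>e. \<bar>a e\<bar>\<close> is a combination of the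
  functionals \<open>a e\<close> with coefficients in \<open>[-1, 1]\<close>. Equivalently, the subdifferential at \<open>0\<close> of a sum of
  absolute values is the sum of their subdifferentials. The functionals \<open>a e\<close> are split off one at
  a time.\<close>

lemma linear_functional_below_abs_sum:
  fixes a :: "'e \<Rightarrow> 'v \<Rightarrow> real" and \<phi> :: "'v \<Rightarrow> real"
  assumes "finite E" "finite V"
    and "\<And>g. (\<Sum>x\<in>V. \<phi> x * g x) \<le> (\<Sum>e\<in>E. \<bar>\<Sum>x\<in>V. a e x * g x\<bar>)"
  shows "\<exists>\<zeta>. (\<forall>e\<in>E. \<bar>\<zeta> e\<bar> \<le> 1) \<and> (\<forall>x\<in>V. \<phi> x = (\<Sum>e\<in>E. \<zeta> e * a e x))"
  using assms(1,3)
proof (induction E arbitrary: \<phi> rule: finite_induct)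
  case empty
  have "\<phi> x = 0" if "x \<in> V" for x
  proof -
    have "(\<Sum>y\<in>V. \<phi> y * (if y = x then \<phi> x else 0)) \<le> 0"
      using empty[of "\<lambda>y. if y = x then \<phi> x else 0"] by simp
    moreover have "(\<Sum>y\<in>V. \<phi> y * (if y = x then \<phi> x else 0)) = (\<Sum>y\<in>V. if y = x then \<phi> x * \<phi> x else 0)"
      by (rule sum.cong) auto
    ultimately have "\<phi> x * \<phi> x \<le> 0"
      using that assms(2) by simp
    then show ?thesis
      by (metis mult_le_0_iff order.antisym)
  qed
  then show ?case by simp
next
  case (insert e E)
  define dot where "dot u g = (\<Sum>x\<in>V. u x * g x)" for u g :: "'v \<Rightarrow> real"
  define q where "q g = (\<Sum>e\<in>E. \<bar>dot (a e) g\<bar>)" for g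
  have le: "dot \<phi> g \<le> \<bar>dot (a e) g\<bar> + q g" for g
    using insert.prems[of g] insert.hyps by (simp add: dot_def q_def)
  have dot_add: "dot u (\<lambda>x. g x + h x) = dot u g + dot u h"
    and dot_scale: "dot u (\<lambda>x. c * g x) = c * dot u g" for u g h c
    by (simp_all add: dot_def algebra_simps sum.distrib sum_distrib_left)
  have q_scale: "q (\<lambda>x. c * g x) = c * q g" if "c \<ge> 0" for c g
    using that by (simp add: q_def dot_scale abs_mult sum_distrib_left)
  have q_add: "q (\<lambda>x. g x + h x) \<le> q g + q h" for g h
    unfolding q_def sum.distrib[symmetric] dot_add by (intro sum_mono abs_triangle_ineq)
  have "\<exists>t. \<bar>t\<bar> \<le> 1 \<and> (\<forall>g. dot \<phi> g - t * dot (a e) g \<le> q g)"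
  proof (cases "\<exists>g. dot (a e) g \<noteq> 0")
    case False
    then show ?thesis
      using le by (intro exI[of _ 0]) (metis abs_zero add_0 diff_zero mult_zero_left zero_le_one)
  next
    case True
    then obtain g0 where "dot (a e) g0 \<noteq> 0" by blast
    then have g0: "dot (a e) (\<lambda>x. (1 / dot (a e) g0) * g0 x) = 1"
      unfolding dot_scale by simp
    define S where "S = {dot \<phi> g - q g | g. dot (a e) g = 1}"
    have "S \<noteq> {}"
      using g0 by (auto simp: S_def)
    have S1: "s \<le> 1" if "s \<in> S" for s
    proof -
      obtain g where "dot (a e) g = 1" "s = dot \<phi> g - q g" using \<open>s \<in> S\<close> by (auto simp: S_def)
      then show ?thesis using le[of g] by simp
    qed
    then have bdd: "bdd_above S"
      by (meson bdd_aboveI)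
    \<comment> \<open>The inequality \<open>dot \<phi> g - t * dot (a e) g \<le> q g\<close> at vectors with \<open>dot (a e) g = 1\<close> asks for
      \<open>Sup S \<le> t\<close>; at those with value \<open>-1\<close> it only bounds \<open>t\<close> from above, so the least \<open>t\<close> in \<open>[-1, 1]\<close> works.\<close>
    define t where "t = max (-1) (Sup S)"
    have "Sup S \<le> 1"
      using \<open>S \<noteq> {}\<close> S1 by (meson cSup_least)
    then have t1: "\<bar>t\<bar> \<le> 1"
      by (auto simp: t_def)
    have "dot \<phi> g - t * dot (a e) g \<le> q g" for g
    proof -
      consider "dot (a e) g = 0" | "dot (a e) g > 0" | "dot (a e) g < 0"
        by linarith
      then show ?thesis
      proof cases
        case 1
        then show ?thesis using le[of g] by simp
      next
        case 2
        define r where "r = dot (a e) g"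
        have "r > 0" using 2 by (simp add: r_def)
        let ?g = "\<lambda>x. (1 / r) * g x"
        have "dot (a e) ?g = 1"
          unfolding dot_scale using \<open>r > 0\<close> by (simp add: r_def)
        then have "dot \<phi> ?g - q ?g \<le> Sup S"
          using bdd by (intro cSup_upper) (auto simp: S_def)
        also have "\<dots> \<le> t" by (simp add: t_def)
        finally have "(1 / r) * dot \<phi> g - (1 / r) * q g \<le> t"
          using \<open>r > 0\<close> q_scale[of "1 / r" g] unfolding dot_scale by simp
        then have "(dot \<phi> g - q g) / r \<le> t"
          by (simp add: diff_divide_distrib)
        then show ?thesis
          using \<open>r > 0\<close> by (simp add: r_def pos_divide_le_eq algebra_simps)
      next
        case 3
        define r where "r = - dot (a e) g"
        have "r > 0" and dot_g: "dot (a e) g = - r" using 3 by (simp_all add: r_def)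
        define h where "h = (\<lambda>x. (1 / r) * g x)"
        have h: "dot (a e) h = -1"
          unfolding h_def dot_scale using \<open>r > 0\<close> by (simp add: r_def)
        have "s \<le> q h - dot \<phi> h" if "s \<in> S" for s
        proof -
          obtain g' where g': "dot (a e) g' = 1" "s = dot \<phi> g' - q g'"
            using \<open>s \<in> S\<close> by (auto simp: S_def)
          have "dot \<phi> g' + dot \<phi> h \<le> q (\<lambda>x. g' x + h x)"
            using le[of "\<lambda>x. g' x + h x"] g' h by (simp add: dot_add)
          also have "\<dots> \<le> q g' + q h" by (rule q_add)
          finally show ?thesis using g' by simp
        qed
        then have "Sup S \<le> q h - dot \<phi> h"
          using \<open>S \<noteq> {}\<close> by (meson cSup_least)
        moreover have "-1 \<le> q h - dot \<phi> h"
          using le[of h] h by simp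
        ultimately have "t \<le> q h - dot \<phi> h"
          by (simp add: t_def)
        then have "t \<le> (1 / r) * q g - (1 / r) * dot \<phi> g"
          using \<open>r > 0\<close> q_scale[of "1 / r" g] unfolding h_def dot_scale by simp
        then have "t \<le> (q g - dot \<phi> g) / r"
          by (simp add: diff_divide_distrib)
        then show ?thesis
          using \<open>r > 0\<close> dot_g by (simp add: pos_le_divide_eq algebra_simps)
      qed
    qed
    then show ?thesis using t1 by blast
  qed
  then obtain t where t: "\<bar>t\<bar> \<le> 1" "\<And>g. dot \<phi> g - t * dot (a e) g \<le> q g"
    by blast
  have "(\<Sum>x\<in>V. (\<phi> x - t * a e x) * g x) \<le> (\<Sum>e\<in>E. \<bar>\<Sum>x\<in>V. a e x * g x\<bar>)" for g
    using t(2)[of g] by (simp add: dot_def q_def algebra_simps sum_subtractf sum_distrib_left)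
  from insert.IH[OF this] obtain \<zeta> where \<zeta>: "\<forall>e\<in>E. \<bar>\<zeta> e\<bar> \<le> 1"
      "\<forall>x\<in>V. \<phi> x - t * a e x = (\<Sum>e\<in>E. \<zeta> e * a e x)"
    by blast
  have "(\<Sum>e'\<in>E. (\<zeta>(e := t)) e' * a e' x) = (\<Sum>e\<in>E. \<zeta> e * a e x)" for x
    using insert.hyps by (intro sum.cong) auto
  then show ?case
    using \<zeta> t(1) insert.hyps by (intro exI[of _ "\<zeta>(e := t)"]) (auto simp: diff_eq_eq)
qed

section \<open>Total variation on a signed graph\<close>

definition vertex_volume :: "'v signed_graph \<Rightarrow> 'v set \<Rightarrow> real" where
  "vertex_volume G A = (\<Sum>x\<in>A. mass G x)"

definition arcs :: "'v signed_graph \<Rightarrow> ('v \<times> 'v) set" where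
  "arcs G = {(x, y). {x, y} \<in> edges G}"

text \<open>Every edge is counted through its two orientations, which have the same absolute tension.\<close>

definition tension :: "'v signed_graph \<Rightarrow> ('v \<Rightarrow> real) \<Rightarrow> 'v \<times> 'v \<Rightarrow> real" where
  "tension G f = (\<lambda>(x, y). f x - signature G {x, y} * f y)"

definition arc_weight :: "'v signed_graph \<Rightarrow> 'v \<times> 'v \<Rightarrow> real" where
  "arc_weight G = (\<lambda>(x, y). weight G {x, y})"

definition total_variation :: "'v signed_graph \<Rightarrow> ('v \<Rightarrow> real) \<Rightarrow> real" where
  "total_variation G f = 1/2 * (\<Sum>e\<in>arcs G. arc_weight G e * \<bar>tension G f e\<bar>)"

definition mass_norm :: "'v signed_graph \<Rightarrow> ('v \<Rightarrow> real) \<Rightarrow> real" where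
  "mass_norm G f = (\<Sum>x\<in>verts G. mass G x * \<bar>f x\<bar>)"

definition signed_indicator :: "'v set \<Rightarrow> 'v set \<Rightarrow> 'v \<Rightarrow> real" where
  "signed_indicator P Q x = (if x \<in> P then 1 else if x \<in> Q then -1 else 0)"

definition component_sets :: "'v signed_graph \<Rightarrow> 'v set set" where
  "component_sets G = verts G // {(x, y). {x, y} \<in> edges G}\<^sup>*"

text \<open>On \<open>K\<close> the substitution \<open>u x = \<tau> x * f x\<close> turns the signed graph into an unsigned one:
  \<open>\<bar>f x - \<sigma> * f y\<bar> = \<bar>u x - u y\<bar>\<close> along each edge.\<close>

definition switching :: "'v signed_graph \<Rightarrow> 'v set \<Rightarrow> ('v \<Rightarrow> real) \<Rightarrow> bool" where
  "switching G K \<tau> \<longleftrightarrow> (\<forall>x\<in>K. \<tau> x \<in> {-1, 1}) \<and>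
     (\<forall>x\<in>K. \<forall>y. {x, y} \<in> edges G \<longrightarrow> signature G {x, y} = \<tau> x * \<tau> y)"

definition restrict_to :: "'v set \<Rightarrow> ('v \<Rightarrow> real) \<Rightarrow> 'v \<Rightarrow> real" where
  "restrict_to K f x = (if x \<in> K then f x else 0)"

text \<open>For \<open>\<sigma> = 1\<close> this holds since on the values concerned both \<open>a \<mapsto> m * sgn a\<close> and
  \<open>a \<mapsto> a - m * sgn a\<close> are nondecreasing, so the two differences have the same sign; both maps are odd,
  which reduces \<open>\<sigma> = -1\<close> to this case.\<close>

lemma abs_diff_peel_layer:
  fixes a b m \<sigma> :: real
  assumes "\<sigma> = 1 \<or> \<sigma> = -1" "0 < m" and a: "a = 0 \<or> m \<le> \<bar>a\<bar>" and b: "b = 0 \<or> m \<le> \<bar>b\<bar>"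
  shows "\<bar>a - \<sigma> * b\<bar> = m * \<bar>sgn a - \<sigma> * sgn b\<bar> + \<bar>(a - m * sgn a) - \<sigma> * (b - m * sgn b)\<bar>"
proof -
  have *: "\<bar>a - c\<bar> = m * \<bar>sgn a - sgn c\<bar> + \<bar>(a - m * sgn a) - (c - m * sgn c)\<bar>"
    if c: "c = 0 \<or> m \<le> \<bar>c\<bar>" for c
  proof -
    have "sgn a = 0 \<and> a = 0 \<or> sgn a = 1 \<and> m \<le> a \<or> sgn a = -1 \<and> a \<le> - m"
      "sgn c = 0 \<and> c = 0 \<or> sgn c = 1 \<and> m \<le> c \<or> sgn c = -1 \<and> c \<le> - m"
      using a c \<open>0 < m\<close> by (auto simp: sgn_if)
    then show ?thesis
      using \<open>0 < m\<close> by (elim disjE conjE) (simp_all add: abs_if)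
  qed
  have "sgn (\<sigma> * b) = \<sigma> * sgn b"
    using assms(1) by auto
  then show ?thesis
    using *[of "\<sigma> * b"] assms(1) b by (auto simp: algebra_simps)
qed

text \<open>\<open>Sgn\<close> is the subdifferential of the absolute value.\<close>

lemma Sgn_iff: "s \<in> Sgn a \<longleftrightarrow> \<bar>s\<bar> \<le> 1 \<and> s * a = \<bar>a\<bar>"
proof -
  have "s * a = - a \<longleftrightarrow> s = -1" if "a < 0"
    using that by (metis less_irrefl mult_cancel_right mult_minus1)
  then show ?thesis
    by (cases a "0::real" rule: linorder_cases) (auto simp: Sgn_def)
qed

locale weighted_signed_graph =
  fixes G :: "'v signed_graph"
  assumes wf: "wf_signed_graph G"
begin

lemma finite_verts: "finite (verts G)"
  using wf by (simp add: wf_signed_graph_def)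

lemma mass_pos: "x \<in> verts G \<Longrightarrow> 0 < mass G x"
  using wf by (simp add: wf_signed_graph_def)

lemma arc_in_verts: "(x, y) \<in> arcs G \<Longrightarrow> x \<in> verts G \<and> y \<in> verts G"
  using wf by (fastforce simp: wf_signed_graph_def arcs_def doubleton_eq_iff)

lemma finite_arcs: "finite (arcs G)"
  by (rule finite_subset[of _ "verts G \<times> verts G"]) (use arc_in_verts finite_verts in auto)

lemma arc_sym: "(x, y) \<in> arcs G \<Longrightarrow> (y, x) \<in> arcs G"
  by (simp add: arcs_def insert_commute)

lemma arc_weight_pos: "e \<in> arcs G \<Longrightarrow> 0 < arc_weight G e"
  using wf by (auto simp: wf_signed_graph_def arcs_def arc_weight_def)

lemma signature_cases: "(x, y) \<in> arcs G \<Longrightarrow> signature G {x, y} = 1 \<or> signature G {x, y} = -1"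
  using wf by (auto simp: wf_signed_graph_def arcs_def)

lemma arcs_eq_Sigma: "arcs G = Sigma (verts G) (nbrs G)"
  using arc_in_verts by (auto simp: arcs_def nbrs_def)

lemma finite_nbrs: "finite (nbrs G x)"
  by (rule finite_subset[of _ "verts G"]) (use arc_in_verts finite_verts in \<open>auto simp: nbrs_def arcs_def\<close>)

lemma sum_nbrs: "(\<Sum>x\<in>verts G. \<Sum>y\<in>nbrs G x. F x y) = (\<Sum>(x, y)\<in>arcs G. F x y)"
  unfolding arcs_eq_Sigma by (rule sum.Sigma) (auto simp: finite_verts finite_nbrs)

lemma sum_arcs_swap: "(\<Sum>(x, y)\<in>arcs G. F x y) = (\<Sum>(x, y)\<in>arcs G. F y x)"
  by (rule sum.reindex_bij_witness[of _ "\<lambda>(x, y). (y, x)" "\<lambda>(x, y). (y, x)"]) (auto intro: arc_sym)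

lemma rayleigh_eq: "rayleigh G f = total_variation G f / mass_norm G f"
  unfolding rayleigh_def total_variation_def mass_norm_def sum_nbrs
  by (simp add: arc_weight_def tension_def case_prod_unfold)

lemma total_variation_nonneg: "0 \<le> total_variation G f"
  unfolding total_variation_def using arc_weight_pos
  by (intro mult_nonneg_nonneg sum_nonneg) (auto intro: less_imp_le)

lemma volume_pos: "A \<subseteq> verts G \<Longrightarrow> A \<noteq> {} \<Longrightarrow> 0 < vertex_volume G A"
  unfolding vertex_volume_def by (intro sum_pos) (auto intro: finite_subset[OF _ finite_verts] mass_pos)

lemma volume_mono: "A \<subseteq> B \<Longrightarrow> B \<subseteq> verts G \<Longrightarrow> vertex_volume G A \<le> vertex_volume G B"
  unfolding vertex_volume_def by (intro sum_mono2) (auto intro: finite_subset[OF _ finite_verts] less_imp_le mass_pos)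

lemma volume_Diff: "A \<subseteq> B \<Longrightarrow> B \<subseteq> verts G \<Longrightarrow> vertex_volume G (B - A) = vertex_volume G B - vertex_volume G A"
  unfolding vertex_volume_def by (intro sum_diff) (auto intro: finite_subset[OF _ finite_verts])

lemma mass_norm_pos:
  assumes "x \<in> verts G" "f x \<noteq> 0"
  shows "0 < mass_norm G f"
  unfolding mass_norm_def
  by (rule sum_pos2[OF finite_verts assms(1)])
    (use assms mass_pos in \<open>auto intro!: mult_nonneg_nonneg less_imp_le[OF mass_pos]\<close>)

lemma edge_vol_eq:
  assumes "U \<subseteq> verts G"
  shows "edge_vol G s U W = (\<Sum>(x, y)\<in>arcs G. weight G {x, y} *
    (if x \<in> U \<and> y \<in> W \<and> signature G {x, y} = s then 1 else 0))"
proof -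
  have "edge_vol G s U W = (\<Sum>x\<in>U. \<Sum>y\<in>nbrs G x. if y \<in> W \<and> signature G {x, y} = s then weight G {x, y} else 0)"
    unfolding edge_vol_def
    by (intro sum.cong refl sum.mono_neutral_cong_left) (auto simp: finite_nbrs)
  also have "\<dots> = (\<Sum>x\<in>verts G. \<Sum>y\<in>nbrs G x. weight G {x, y} *
      (if x \<in> U \<and> y \<in> W \<and> signature G {x, y} = s then 1 else 0))"
    by (intro sum.mono_neutral_cong_left) (use assms finite_verts in \<open>auto simp: finite_nbrs intro!: sum.cong\<close>)
  finally show ?thesis
    by (simp only: sum_nbrs)
qed

lemma boundary_vol_eq:
  assumes "U \<subseteq> verts G"
  shows "boundary_vol G U = (\<Sum>(x, y)\<in>arcs G. weight G {x, y} * (if x \<in> U \<and> y \<notin> U then 1 else 0))"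
proof -
  have "boundary_vol G U = (\<Sum>x\<in>U. \<Sum>y\<in>nbrs G x. if y \<notin> U then weight G {x, y} else 0)"
    unfolding boundary_vol_def
    by (intro sum.cong refl sum.mono_neutral_cong_left) (auto simp: finite_nbrs)
  also have "\<dots> = (\<Sum>x\<in>verts G. \<Sum>y\<in>nbrs G x. weight G {x, y} * (if x \<in> U \<and> y \<notin> U then 1 else 0))"
    by (intro sum.mono_neutral_cong_left) (use assms finite_verts in \<open>auto simp: finite_nbrs intro!: sum.cong\<close>)
  finally show ?thesis
    by (simp only: sum_nbrs)
qed

text \<open>Along an edge \<open>\<bar>f x - \<sigma> * f y\<bar>\<close> with \<open>f = 1\<^sub>P - 1\<^sub>Q\<close> is \<open>2\<close> for a positive edge
  between \<open>P\<close> and \<open>Q\<close> or a negative edge inside \<open>P\<close> or inside \<open>Q\<close>, and \<open>1\<close> for an edge leaving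
  \<open>P \<union> Q\<close>. The proof compares the two orientations of an edge together, as the summands of the
  numerator are not symmetric individually.\<close>

lemma signed_beta_eq:
  assumes P: "P \<subseteq> verts G" and Q: "Q \<subseteq> verts G" and PQ: "P \<inter> Q = {}"
  shows "signed_beta G P Q = total_variation G (signed_indicator P Q) / vertex_volume G (P \<union> Q)"
proof -
  define c where "c x y = 2 * (if x \<in> P \<and> y \<in> Q \<and> signature G {x, y} = 1 then 1 else (0::real))
    + (if x \<in> P \<and> y \<in> P \<and> signature G {x, y} = -1 then 1 else 0)
    + (if x \<in> Q \<and> y \<in> Q \<and> signature G {x, y} = -1 then 1 else 0)
    + (if x \<in> P \<union> Q \<and> y \<notin> P \<union> Q then 1 else 0)" for x y
  define T where "T = (\<Sum>(x, y)\<in>arcs G. weight G {x, y} * c x y)"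
  have num: "2 * edge_vol G 1 P Q + edge_vol G (-1) P P + edge_vol G (-1) Q Q + boundary_vol G (P \<union> Q) = T"
    unfolding edge_vol_eq[OF P] edge_vol_eq[OF Q] boundary_vol_eq[OF Un_least[OF P Q]] T_def c_def
    by (simp add: sum_distrib_left case_prod_unfold algebra_simps flip: sum.distrib)
  have "2 * T = (\<Sum>(x, y)\<in>arcs G. weight G {x, y} * (c x y + c y x))"
    unfolding mult_2
    by (subst (2) T_def, subst sum_arcs_swap)
       (simp add: T_def insert_commute algebra_simps case_prod_unfold flip: sum.distrib)
  moreover have "\<dots> = (\<Sum>e\<in>arcs G. arc_weight G e * \<bar>tension G (signed_indicator P Q) e\<bar>)"
  proof (intro sum.cong refl, clarify)
    fix x y assume "(x, y) \<in> arcs G"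
    from signature_cases[OF this]
    have "c x y + c y x = \<bar>signed_indicator P Q x - signature G {x, y} * signed_indicator P Q y\<bar>"
      using PQ by (auto simp: c_def signed_indicator_def insert_commute[of y x])
    then show "weight G {x, y} * (c x y + c y x)
        = arc_weight G (x, y) * \<bar>tension G (signed_indicator P Q) (x, y)\<bar>"
      by (simp add: arc_weight_def tension_def)
  qed
  ultimately have "total_variation G (signed_indicator P Q) = T"
    by (simp add: total_variation_def)
  with num show ?thesis
    by (simp add: signed_beta_def vertex_volume_def)
qed

text \<open>A coarea argument: to bound a linear functional by the total variation at \<open>f\<close>, it suffices to do so
  at the indicators of the level sets of \<open>f\<close>. With \<open>m\<close> the smallest nonzero value of \<open>\<bar>f\<bar>\<close>, the function
  \<open>f\<close> is the sum of \<open>m * sgn f\<close> and a function of smaller support, and the total variation is additive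
  for this decomposition.\<close>

lemma signed_layer_inequality:
  assumes "\<And>P Q. P \<subseteq> {x \<in> verts G. 0 < f x} \<Longrightarrow> Q \<subseteq> {x \<in> verts G. f x < 0} \<Longrightarrow>
      (\<Sum>x\<in>verts G. \<phi> x * signed_indicator P Q x) \<le> total_variation G (signed_indicator P Q)"
  shows "(\<Sum>x\<in>verts G. \<phi> x * f x) \<le> total_variation G f"
  using assms
proof (induction "card {x \<in> verts G. f x \<noteq> 0}" arbitrary: f rule: less_induct)
  case less
  let ?supp = "\<lambda>f. {x \<in> verts G. f x \<noteq> (0::real)}"
  show ?case
  proof (cases "?supp f = {}")
    case True
    then have "(\<Sum>x\<in>verts G. \<phi> x * f x) = 0"
      by (intro sum.neutral) auto
    then show ?thesis using total_variation_nonneg[of f] by simp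
  next
    case False
    have fin: "finite (?supp f)" using finite_verts by simp
    define m where "m = Min ((\<lambda>x. \<bar>f x\<bar>) ` ?supp f)"
    have "m \<in> (\<lambda>x. \<bar>f x\<bar>) ` ?supp f"
      unfolding m_def using fin False by (intro Min_in) auto
    then obtain x0 where x0: "x0 \<in> verts G" "f x0 \<noteq> 0" "m = \<bar>f x0\<bar>"
      by auto
    have m: "f x = 0 \<or> m \<le> \<bar>f x\<bar>" if "x \<in> verts G" for x
      unfolding m_def using fin that by (auto intro!: Min_le)
    have "m > 0" using x0 by simp
    define s where "s = signed_indicator {x \<in> verts G. 0 < f x} {x \<in> verts G. f x < 0}"
    define f' where "f' x = f x - m * s x" for x
    have s: "s x = sgn (f x)" if "x \<in> verts G" for x
      using that by (auto simp: s_def signed_indicator_def sgn_if)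
    have f': "f' x = f x - m * sgn (f x)" if "x \<in> verts G" for x
      using s[OF that] by (simp add: f'_def)
    have "0 < f x" if "x \<in> verts G" "0 < f' x" for x
      using f'[OF that(1)] m[OF that(1)] that(2) \<open>m > 0\<close>
      by (cases "f x" "0::real" rule: linorder_cases) auto
    then have pos: "{x \<in> verts G. 0 < f' x} \<subseteq> {x \<in> verts G. 0 < f x}"
      by blast
    have "f x < 0" if "x \<in> verts G" "f' x < 0" for x
      using f'[OF that(1)] m[OF that(1)] that(2) \<open>m > 0\<close>
      by (cases "f x" "0::real" rule: linorder_cases) auto
    then have neg: "{x \<in> verts G. f' x < 0} \<subseteq> {x \<in> verts G. f x < 0}"
      by blast
    have "?supp f' \<subset> ?supp f"
    proof
      have "f' x = 0" if "x \<in> verts G" "f x = 0" for x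
        using f'[OF that(1)] that(2) by simp
      then show "?supp f' \<subseteq> ?supp f" by blast
      have "f' x0 = 0" using f'[OF x0(1)] x0 by (simp add: abs_if sgn_if split: if_splits)
      then show "?supp f' \<noteq> ?supp f" using x0 by blast
    qed
    then have "card (?supp f') < card (?supp f)"
      by (rule psubset_card_mono[OF fin])
    then have IH: "(\<Sum>x\<in>verts G. \<phi> x * f' x) \<le> total_variation G f'"
      by (rule less.hyps) (rule less.prems[OF subset_trans[OF _ pos] subset_trans[OF _ neg]])
    have base: "(\<Sum>x\<in>verts G. \<phi> x * s x) \<le> total_variation G s"
      unfolding s_def by (rule less.prems) auto
    have peel: "\<bar>tension G f e\<bar> = m * \<bar>tension G s e\<bar> + \<bar>tension G f' e\<bar>" if e: "e \<in> arcs G" for e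
    proof -
      obtain x y where e_eq: "e = (x, y)" and xy: "(x, y) \<in> arcs G" using e by (cases e) auto
      then have v: "x \<in> verts G" "y \<in> verts G" using arc_in_verts by auto
      show ?thesis
        unfolding e_eq tension_def prod.case s[OF v(1)] s[OF v(2)] f'[OF v(1)] f'[OF v(2)]
        by (rule abs_diff_peel_layer) (use signature_cases[OF xy] m v \<open>m > 0\<close> in auto)
    qed
    have "total_variation G f = m * total_variation G s + total_variation G f'"
    proof -
      have "(\<Sum>e\<in>arcs G. arc_weight G e * \<bar>tension G f e\<bar>)
          = (\<Sum>e\<in>arcs G. m * (arc_weight G e * \<bar>tension G s e\<bar>) + arc_weight G e * \<bar>tension G f' e\<bar>)"
        by (intro sum.cong refl) (simp only: peel, simp add: algebra_simps)
      then show ?thesis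
        by (simp add: total_variation_def sum.distrib algebra_simps flip: sum_distrib_left)
    qed
    moreover have "(\<Sum>x\<in>verts G. \<phi> x * f x) = m * (\<Sum>x\<in>verts G. \<phi> x * s x) + (\<Sum>x\<in>verts G. \<phi> x * f' x)"
      by (simp add: f'_def sum_distrib_left algebra_simps flip: sum.distrib)
    ultimately show ?thesis
      using IH mult_left_mono[OF base less_imp_le[OF \<open>m > 0\<close>]] by linarith
  qed
qed

text \<open>On functions whose signs are compatible with those of \<open>f\<close> the mass norm is linear, so the layer
  inequality applies to it.\<close>

lemma mass_norm_le_total_variation:
  assumes "\<And>P Q. P \<subseteq> {x \<in> verts G. 0 < f x} \<Longrightarrow> Q \<subseteq> {x \<in> verts G. f x < 0} \<Longrightarrow>
      t * vertex_volume G (P \<union> Q) \<le> total_variation G (signed_indicator P Q)"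
  shows "t * mass_norm G f \<le> total_variation G f"
proof -
  have "(\<Sum>x\<in>verts G. (t * mass G x * sgn (f x)) * f x) \<le> total_variation G f"
  proof (rule signed_layer_inequality)
    fix P Q assume P: "P \<subseteq> {x \<in> verts G. 0 < f x}" and Q: "Q \<subseteq> {x \<in> verts G. f x < 0}"
    have "(\<Sum>x\<in>verts G. t * mass G x * sgn (f x) * signed_indicator P Q x)
        = (\<Sum>x\<in>P \<union> Q. t * mass G x)"
      using P Q by (intro sum.mono_neutral_cong_right) (auto simp: finite_verts signed_indicator_def sgn_if)
    also have "\<dots> = t * vertex_volume G (P \<union> Q)"
      by (simp add: vertex_volume_def sum_distrib_left)
    finally show "(\<Sum>x\<in>verts G. t * mass G x * sgn (f x) * signed_indicator P Q x)
        \<le> total_variation G (signed_indicator P Q)"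
      using assms[OF P Q] by simp
  qed
  moreover have "(\<Sum>x\<in>verts G. (t * mass G x * sgn (f x)) * f x) = t * mass_norm G f"
    unfolding mass_norm_def sum_distrib_left
  proof (intro sum.cong refl)
    show "t * mass G x * sgn (f x) * f x = t * (mass G x * \<bar>f x\<bar>)" for x
      by (cases "f x" "0::real" rule: linorder_cases) auto
  qed
  ultimately show ?thesis by simp
qed

text \<open>Summation by parts, the duality between divergence and gradient on the signed graph.\<close>

lemma flow_sum_by_parts:
  assumes "\<And>x y. (x, y) \<in> arcs G \<Longrightarrow> z x y = - signature G {x, y} * z y x"
  shows "(\<Sum>x\<in>verts G. g x * (\<Sum>y\<in>nbrs G x. weight G {x, y} * z x y))
     = 1/2 * (\<Sum>(x, y)\<in>arcs G. weight G {x, y} * (z x y * tension G g (x, y)))"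
proof -
  let ?S = "\<Sum>(x, y)\<in>arcs G. weight G {x, y} * z x y * g x"
  have "(\<Sum>x\<in>verts G. g x * (\<Sum>y\<in>nbrs G x. weight G {x, y} * z x y)) = ?S"
    unfolding sum_distrib_left sum_nbrs by (simp add: mult_ac)
  moreover have "?S + ?S = (\<Sum>(x, y)\<in>arcs G. weight G {x, y} * (z x y * tension G g (x, y)))"
  proof (subst (2) sum_arcs_swap, unfold sum.distrib[symmetric], intro sum.cong refl, clarsimp)
    fix x y assume xy: "(x, y) \<in> arcs G"
    have "z y x = - signature G {x, y} * z x y"
      using assms[OF arc_sym[OF xy]] by (simp add: insert_commute)
    then show "weight G {x, y} * z x y * g x + weight G {y, x} * z y x * g y
        = weight G {x, y} * (z x y * tension G g (x, y))"
      by (simp add: tension_def insert_commute[of y x] algebra_simps)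
  qed
  ultimately show ?thesis by simp
qed

text \<open>A linear functional \<open>\<phi>\<close> below the total variation that touches it at \<open>f\<close> is a subgradient there. The
  coefficients \<open>\<zeta>\<close> of \<open>\<phi>\<close> in terms of the arcs have no symmetry; averaging over the two orientations of an
  edge produces the flow \<open>z\<close>, and equality at \<open>f\<close> forces \<open>z\<close> to be a sign of the tension of \<open>f\<close>.\<close>

lemma flow_of_calibration:
  assumes le: "\<And>g. (\<Sum>x\<in>verts G. \<phi> x * g x) \<le> total_variation G g"
    and eq: "(\<Sum>x\<in>verts G. \<phi> x * f x) = total_variation G f"
  obtains z where "\<And>x y. (x, y) \<in> arcs G \<Longrightarrow> z x y \<in> Sgn (f x - signature G {x, y} * f y)"
    and "\<And>x y. (x, y) \<in> arcs G \<Longrightarrow> z x y = - signature G {x, y} * z y x"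
    and "\<And>x. x \<in> verts G \<Longrightarrow> (\<Sum>y\<in>nbrs G x. weight G {x, y} * z x y) = \<phi> x"
proof -
  define a where "a e v = (arc_weight G e / 2) *
    ((if v = fst e then 1 else 0) - signature G {fst e, snd e} * (if v = snd e then 1 else 0))"
    for e :: "'v \<times> 'v" and v
  have a: "(\<Sum>v\<in>verts G. a e v * g v) = (arc_weight G e / 2) * tension G g e" if e_arc: "e \<in> arcs G" for e g
  proof -
    obtain x y where e: "e = (x, y)" "x \<in> verts G" "y \<in> verts G"
      using e_arc arc_in_verts[of "fst e" "snd e"] by (metis prod.collapse)
    have "(\<Sum>v\<in>verts G. a e v * g v) = (\<Sum>v\<in>verts G. (if v = x then arc_weight G e / 2 * g x else 0)
        - (if v = y then arc_weight G e / 2 * (signature G {x, y} * g y) else 0))"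
      by (intro sum.cong refl) (auto simp: a_def e algebra_simps)
    also have "\<dots> = (arc_weight G e / 2) * tension G g e"
      using e finite_verts by (simp add: sum_subtractf tension_def algebra_simps)
    finally show ?thesis .
  qed
  have "(\<Sum>x\<in>verts G. \<phi> x * g x) \<le> (\<Sum>e\<in>arcs G. \<bar>\<Sum>v\<in>verts G. a e v * g v\<bar>)" for g
  proof -
    have "(\<Sum>e\<in>arcs G. \<bar>\<Sum>v\<in>verts G. a e v * g v\<bar>) = total_variation G g"
      unfolding total_variation_def sum_distrib_left
      by (intro sum.cong refl) (auto simp: a abs_mult dest!: arc_weight_pos)
    then show ?thesis using le[of g] by simp
  qed
  from linear_functional_below_abs_sum[OF finite_arcs finite_verts this]
  obtain \<zeta> where \<zeta>: "\<And>e. e \<in> arcs G \<Longrightarrow> \<bar>\<zeta> e\<bar> \<le> 1"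
      and \<phi>: "\<And>x. x \<in> verts G \<Longrightarrow> \<phi> x = (\<Sum>e\<in>arcs G. \<zeta> e * a e x)"
    by blast
  \<comment> \<open>The two orientations of an edge are averaged so that \<open>z\<close> becomes skew.\<close>
  define z where "z x y = (\<zeta> (x, y) - signature G {x, y} * \<zeta> (y, x)) / 2" for x y
  have skew: "z x y = - signature G {x, y} * z y x" if "(x, y) \<in> arcs G" for x y
    using signature_cases[OF that] by (auto simp: z_def insert_commute[of y x])
  have bound: "\<bar>z x y\<bar> \<le> 1" if "(x, y) \<in> arcs G" for x y
    using signature_cases[OF that] \<zeta>[OF that] \<zeta>[OF arc_sym[OF that]] by (auto simp: z_def abs_le_iff)
  have pairing: "(\<Sum>x\<in>verts G. \<phi> x * g x) = (\<Sum>x\<in>verts G. g x * (\<Sum>y\<in>nbrs G x. weight G {x, y} * z x y))" for g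
  proof -
    have "(\<Sum>x\<in>verts G. \<phi> x * g x) = (\<Sum>x\<in>verts G. \<Sum>e\<in>arcs G. \<zeta> e * (a e x * g x))"
      by (simp add: \<phi> sum_distrib_right mult.assoc)
    also have "\<dots> = (\<Sum>e\<in>arcs G. \<zeta> e * (arc_weight G e / 2 * tension G g e))"
      by (subst sum.swap) (simp add: a flip: sum_distrib_left)
    also have "\<dots> = 1/2 * ((\<Sum>(x, y)\<in>arcs G. weight G {x, y} * \<zeta> (x, y) * g x)
        - (\<Sum>(x, y)\<in>arcs G. weight G {x, y} * \<zeta> (x, y) * signature G {x, y} * g y))"
      by (simp add: tension_def arc_weight_def case_prod_unfold algebra_simps sum_distrib_left flip: sum_subtractf)
    also have "\<dots> = 1/2 * ((\<Sum>(x, y)\<in>arcs G. weight G {x, y} * \<zeta> (x, y) * g x)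
        - (\<Sum>(x, y)\<in>arcs G. weight G {x, y} * \<zeta> (y, x) * signature G {x, y} * g x))"
      by (subst (2) sum_arcs_swap) (simp add: insert_commute)
    also have "\<dots> = (\<Sum>(x, y)\<in>arcs G. g x * (weight G {x, y} * z x y))"
      by (simp add: z_def case_prod_unfold algebra_simps sum_distrib_left diff_divide_distrib flip: sum_subtractf)
    finally show ?thesis
      by (simp add: sum_nbrs sum_distrib_left)
  qed
  have div: "(\<Sum>y\<in>nbrs G x. weight G {x, y} * z x y) = \<phi> x" if "x \<in> verts G" for x
  proof -
    have "(\<Sum>v\<in>verts G. \<phi> v * (if v = x then 1 else 0)) = \<phi> x"
      using that finite_verts by (simp add: if_distrib[of "(*) _"] cong: if_cong)
    moreover have "(\<Sum>v\<in>verts G. (if v = x then 1 else 0) * (\<Sum>y\<in>nbrs G v. weight G {v, y} * z v y))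
        = (\<Sum>y\<in>nbrs G x. weight G {x, y} * z x y)"
      using that finite_verts by (simp add: if_distrib[of "\<lambda>u. u * _"] cong: if_cong)
    ultimately show ?thesis
      using pairing[of "\<lambda>v. if v = x then 1 else 0"] by simp
  qed
  have Sgn: "z x y \<in> Sgn (f x - signature G {x, y} * f y)" if xy: "(x, y) \<in> arcs G" for x y
  proof -
    let ?d = "\<lambda>(x, y). weight G {x, y} * (\<bar>tension G f (x, y)\<bar> - z x y * tension G f (x, y))"
    have nonneg: "0 \<le> ?d e" if "e \<in> arcs G" for e
    proof -
      obtain u v where e: "e = (u, v)" by force
      have "z u v * tension G f e \<le> \<bar>z u v\<bar> * \<bar>tension G f e\<bar>"
        by (metis abs_ge_self abs_mult)
      also have "\<dots> \<le> 1 * \<bar>tension G f e\<bar>"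
        using bound that by (intro mult_right_mono) (auto simp: e)
      finally show ?thesis
        using arc_weight_pos[OF that] by (simp add: e arc_weight_def)
    qed
    have parts: "(\<Sum>x\<in>verts G. \<phi> x * f x)
        = 1/2 * (\<Sum>(x, y)\<in>arcs G. weight G {x, y} * (z x y * tension G f (x, y)))"
      by (rule trans[OF pairing flow_sum_by_parts]) (rule skew)
    have "sum ?d (arcs G) = 2 * (total_variation G f - (\<Sum>x\<in>verts G. \<phi> x * f x))"
      unfolding parts total_variation_def
      by (simp add: arc_weight_def case_prod_unfold algebra_simps sum_subtractf)
    then have "sum ?d (arcs G) = 0"
      using eq by simp
    moreover have "sum ?d (arcs G) = 0 \<longleftrightarrow> (\<forall>e\<in>arcs G. ?d e = 0)"
      by (intro sum_nonneg_eq_0_iff finite_arcs) (rule nonneg)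
    ultimately have "?d (x, y) = 0"
      using xy by blast
    then have "\<bar>tension G f (x, y)\<bar> = z x y * tension G f (x, y)"
      using arc_weight_pos[OF xy] by (simp add: arc_weight_def)
    then show ?thesis
      using bound[OF xy] by (simp add: Sgn_iff tension_def)
  qed
  show ?thesis
    by (rule that[OF Sgn skew div])
qed

section \<open>Components and switching functions\<close>

abbreviation reach :: "('v \<times> 'v) set" where
  "reach \<equiv> {(x, y). {x, y} \<in> edges G}\<^sup>*"

lemma equiv_reach: "equiv UNIV reach"
proof (rule equivI)
  show "sym reach"
    by (intro sym_rtrancl symI) (auto simp: insert_commute)
qed (auto simp: refl_rtrancl trans_rtrancl)

lemma component_of_vertex: "x \<in> verts G \<Longrightarrow> reach `` {x} \<in> component_sets G"
  by (auto simp: component_sets_def quotientI)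

lemma component_eq_reach:
  assumes "K \<in> component_sets G" "x \<in> K"
  shows "K = reach `` {x}"
proof -
  obtain x0 where "K = reach `` {x0}"
    using assms(1) by (auto simp: component_sets_def elim: quotientE)
  then show ?thesis
    using assms(2) equiv_class_eq[OF equiv_reach, of x0 x] by auto
qed

lemma component_subset:
  assumes "K \<in> component_sets G"
  shows "K \<subseteq> verts G"
proof -
  obtain x0 where x0: "x0 \<in> verts G" "K = reach `` {x0}"
    using assms by (auto simp: component_sets_def elim: quotientE)
  have "y \<in> verts G" if "(x0, y) \<in> reach" for y
    using that
  proof (induction rule: rtrancl_induct)
    case (step y z)
    then show ?case using arc_in_verts[of y z] by (simp add: arcs_def)
  qed (rule x0)
  then show ?thesis using x0 by auto
qed

lemma finite_component: "K \<in> component_sets G \<Longrightarrow> finite K"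
  using component_subset finite_verts finite_subset by blast

lemma component_nonempty: "K \<in> component_sets G \<Longrightarrow> K \<noteq> {}"
  using in_quotient_imp_non_empty[OF equiv_reach] by (auto simp: component_sets_def quotient_def)

lemma component_closed:
  assumes "K \<in> component_sets G" "x \<in> K" "(x, y) \<in> arcs G"
  shows "y \<in> K"
  using assms component_eq_reach[OF assms(1,2)] by (auto simp: arcs_def)

lemma component_unique: "K \<in> component_sets G \<Longrightarrow> L \<in> component_sets G \<Longrightarrow> x \<in> K \<Longrightarrow> x \<in> L \<Longrightarrow> K = L"
  using component_eq_reach by metis

lemma component_connected:
  assumes K: "K \<in> component_sets G" and A: "A \<subseteq> K" "A \<noteq> {}"
    and closed: "\<And>x y. x \<in> A \<Longrightarrow> (x, y) \<in> arcs G \<Longrightarrow> y \<in> A"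
  shows "A = K"
proof -
  obtain x where x: "x \<in> A" using A by blast
  have "y \<in> A" if "(x, y) \<in> reach" for y
    using that by (induction rule: rtrancl_induct) (use x closed in \<open>auto simp: arcs_def\<close>)
  then show ?thesis
    using component_eq_reach[OF K, of x] x A by auto
qed

lemma Union_components: "\<Union>(component_sets G) = verts G"
proof
  show "\<Union>(component_sets G) \<subseteq> verts G" using component_subset by blast
  show "verts G \<subseteq> \<Union>(component_sets G)" using component_of_vertex by blast
qed

lemma finite_components: "finite (component_sets G)"
  by (rule finite_subset[of _ "Pow (verts G)"]) (use component_subset finite_verts in auto)

lemma components_disjoint: "K \<in> component_sets G \<Longrightarrow> L \<in> component_sets G \<Longrightarrow> K \<noteq> L \<Longrightarrow> K \<inter> L = {}"
  using component_unique by blast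

lemma total_variation_restrict:
  assumes "K \<in> component_sets G"
  shows "total_variation G (restrict_to K f)
    = 1/2 * (\<Sum>e\<in>{e \<in> arcs G. fst e \<in> K}. arc_weight G e * \<bar>tension G f e\<bar>)"
proof -
  have "(\<Sum>e\<in>arcs G. arc_weight G e * \<bar>tension G (restrict_to K f) e\<bar>)
      = (\<Sum>e\<in>{e \<in> arcs G. fst e \<in> K}. arc_weight G e * \<bar>tension G f e\<bar>)"
  proof (intro sum.mono_neutral_cong_right finite_arcs ballI)
    fix e assume e: "e \<in> arcs G - {e \<in> arcs G. fst e \<in> K}"
    then have "snd e \<notin> K"
      using component_closed[OF assms, of "snd e" "fst e"] arc_sym[of "fst e" "snd e"] by auto
    then show "arc_weight G e * \<bar>tension G (restrict_to K f) e\<bar> = 0"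
      using e by (auto simp: tension_def restrict_to_def case_prod_unfold)
  next
    fix e assume e: "e \<in> {e \<in> arcs G. fst e \<in> K}"
    then have "snd e \<in> K"
      using component_closed[OF assms, of "fst e" "snd e"] by auto
    then show "arc_weight G e * \<bar>tension G (restrict_to K f) e\<bar> = arc_weight G e * \<bar>tension G f e\<bar>"
      using e by (auto simp: tension_def restrict_to_def case_prod_unfold)
  qed auto
  then show ?thesis by (simp add: total_variation_def)
qed

lemma arc_term_nonneg: "e \<in> arcs G \<Longrightarrow> 0 \<le> arc_weight G e * \<bar>u\<bar>"
  by (rule mult_nonneg_nonneg[OF less_imp_le[OF arc_weight_pos] abs_ge_zero])

lemma total_variation_restrict_le:
  assumes "K \<in> component_sets G"
  shows "total_variation G (restrict_to K f) \<le> total_variation G f"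
proof -
  have "(\<Sum>e\<in>{e \<in> arcs G. fst e \<in> K}. arc_weight G e * \<bar>tension G f e\<bar>)
      \<le> (\<Sum>e\<in>arcs G. arc_weight G e * \<bar>tension G f e\<bar>)"
    by (rule sum_mono2[OF finite_arcs]) (auto intro: arc_term_nonneg)
  then show ?thesis
    unfolding total_variation_restrict[OF assms] total_variation_def[of G f] by simp
qed

lemma total_variation_components:
  "total_variation G f = (\<Sum>K\<in>component_sets G. total_variation G (restrict_to K f))"
proof -
  have "arcs G = (\<Union>K\<in>component_sets G. {e \<in> arcs G. fst e \<in> K})"
  proof -
    have "fst e \<in> \<Union>(component_sets G)" if "e \<in> arcs G" for e
      unfolding Union_components using arc_in_verts[of "fst e" "snd e"] that by simp
    then show ?thesis by auto
  qed
  then have "(\<Sum>e\<in>arcs G. arc_weight G e * \<bar>tension G f e\<bar>)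
      = (\<Sum>e\<in>(\<Union>K\<in>component_sets G. {e \<in> arcs G. fst e \<in> K}). arc_weight G e * \<bar>tension G f e\<bar>)"
    by (rule arg_cong)
  also have "\<dots> = (\<Sum>K\<in>component_sets G. \<Sum>e\<in>{e \<in> arcs G. fst e \<in> K}. arc_weight G e * \<bar>tension G f e\<bar>)"
  proof (rule sum.UNION_disjoint[OF finite_components])
    show "\<forall>K\<in>component_sets G. \<forall>L\<in>component_sets G. K \<noteq> L \<longrightarrow>
        {e \<in> arcs G. fst e \<in> K} \<inter> {e \<in> arcs G. fst e \<in> L} = {}"
    proof (intro ballI impI)
      fix K L assume "K \<in> component_sets G" "L \<in> component_sets G" "K \<noteq> L"
      then have "K \<inter> L = {}" by (rule components_disjoint)
      then show "{e \<in> arcs G. fst e \<in> K} \<inter> {e \<in> arcs G. fst e \<in> L} = {}" by auto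
    qed
  qed (simp add: finite_arcs)
  finally have "total_variation G f = (\<Sum>K\<in>component_sets G. 1/2 * (\<Sum>e\<in>{e \<in> arcs G. fst e \<in> K}. arc_weight G e * \<bar>tension G f e\<bar>))"
    unfolding total_variation_def by (simp only: sum_distrib_left)
  also have "\<dots> = (\<Sum>K\<in>component_sets G. total_variation G (restrict_to K f))"
    by (intro sum.cong refl) (rule total_variation_restrict[symmetric])
  finally show ?thesis .
qed

lemma mass_norm_restrict:
  "K \<subseteq> verts G \<Longrightarrow> mass_norm G (restrict_to K f) = (\<Sum>x\<in>K. mass G x * \<bar>f x\<bar>)"
  unfolding mass_norm_def
  by (intro sum.mono_neutral_cong_right) (auto simp: finite_verts restrict_to_def)

lemma mass_norm_components:
  "mass_norm G f = (\<Sum>K\<in>component_sets G. mass_norm G (restrict_to K f))"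
proof -
  have "mass_norm G f = (\<Sum>x\<in>\<Union>(component_sets G). mass G x * \<bar>f x\<bar>)"
    by (simp add: mass_norm_def Union_components)
  also have "\<dots> = (\<Sum>K\<in>component_sets G. \<Sum>x\<in>K. mass G x * \<bar>f x\<bar>)"
    by (subst sum.Union_disjoint) (use finite_component components_disjoint in auto)
  finally show ?thesis
    by (simp add: mass_norm_restrict component_subset)
qed

lemma balanced_iff_switching:
  assumes "K \<in> component_sets G"
  shows "balanced (induced G K) \<longleftrightarrow> (\<exists>\<tau>. switching G K \<tau>)"
proof
  assume "balanced (induced G K)"
  then obtain \<tau> :: "'v \<Rightarrow> real" where \<tau>: "\<And>x. x \<in> K \<Longrightarrow> \<tau> x = -1 \<or> \<tau> x = 1"
      "\<And>x y. {x, y} \<in> edges G \<Longrightarrow> x \<in> K \<Longrightarrow> y \<in> K \<Longrightarrow> \<tau> x * signature G {x, y} * \<tau> y = 1"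
    by (auto simp: balanced_def induced_def)
  have "signature G {x, y} = \<tau> x * \<tau> y" if "x \<in> K" "{x, y} \<in> edges G" for x y
  proof -
    have "y \<in> K" using component_closed[OF assms that(1)] that(2) by (simp add: arcs_def)
    then show ?thesis
      using \<tau>(1)[OF that(1)] \<tau>(1)[OF \<open>y \<in> K\<close>] \<tau>(2)[OF that(2,1)] by auto
  qed
  then show "\<exists>\<tau>. switching G K \<tau>"
    using \<tau>(1) by (auto simp: switching_def)
next
  assume "\<exists>\<tau>. switching G K \<tau>"
  then obtain \<tau> where \<tau>: "switching G K \<tau>" by blast
  have "\<tau> x * signature G {x, y} * \<tau> y = 1" if "{x, y} \<in> edges G" "x \<in> K" "y \<in> K" for x y
  proof -
    have "signature G {x, y} = \<tau> x * \<tau> y" "\<tau> x = -1 \<or> \<tau> x = 1" "\<tau> y = -1 \<or> \<tau> y = 1"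
      using \<tau> that by (simp_all add: switching_def)
    then show ?thesis by auto
  qed
  then show "balanced (induced G K)"
    using \<tau> unfolding balanced_def by (intro exI[of _ \<tau>]) (auto simp: induced_def switching_def)
qed

lemma switching_square: "switching G K \<tau> \<Longrightarrow> x \<in> K \<Longrightarrow> \<tau> x * \<tau> x = 1"
  by (auto simp: switching_def)

lemma switching_cases: "switching G K \<tau> \<Longrightarrow> x \<in> K \<Longrightarrow> \<tau> x = 1 \<or> \<tau> x = -1"
  by (auto simp: switching_def)

lemma switching_uminus: "switching G K \<tau> \<Longrightarrow> switching G K (\<lambda>x. - \<tau> x)"
  by (auto simp: switching_def)

lemma switching_arc: "switching G K \<tau> \<Longrightarrow> x \<in> K \<Longrightarrow> (x, y) \<in> arcs G \<Longrightarrow> signature G {x, y} = \<tau> x * \<tau> y"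
  by (auto simp: switching_def arcs_def)

text \<open>With \<open>u = \<tau> f\<close> the total variation on \<open>K\<close> is that of \<open>u\<close> on an unsigned graph, which is the sum of
  the total variations of the positive and the negative part of \<open>u\<close>.\<close>

lemma total_variation_switching_parts:
  assumes K: "K \<in> component_sets G" and \<tau>: "switching G K \<tau>"
  shows "total_variation G (restrict_to K f)
    = total_variation G (restrict_to {x \<in> K. 0 < \<tau> x * f x} f)
      + total_variation G (restrict_to {x \<in> K. \<tau> x * f x < 0} f)"
proof -
  have "\<bar>tension G (restrict_to K f) e\<bar> = \<bar>tension G (restrict_to {x \<in> K. 0 < \<tau> x * f x} f) e\<bar>
      + \<bar>tension G (restrict_to {x \<in> K. \<tau> x * f x < 0} f) e\<bar>" if e: "e \<in> arcs G" for e
  proof -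
    obtain x y where xy: "e = (x, y)" "(x, y) \<in> arcs G" using e by (cases e) auto
    show ?thesis
    proof (cases "x \<in> K")
      case True
      then have y: "y \<in> K" using component_closed[OF K _ xy(2)] by blast
      show ?thesis
        using switching_cases[OF \<tau> True] switching_cases[OF \<tau> y] True y
        by (auto simp: xy tension_def restrict_to_def switching_arc[OF \<tau> True xy(2)])
    next
      case False
      then have "y \<notin> K" using component_closed[OF K _ arc_sym[OF xy(2)]] by blast
      with False show ?thesis by (simp add: xy tension_def restrict_to_def)
    qed
  qed
  then show ?thesis
    by (simp add: total_variation_def sum_distrib_left algebra_simps flip: sum.distrib)
qed

lemma mass_norm_switching_parts:
  assumes K: "K \<in> component_sets G" and \<tau>: "switching G K \<tau>"
  shows "mass_norm G (restrict_to K f)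
    = mass_norm G (restrict_to {x \<in> K. 0 < \<tau> x * f x} f)
      + mass_norm G (restrict_to {x \<in> K. \<tau> x * f x < 0} f)"
proof -
  have "\<bar>restrict_to K f x\<bar> = \<bar>restrict_to {x \<in> K. 0 < \<tau> x * f x} f x\<bar>
      + \<bar>restrict_to {x \<in> K. \<tau> x * f x < 0} f x\<bar>" for x
    using switching_cases[OF \<tau>, of x] by (auto simp: restrict_to_def)
  then show ?thesis
    by (simp add: mass_norm_def algebra_simps flip: sum.distrib)
qed

end

section \<open>Admissible pairs and eigenvalues\<close>

text \<open>In a balanced component the volume condition excludes the pairs that cover most of the component,
  in particular those of quotient \<open>0\<close>.\<close>

definition admissible_pairs :: "'v signed_graph \<Rightarrow> ('v set \<times> 'v set) set" where
  "admissible_pairs G = {(P, Q). P \<inter> Q = {} \<and> P \<union> Q \<noteq> {} \<and> (\<exists>K\<in>component_sets G. P \<union> Q \<subseteq> K \<and>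
     (balanced (induced G K) \<longrightarrow> 2 * vertex_volume G (P \<union> Q) \<le> vertex_volume G K))}"

definition admissible_bound :: "'v signed_graph \<Rightarrow> real \<Rightarrow> bool" where
  "admissible_bound G t \<longleftrightarrow> (\<forall>(P, Q)\<in>admissible_pairs G. t \<le> signed_beta G P Q)"

definition zero_is_median :: "'v signed_graph \<Rightarrow> 'v set \<Rightarrow> ('v \<Rightarrow> real) \<Rightarrow> bool" where
  "zero_is_median G K u \<longleftrightarrow>
     2 * vertex_volume G {x \<in> K. 0 < u x} \<le> vertex_volume G K \<and> 2 * vertex_volume G {x \<in> K. u x < 0} \<le> vertex_volume G K"

context weighted_signed_graph
begin

lemma admissible_bound_total_variation:
  assumes t: "admissible_bound G t" and K: "K \<in> component_sets G" and PQ: "P \<union> Q \<subseteq> K" "P \<inter> Q = {}"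
    and vol: "balanced (induced G K) \<Longrightarrow> 2 * vertex_volume G (P \<union> Q) \<le> vertex_volume G K"
  shows "t * vertex_volume G (P \<union> Q) \<le> total_variation G (signed_indicator P Q)"
proof (cases "P \<union> Q = {}")
  case True
  then show ?thesis using total_variation_nonneg by (simp add: vertex_volume_def)
next
  case False
  have sub: "P \<subseteq> verts G" "Q \<subseteq> verts G" using PQ component_subset[OF K] by auto
  have "(P, Q) \<in> admissible_pairs G"
    unfolding admissible_pairs_def using False K PQ vol by blast
  then have "t \<le> signed_beta G P Q"
    using t by (auto simp: admissible_bound_def)
  then show ?thesis
    using volume_pos[of "P \<union> Q"] False sub by (simp add: signed_beta_eq[OF sub PQ(2)] pos_le_divide_eq)
qed

text \<open>If \<open>0\<close> is a median of \<open>\<tau> f\<close> on each balanced component, then both its positive and its negative part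
  live on at most half of the volume, so all of their level sets are admissible.\<close>

lemma mass_norm_le_total_variation_median:
  assumes t: "admissible_bound G t"
    and median: "\<And>K. K \<in> component_sets G \<Longrightarrow> balanced (induced G K) \<Longrightarrow>
      \<exists>\<tau>. switching G K \<tau> \<and> zero_is_median G K (\<lambda>x. \<tau> x * f x)"
  shows "t * mass_norm G f \<le> total_variation G f"
proof -
  have small: "t * mass_norm G (restrict_to A f) \<le> total_variation G (restrict_to A f)"
    if K: "K \<in> component_sets G" and A: "A \<subseteq> K"
      and vol: "balanced (induced G K) \<Longrightarrow> 2 * vertex_volume G A \<le> vertex_volume G K" for K A
  proof (rule mass_norm_le_total_variation)
    fix P Q assume P: "P \<subseteq> {x \<in> verts G. 0 < restrict_to A f x}" and Q: "Q \<subseteq> {x \<in> verts G. restrict_to A f x < 0}"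
    have pos: "0 < restrict_to A f x" if "x \<in> P" for x using P that by blast
    have neg: "restrict_to A f x < 0" if "x \<in> Q" for x using Q that by blast
    have "P \<union> Q \<subseteq> A"
      using pos neg by (force simp: restrict_to_def split: if_splits)
    moreover have "P \<inter> Q = {}"
      using pos neg by (meson disjoint_iff order_less_asym)
    ultimately have PQ: "P \<union> Q \<subseteq> A" "P \<inter> Q = {}" by auto
    moreover have "vertex_volume G (P \<union> Q) \<le> vertex_volume G A"
      using PQ A component_subset[OF K] by (intro volume_mono) auto
    ultimately show "t * vertex_volume G (P \<union> Q) \<le> total_variation G (signed_indicator P Q)"
      using A vol by (intro admissible_bound_total_variation[OF t K]) auto
  qed
  have "t * mass_norm G (restrict_to K f) \<le> total_variation G (restrict_to K f)" if K: "K \<in> component_sets G" for K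
  proof (cases "balanced (induced G K)")
    case False
    then show ?thesis using small[OF K order_refl] by simp
  next
    case True
    from median[OF K this] obtain \<tau> where \<tau>: "switching G K \<tau>"
        and med: "zero_is_median G K (\<lambda>x. \<tau> x * f x)" by blast
    have "t * mass_norm G (restrict_to {x \<in> K. 0 < \<tau> x * f x} f)
        \<le> total_variation G (restrict_to {x \<in> K. 0 < \<tau> x * f x} f)"
      by (rule small[OF K]) (use med in \<open>auto simp: zero_is_median_def\<close>)
    moreover have "t * mass_norm G (restrict_to {x \<in> K. \<tau> x * f x < 0} f)
        \<le> total_variation G (restrict_to {x \<in> K. \<tau> x * f x < 0} f)"
      by (rule small[OF K]) (use med in \<open>auto simp: zero_is_median_def\<close>)
    ultimately show ?thesis
      unfolding mass_norm_switching_parts[OF K \<tau>] total_variation_switching_parts[OF K \<tau>]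
      by (simp add: distrib_left)
  qed
  then show ?thesis
    unfolding total_variation_components[of f] mass_norm_components[of f] sum_distrib_left
    by (rule sum_mono)
qed

lemma tension_switching:
  assumes "K \<in> component_sets G" "switching G K \<tau>" "(x, y) \<in> arcs G"
  shows "tension G (restrict_to K \<tau>) (x, y) = 0"
proof (cases "x \<in> K")
  case True
  then have y: "y \<in> K" using component_closed[OF assms(1) _ assms(3)] by blast
  show ?thesis
    using switching_cases[OF assms(2) True] switching_cases[OF assms(2) y] True y
    by (auto simp: tension_def restrict_to_def switching_arc[OF assms(2) True assms(3)])
next
  case False
  then have "y \<notin> K" using component_closed[OF assms(1) _ arc_sym[OF assms(3)]] by blast
  with False show ?thesis by (simp add: tension_def restrict_to_def)
qed

text \<open>Testing the eigenvalue equation against \<open>\<tau>\<close> on a balanced component \<open>K\<close> gives \<open>0\<close> on the side of the flow,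
  hence \<open>\<Sum>x\<in>K. mass x * \<tau> x * z' x = 0\<close> for a positive eigenvalue. The summand is \<open>mass x\<close> where
  \<open>\<tau> f > 0\<close> and at least \<open>- mass x\<close> elsewhere, so \<open>0\<close> is a median of \<open>\<tau> f\<close>. Testing
  against \<open>f\<close> shows that the eigenvalue is the Rayleigh quotient of \<open>f\<close>.\<close>

lemma eigenvalue_ge_admissible_bound:
  assumes t: "admissible_bound G t" and eig: "eigenvalue G ev" and "0 < ev"
  shows "t \<le> ev"
proof -
  obtain f z z' where f: "f \<in> vfuns G" "f \<noteq> (\<lambda>_. 0)"
    and z: "\<And>x y. (x, y) \<in> arcs G \<Longrightarrow> z x y \<in> Sgn (tension G f (x, y))"
    and skew: "\<And>x y. (x, y) \<in> arcs G \<Longrightarrow> z x y = - signature G {x, y} * z y x"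
    and z': "\<And>x. x \<in> verts G \<Longrightarrow> z' x \<in> Sgn (f x)"
    and eq: "\<And>x. x \<in> verts G \<Longrightarrow> (\<Sum>y\<in>nbrs G x. weight G {x, y} * z x y) = ev * mass G x * z' x"
  proof -
    obtain f where "eigenfunction G ev f" using eig by (auto simp: eigenvalue_def)
    then have f: "f \<in> vfuns G" "f \<noteq> (\<lambda>_. 0)"
      by (auto simp: eigenfunction_def)
    obtain z z' where z: "\<forall>x y. {x, y} \<in> edges G \<longrightarrow>
          z x y \<in> Sgn (f x - signature G {x, y} * f y) \<and> z x y = - signature G {x, y} * z y x"
        and z': "\<forall>x\<in>verts G. z' x \<in> Sgn (f x)"
        and eq: "\<forall>x\<in>verts G. (\<Sum>y\<in>nbrs G x. weight G {x, y} * z x y) = ev * mass G x * z' x"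
      using \<open>eigenfunction G ev f\<close> unfolding eigenfunction_def by blast
    show thesis
    proof (rule that[of f z z', OF f])
      fix x y assume "(x, y) \<in> arcs G"
      then have xy: "{x, y} \<in> edges G" by (simp add: arcs_def)
      show "z x y \<in> Sgn (tension G f (x, y))"
        unfolding tension_def prod.case using z xy by blast
      show "z x y = - signature G {x, y} * z y x"
        using z xy by blast
    qed (use z' eq in blast)+
  qed
  have test: "ev * (\<Sum>x\<in>verts G. mass G x * (z' x * g x))
      = 1/2 * (\<Sum>(x, y)\<in>arcs G. weight G {x, y} * (z x y * tension G g (x, y)))" for g
  proof -
    have "(\<Sum>x\<in>verts G. g x * (\<Sum>y\<in>nbrs G x. weight G {x, y} * z x y))
      = 1/2 * (\<Sum>(x, y)\<in>arcs G. weight G {x, y} * (z x y * tension G g (x, y)))"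
      by (rule flow_sum_by_parts) (rule skew)
    moreover have "(\<Sum>x\<in>verts G. g x * (\<Sum>y\<in>nbrs G x. weight G {x, y} * z x y))
      = ev * (\<Sum>x\<in>verts G. mass G x * (z' x * g x))"
      unfolding sum_distrib_left by (intro sum.cong refl) (simp add: eq flip: sum_distrib_left)
    ultimately show ?thesis by simp
  qed
  have "total_variation G f = 1/2 * (\<Sum>(x, y)\<in>arcs G. weight G {x, y} * (z x y * tension G f (x, y)))"
    unfolding total_variation_def
    by (intro arg_cong[of _ _ "(*) (1/2)"] sum.cong refl) (auto simp: arc_weight_def dest!: z[unfolded Sgn_iff])
  also have "\<dots> = ev * mass_norm G f"
    unfolding test[symmetric] mass_norm_def using z'[unfolded Sgn_iff] by simp
  finally have tv: "total_variation G f = ev * mass_norm G f" .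
  have half: "2 * vertex_volume G {x \<in> K. 0 < \<tau> x * f x} \<le> vertex_volume G K"
    if K: "K \<in> component_sets G" and \<tau>: "switching G K \<tau>" for K \<tau>
  proof -
    have KV: "K \<subseteq> verts G" by (rule component_subset[OF K])
    let ?A = "{x \<in> K. 0 < \<tau> x * f x}"
    have "(\<Sum>(x, y)\<in>arcs G. weight G {x, y} * (z x y * tension G (restrict_to K \<tau>) (x, y))) = 0"
      by (intro sum.neutral) (auto simp: tension_switching[OF K \<tau>])
    then have "ev * (\<Sum>x\<in>verts G. mass G x * (z' x * restrict_to K \<tau> x)) = 0"
      unfolding test by simp
    moreover have "(\<Sum>x\<in>verts G. mass G x * (z' x * restrict_to K \<tau> x)) = (\<Sum>x\<in>K. mass G x * (z' x * \<tau> x))"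
      by (intro sum.mono_neutral_cong_right) (use KV in \<open>auto simp: finite_verts restrict_to_def\<close>)
    ultimately have zero: "(\<Sum>x\<in>K. mass G x * (z' x * \<tau> x)) = 0"
      using \<open>0 < ev\<close> by simp
    have nonneg: "0 \<le> 1 + z' x * \<tau> x" if "x \<in> K" for x
      using switching_cases[OF \<tau> that] z'[of x, unfolded Sgn_iff] that KV by (auto simp: abs_le_iff)
    have "2 * vertex_volume G ?A = (\<Sum>x\<in>?A. mass G x * (1 + z' x * \<tau> x))"
      unfolding vertex_volume_def sum_distrib_left
    proof (intro sum.cong refl)
      fix x assume x: "x \<in> ?A"
      then have "z' x * \<tau> x = 1"
        using switching_cases[OF \<tau>, of x] z'[of x] KV by (auto simp: Sgn_def zero_less_mult_iff)
      then show "2 * mass G x = mass G x * (1 + z' x * \<tau> x)" by simp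
    qed
    also have "\<dots> \<le> (\<Sum>x\<in>K. mass G x * (1 + z' x * \<tau> x))"
      using KV nonneg finite_component[OF K]
      by (intro sum_mono2 mult_nonneg_nonneg) (auto intro: less_imp_le[OF mass_pos])
    also have "\<dots> = vertex_volume G K"
      using zero by (simp add: vertex_volume_def distrib_left sum.distrib)
    finally show ?thesis .
  qed
  have "t * mass_norm G f \<le> total_variation G f"
  proof (rule mass_norm_le_total_variation_median[OF t])
    fix K assume K: "K \<in> component_sets G" and "balanced (induced G K)"
    then obtain \<tau> where \<tau>: "switching G K \<tau>" using balanced_iff_switching by blast
    have "zero_is_median G K (\<lambda>x. \<tau> x * f x)"
      using half[OF K \<tau>] half[OF K switching_uminus[OF \<tau>]] by (simp add: zero_is_median_def)
    then show "\<exists>\<tau>. switching G K \<tau> \<and> zero_is_median G K (\<lambda>x. \<tau> x * f x)" using \<tau> by blast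
  qed
  moreover have "0 < mass_norm G f"
  proof -
    obtain x where "f x \<noteq> 0" using f(2) by blast
    then show ?thesis using f(1) by (intro mass_norm_pos[of x]) (auto simp: vfuns_def)
  qed
  ultimately show ?thesis
    by (simp add: tv)
qed

lemma eigenvalue_of_calibration:
  assumes f: "f \<in> vfuns G" "f \<noteq> (\<lambda>_. 0)" and z': "\<And>x. x \<in> verts G \<Longrightarrow> z' x \<in> Sgn (f x)"
    and le: "\<And>g. (\<Sum>x\<in>verts G. (t * mass G x * z' x) * g x) \<le> total_variation G g"
    and eq: "(\<Sum>x\<in>verts G. (t * mass G x * z' x) * f x) = total_variation G f"
  shows "eigenvalue G t"
proof -
  obtain z where "\<And>x y. (x, y) \<in> arcs G \<Longrightarrow> z x y \<in> Sgn (f x - signature G {x, y} * f y)"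
    and "\<And>x y. (x, y) \<in> arcs G \<Longrightarrow> z x y = - signature G {x, y} * z y x"
    and "\<And>x. x \<in> verts G \<Longrightarrow> (\<Sum>y\<in>nbrs G x. weight G {x, y} * z x y) = t * mass G x * z' x"
    using flow_of_calibration[OF le eq] by blast
  then have "eigenfunction G t f"
    unfolding eigenfunction_def using f z' by (intro conjI exI[of _ z] exI[of _ z']) (auto simp: arcs_def)
  then show ?thesis by (auto simp: eigenvalue_def)
qed

lemma restrict_switching_eq_indicator:
  assumes "switching G K \<tau>" "A \<subseteq> K"
  shows "restrict_to A \<tau> = signed_indicator {x \<in> A. \<tau> x = 1} {x \<in> A. \<tau> x = -1}"
  using switching_cases[OF assms(1)] assms(2) by (fastforce simp: restrict_to_def signed_indicator_def)

lemma tension_switching_set: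
  assumes K: "K \<in> component_sets G" and \<tau>: "switching G K \<tau>" and A: "A \<subseteq> K" and xy: "(x, y) \<in> arcs G"
  shows "\<bar>tension G (restrict_to A \<tau>) (x, y)\<bar> = (if x \<in> A \<longleftrightarrow> y \<in> A then 0 else 1)"
proof (cases "x \<in> K")
  case True
  then have y: "y \<in> K" using component_closed[OF K _ xy] by blast
  show ?thesis
    using switching_cases[OF \<tau> True] switching_cases[OF \<tau> y]
    by (auto simp: tension_def restrict_to_def switching_arc[OF \<tau> True xy])
next
  case False
  then have "y \<notin> K" using component_closed[OF K _ arc_sym[OF xy]] by blast
  with False show ?thesis using A by (auto simp: tension_def restrict_to_def)
qed

text \<open>Every edge that leaves \<open>P \<union> Q\<close> contributes equally to both sides, and the left side has no other
  contributions.\<close>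

lemma total_variation_switching_le:
  assumes K: "K \<in> component_sets G" and \<tau>: "switching G K \<tau>" and PQ: "P \<union> Q \<subseteq> K" "P \<inter> Q = {}"
  shows "total_variation G (restrict_to (P \<union> Q) \<tau>) \<le> total_variation G (signed_indicator P Q)"
proof -
  have "\<bar>tension G (restrict_to (P \<union> Q) \<tau>) e\<bar> \<le> \<bar>tension G (signed_indicator P Q) e\<bar>" if e: "e \<in> arcs G" for e
  proof -
    obtain x y where xy: "e = (x, y)" "(x, y) \<in> arcs G" using e by (cases e) auto
    show ?thesis
      unfolding xy(1) tension_switching_set[OF K \<tau> PQ(1) xy(2)]
      using signature_cases[OF xy(2)] PQ(2) by (auto simp: tension_def signed_indicator_def)
  qed
  then show ?thesis
    unfolding total_variation_def
    by (intro mult_left_mono sum_mono) (auto intro: less_imp_le[OF arc_weight_pos])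
qed

text \<open>A set and its complement in a component have the same boundary.\<close>

lemma total_variation_switching_complement:
  assumes K: "K \<in> component_sets G" and \<tau>: "switching G K \<tau>" and A: "A \<subseteq> K"
  shows "total_variation G (restrict_to (K - A) \<tau>) = total_variation G (restrict_to A \<tau>)"
proof -
  have "\<bar>tension G (restrict_to (K - A) \<tau>) e\<bar> = \<bar>tension G (restrict_to A \<tau>) e\<bar>" if e: "e \<in> arcs G" for e
  proof -
    obtain x y where xy: "e = (x, y)" "(x, y) \<in> arcs G" using e by (cases e) auto
    have "x \<in> K \<longleftrightarrow> y \<in> K"
      using component_closed[OF K _ xy(2)] component_closed[OF K _ arc_sym[OF xy(2)]] by blast
    then show ?thesis
      unfolding xy(1) using A
      by (subst (1 2) tension_switching_set[OF K \<tau> _ xy(2)]) auto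
  qed
  then show ?thesis
    by (simp add: total_variation_def)
qed

lemma admissible_bound_cut:
  assumes t: "admissible_bound G t" and K: "K \<in> component_sets G" and \<tau>: "switching G K \<tau>" and A: "A \<subseteq> K"
    and vol: "2 * vertex_volume G A \<le> vertex_volume G K"
  shows "t * vertex_volume G A \<le> total_variation G (restrict_to A \<tau>)"
proof -
  have eq: "{x \<in> A. \<tau> x = 1} \<union> {x \<in> A. \<tau> x = -1} = A"
    using switching_cases[OF \<tau>] A by auto
  show ?thesis
    using admissible_bound_total_variation[OF t K, of "{x \<in> A. \<tau> x = 1}" "{x \<in> A. \<tau> x = -1}"] A vol
    unfolding restrict_switching_eq_indicator[OF \<tau> A] by (simp add: eq) fastforce
qed

lemma total_variation_switching_component:
  assumes "K \<in> component_sets G" "switching G K \<tau>"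
  shows "total_variation G (restrict_to K \<tau>) = 0"
  unfolding total_variation_def
  using tension_switching[OF assms] by (simp add: sum.neutral split_paired_all)

lemma admissible_pairE:
  assumes "(P, Q) \<in> admissible_pairs G"
  obtains K where "K \<in> component_sets G" "P \<union> Q \<subseteq> K" "P \<inter> Q = {}" "P \<union> Q \<noteq> {}"
    "P \<subseteq> verts G" "Q \<subseteq> verts G" "balanced (induced G K) \<Longrightarrow> 2 * vertex_volume G (P \<union> Q) \<le> vertex_volume G K"
  using assms component_subset unfolding admissible_pairs_def by blast

text \<open>If the quotient were \<open>0\<close>, no edge would leave \<open>P \<union> Q\<close>, so \<open>P \<union> Q\<close> would be the whole component, and
  \<open>1\<^sub>P - 1\<^sub>Q\<close> would be a switching function of it. The component would be balanced, against the
  volume condition.\<close>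

lemma signed_beta_pos_of_admissible:
  assumes PQ: "(P, Q) \<in> admissible_pairs G"
  shows "0 < signed_beta G P Q"
proof -
  obtain K where K: "K \<in> component_sets G" "P \<union> Q \<subseteq> K" and disj: "P \<inter> Q = {}" and ne: "P \<union> Q \<noteq> {}"
    and sub: "P \<subseteq> verts G" "Q \<subseteq> verts G"
    and bal: "balanced (induced G K) \<Longrightarrow> 2 * vertex_volume G (P \<union> Q) \<le> vertex_volume G K"
    by (rule admissible_pairE[OF PQ]) (rule that; blast)
  let ?f = "signed_indicator P Q"
  have vol: "0 < vertex_volume G (P \<union> Q)" using volume_pos ne sub by simp
  have "total_variation G ?f \<noteq> 0"
  proof
    assume "total_variation G ?f = 0"
    then have "\<forall>e\<in>arcs G. arc_weight G e * \<bar>tension G ?f e\<bar> = 0"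
      unfolding total_variation_def using finite_arcs arc_term_nonneg by (simp add: sum_nonneg_eq_0_iff)
    then have zero: "tension G ?f e = 0" if "e \<in> arcs G" for e
      using that arc_weight_pos[OF that] by auto
    have "y \<in> P \<union> Q" if "x \<in> P \<union> Q" "(x, y) \<in> arcs G" for x y
      using zero[OF that(2)] signature_cases[OF that(2)] that(1)
      by (auto simp: tension_def signed_indicator_def split: if_splits)
    then have eq: "P \<union> Q = K"
      by (intro component_connected[OF K ne])
    have "switching G K ?f"
      unfolding switching_def
    proof (intro conjI ballI allI impI)
      fix x assume "x \<in> K"
      then show "?f x \<in> {-1, 1}" using eq by (auto simp: signed_indicator_def)
    next
      fix x y assume x: "x \<in> K" and "{x, y} \<in> edges G"
      then have xy: "(x, y) \<in> arcs G" by (simp add: arcs_def)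
      have y: "y \<in> K" by (rule component_closed[OF K(1) x xy])
      show "signature G {x, y} = ?f x * ?f y"
        using zero[OF xy] signature_cases[OF xy] x y eq
        by (auto simp: tension_def signed_indicator_def split: if_splits)
    qed
    then have "2 * vertex_volume G K \<le> vertex_volume G K"
      using bal eq balanced_iff_switching[OF K(1)] by auto
    then show False using vol eq by simp
  qed
  then have "0 < total_variation G ?f"
    using total_variation_nonneg[of ?f] by simp
  then show ?thesis
    using vol by (simp add: signed_beta_eq[OF sub disj])
qed

text \<open>With \<open>f = 1\<^sub>P - 1\<^sub>Q\<close>, the functional \<open>g \<mapsto> t * (\<Sum>x. mass x * f x * g x)\<close> is at most \<open>t\<close> times the
  mass norm of \<open>g\<close> on \<open>K\<close>, which the total variation dominates because every pair of level sets in \<open>K\<close>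
  is admissible.\<close>

lemma eigenvalue_of_minimal_unbalanced:
  assumes t: "admissible_bound G t" and "0 < t"
    and K: "K \<in> component_sets G" "P \<union> Q \<subseteq> K" and disj: "P \<inter> Q = {}" and ne: "P \<union> Q \<noteq> {}"
    and unbal: "\<not> balanced (induced G K)"
    and tv: "total_variation G (signed_indicator P Q) = t * vertex_volume G (P \<union> Q)"
  shows "eigenvalue G t"
proof -
  let ?f = "signed_indicator P Q"
  have KV: "K \<subseteq> verts G" by (rule component_subset[OF K(1)])
  show ?thesis
  proof (rule eigenvalue_of_calibration[of ?f ?f])
    show "?f \<in> vfuns G" using K KV by (auto simp: vfuns_def signed_indicator_def)
    show "?f \<noteq> (\<lambda>_. 0)" using ne by (auto simp: signed_indicator_def fun_eq_iff)
    show "?f x \<in> Sgn (?f x)" for x by (auto simp: signed_indicator_def Sgn_iff)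
  next
    fix g :: "'v \<Rightarrow> real"
    have "(\<Sum>x\<in>verts G. t * mass G x * ?f x * g x) \<le> (\<Sum>x\<in>verts G. t * (mass G x * \<bar>restrict_to K g x\<bar>))"
    proof (rule sum_mono)
      fix x assume "x \<in> verts G"
      have "?f x * g x \<le> \<bar>restrict_to K g x\<bar>"
        using K by (auto simp: signed_indicator_def restrict_to_def)
      then show "t * mass G x * ?f x * g x \<le> t * (mass G x * \<bar>restrict_to K g x\<bar>)"
        using \<open>0 < t\<close> mass_pos[OF \<open>x \<in> verts G\<close>] by (simp add: mult.assoc)
    qed
    also have "\<dots> = t * mass_norm G (restrict_to K g)"
      by (simp add: mass_norm_def sum_distrib_left)
    also have "\<dots> \<le> total_variation G (restrict_to K g)"
    proof (rule mass_norm_le_total_variation)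
      fix P' Q' assume P': "P' \<subseteq> {x \<in> verts G. 0 < restrict_to K g x}"
        and Q': "Q' \<subseteq> {x \<in> verts G. restrict_to K g x < 0}"
      have pos: "0 < restrict_to K g x" if "x \<in> P'" for x using P' that by blast
      have neg: "restrict_to K g x < 0" if "x \<in> Q'" for x using Q' that by blast
      show "t * vertex_volume G (P' \<union> Q') \<le> total_variation G (signed_indicator P' Q')"
      proof (rule admissible_bound_total_variation[OF t K(1)])
        show "P' \<union> Q' \<subseteq> K"
          using pos neg by (force simp: restrict_to_def split: if_splits)
        show "P' \<inter> Q' = {}"
          using pos neg by (meson disjoint_iff order_less_asym)
      qed (use unbal in simp)
    qed
    also have "\<dots> \<le> total_variation G g"
      by (rule total_variation_restrict_le[OF K(1)])
    finally show "(\<Sum>x\<in>verts G. t * mass G x * ?f x * g x) \<le> total_variation G g" .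
  next
    have "(\<Sum>x\<in>verts G. t * mass G x * ?f x * ?f x) = (\<Sum>x\<in>P \<union> Q. t * mass G x)"
      using K KV by (intro sum.mono_neutral_cong_right) (auto simp: finite_verts signed_indicator_def)
    then show "(\<Sum>x\<in>verts G. t * mass G x * ?f x * ?f x) = total_variation G ?f"
      by (simp add: tv vertex_volume_def sum_distrib_left)
  qed
qed

text \<open>Here \<open>f = \<tau> 1\<^sub>A\<close> and the sign \<open>z'\<close> must be chosen outside \<open>A\<close>: it is \<open>- r \<tau>\<close> there, with the constant
  \<open>r \<in> [0, 1]\<close> that makes the weights \<open>\<zeta> = \<tau> z'\<close> sum to \<open>0\<close> over \<open>K\<close>. The calibrating functional is
  then unchanged when a multiple of \<open>\<tau>\<close> is added to \<open>g\<close>, as is the total variation on \<open>K\<close>. So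
  \<open>\<tau> g\<close> may be assumed nonnegative on \<open>K\<close>, and all its level sets are of the form \<open>\<tau> 1\<^sub>B\<close>. For
  these the claim follows from the bound for \<open>B\<close> or for \<open>K - B\<close>, whichever is smaller.\<close>

lemma eigenvalue_of_minimal_balanced:
  assumes t: "admissible_bound G t" and "0 < t"
    and K: "K \<in> component_sets G" and \<tau>: "switching G K \<tau>" and A: "A \<subseteq> K" "A \<noteq> {}"
    and half: "2 * vertex_volume G A \<le> vertex_volume G K"
    and tv: "total_variation G (restrict_to A \<tau>) = t * vertex_volume G A"
  shows "eigenvalue G t"
proof -
  let ?f = "restrict_to A \<tau>"
  have KV: "K \<subseteq> verts G" by (rule component_subset[OF K])
  have fin: "finite K" by (rule finite_component[OF K])
  have volA: "0 < vertex_volume G A" using A KV by (intro volume_pos) auto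
  have volKA: "vertex_volume G (K - A) = vertex_volume G K - vertex_volume G A" using A KV by (intro volume_Diff)
  define r where "r = vertex_volume G A / vertex_volume G (K - A)"
  have r: "0 \<le> r" "r \<le> 1" "r * vertex_volume G (K - A) = vertex_volume G A"
    using volA volKA half by (simp_all add: r_def field_simps)
  define \<zeta> where "\<zeta> x = (if x \<in> A then 1 else - r)" for x
  have \<zeta>1: "\<bar>\<zeta> x\<bar> \<le> 1" for x using r by (auto simp: \<zeta>_def)
  have \<zeta>0: "(\<Sum>x\<in>K. mass G x * \<zeta> x) = 0"
  proof -
    have "(\<Sum>x\<in>K. mass G x * \<zeta> x) = (\<Sum>x\<in>A. mass G x * \<zeta> x) + (\<Sum>x\<in>K - A. mass G x * \<zeta> x)"
      using sum.subset_diff[OF A(1) fin] by (simp add: add.commute)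
    also have "\<dots> = vertex_volume G A - r * vertex_volume G (K - A)"
      by (simp add: \<zeta>_def vertex_volume_def sum_negf sum_distrib_left mult.commute)
    finally show ?thesis using r by simp
  qed
  define z' where "z' = restrict_to K (\<lambda>x. \<zeta> x * \<tau> x)"
  have pair: "(\<Sum>x\<in>verts G. t * mass G x * z' x * g x) = t * (\<Sum>x\<in>K. mass G x * \<zeta> x * (\<tau> x * g x))" for g
  proof -
    have "(\<Sum>x\<in>verts G. t * mass G x * z' x * g x) = (\<Sum>x\<in>K. t * mass G x * (\<zeta> x * \<tau> x) * g x)"
      using KV by (intro sum.mono_neutral_cong_right) (auto simp: finite_verts z'_def restrict_to_def)
    then show ?thesis by (simp add: sum_distrib_left mult.assoc)
  qed
  have cut: "t * (\<Sum>x\<in>B. mass G x * \<zeta> x) \<le> total_variation G (restrict_to B \<tau>)" if B: "B \<subseteq> K" for B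
  proof (cases "2 * vertex_volume G B \<le> vertex_volume G K")
    case True
    have "(\<Sum>x\<in>B. mass G x * \<zeta> x) \<le> vertex_volume G B"
      unfolding vertex_volume_def
    proof (rule sum_mono)
      fix x assume "x \<in> B"
      then have "0 < mass G x" using B KV mass_pos by blast
      then show "mass G x * \<zeta> x \<le> mass G x" using \<zeta>1[of x] by (simp add: abs_le_iff)
    qed
    then have "t * (\<Sum>x\<in>B. mass G x * \<zeta> x) \<le> t * vertex_volume G B" using \<open>0 < t\<close> by simp
    also have "\<dots> \<le> total_variation G (restrict_to B \<tau>)"
      by (rule admissible_bound_cut[OF t K \<tau> B True])
    finally show ?thesis .
  next
    case False
    have "vertex_volume G (K - B) = vertex_volume G K - vertex_volume G B" using B KV by (intro volume_Diff)
    then have vol: "2 * vertex_volume G (K - B) \<le> vertex_volume G K" using False by simp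
    have "(\<Sum>x\<in>B. mass G x * \<zeta> x) = - (\<Sum>x\<in>K - B. mass G x * \<zeta> x)"
      using sum.subset_diff[OF B fin, of "\<lambda>x. mass G x * \<zeta> x"] \<zeta>0 by simp
    also have "\<dots> \<le> vertex_volume G (K - B)"
      unfolding vertex_volume_def sum_negf[symmetric]
    proof (rule sum_mono)
      fix x assume "x \<in> K - B"
      then have "0 < mass G x" using KV mass_pos by blast
      then show "- (mass G x * \<zeta> x) \<le> mass G x"
        using \<zeta>1[of x] mult_left_mono[of "- \<zeta> x" 1 "mass G x"] by (simp add: abs_le_iff)
    qed
    finally have "t * (\<Sum>x\<in>B. mass G x * \<zeta> x) \<le> t * vertex_volume G (K - B)" using \<open>0 < t\<close> by simp
    also have "\<dots> \<le> total_variation G (restrict_to (K - B) \<tau>)"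
      by (rule admissible_bound_cut[OF t K \<tau> _ vol]) blast
    also have "\<dots> = total_variation G (restrict_to B \<tau>)"
      by (rule total_variation_switching_complement[OF K \<tau> B])
    finally show ?thesis .
  qed
  show ?thesis
  proof (rule eigenvalue_of_calibration[of ?f z'])
    show "?f \<in> vfuns G" using A KV by (auto simp: vfuns_def restrict_to_def)
    show "?f \<noteq> (\<lambda>_. 0)"
    proof
      assume zero: "?f = (\<lambda>_. 0)"
      obtain x where "x \<in> A" using A by blast
      then show False
        using fun_cong[OF zero, of x] switching_cases[OF \<tau>, of x] A by (auto simp: restrict_to_def)
    qed
    show "z' x \<in> Sgn (?f x)" for x
      using switching_cases[OF \<tau>, of x] \<zeta>1[of x] A
      by (auto simp: z'_def restrict_to_def Sgn_iff \<zeta>_def)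
  next
    fix g :: "'v \<Rightarrow> real"
    \<comment> \<open>A shift large enough to make \<open>\<tau> x * g x + c\<close> nonnegative on \<open>K\<close>.\<close>
    define c where "c = (\<Sum>x\<in>K. \<bar>g x\<bar>)"
    have c: "\<bar>g x\<bar> \<le> c" if "x \<in> K" for x
      unfolding c_def by (rule member_le_sum) (use that fin in auto)
    define g' where "g' = restrict_to K (\<lambda>x. g x + c * \<tau> x)"
    have sign: "0 \<le> \<tau> x * g' x" if "x \<in> K" for x
      using switching_cases[OF \<tau> that] c[OF that] that by (auto simp: g'_def restrict_to_def)
    have "\<tau> x * g' x = \<tau> x * g x + c" if "x \<in> K" for x
      using switching_cases[OF \<tau> that] that by (auto simp: g'_def restrict_to_def)
    then have "(\<Sum>x\<in>K. mass G x * \<zeta> x * (\<tau> x * g' x)) = (\<Sum>x\<in>K. mass G x * \<zeta> x * (\<tau> x * g x)) + (\<Sum>x\<in>K. mass G x * \<zeta> x) * c"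
      by (simp add: distrib_left sum.distrib sum_distrib_right)
    then have "(\<Sum>x\<in>verts G. t * mass G x * z' x * g x) = (\<Sum>x\<in>verts G. t * mass G x * z' x * g' x)"
      unfolding pair by (simp add: \<zeta>0)
    also have "\<dots> \<le> total_variation G g'"
    proof (rule signed_layer_inequality)
      fix P Q assume P: "P \<subseteq> {x \<in> verts G. 0 < g' x}" and Q: "Q \<subseteq> {x \<in> verts G. g' x < 0}"
      have pos: "0 < g' x" if "x \<in> P" for x using P that by blast
      have neg: "g' x < 0" if "x \<in> Q" for x using Q that by blast
      have "g' x = 0" if "x \<notin> K" for x
        using that by (simp add: g'_def restrict_to_def)
      then have PQ: "P \<union> Q \<subseteq> K"
        using pos neg by (metis Un_iff order_less_irrefl subsetI)
      have "\<tau> x = 1" if "x \<in> P" for x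
      proof -
        have "x \<in> K" using that PQ by blast
        then show ?thesis
          using pos[OF that] sign[of x] switching_cases[OF \<tau>, of x] by fastforce
      qed
      moreover have "\<tau> x = -1" if "x \<in> Q" for x
      proof -
        have "x \<in> K" using that PQ by blast
        then show ?thesis
          using neg[OF that] sign[of x] switching_cases[OF \<tau>, of x] by fastforce
      qed
      moreover have "x \<notin> Q" if "x \<in> P" for x
        using pos[OF that] neg[of x] by force
      ultimately have eq: "signed_indicator P Q = restrict_to (P \<union> Q) \<tau>"
        by (intro ext) (auto simp: signed_indicator_def restrict_to_def)
      have "(\<Sum>x\<in>K. mass G x * \<zeta> x * (\<tau> x * restrict_to (P \<union> Q) \<tau> x)) = (\<Sum>x\<in>P \<union> Q. mass G x * \<zeta> x)"
        using PQ fin switching_square[OF \<tau>]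
        by (intro sum.mono_neutral_cong_right) (auto simp: restrict_to_def)
      then show "(\<Sum>x\<in>verts G. t * mass G x * z' x * signed_indicator P Q x) \<le> total_variation G (signed_indicator P Q)"
        unfolding pair eq using cut[OF PQ] by simp
    qed
    also have "\<dots> = total_variation G (restrict_to K g)"
    proof -
      have "tension G g' e = tension G (restrict_to K g) e" if "e \<in> arcs G" for e
      proof -
        obtain x y where xy: "e = (x, y)" by force
        have "tension G g' (x, y) = tension G (restrict_to K g) (x, y) + c * tension G (restrict_to K \<tau>) (x, y)"
          by (auto simp: g'_def tension_def restrict_to_def algebra_simps)
        then show ?thesis using tension_switching[OF K \<tau>] \<open>e \<in> arcs G\<close> xy by simp
      qed
      then show ?thesis by (simp add: total_variation_def)
    qed
    also have "\<dots> \<le> total_variation G g"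
      by (rule total_variation_restrict_le[OF K])
    finally show "(\<Sum>x\<in>verts G. t * mass G x * z' x * g x) \<le> total_variation G g" .
  next
    have "(\<Sum>x\<in>K. mass G x * \<zeta> x * (\<tau> x * ?f x)) = (\<Sum>x\<in>A. mass G x)"
      using A fin switching_square[OF \<tau>]
      by (intro sum.mono_neutral_cong_right) (auto simp: restrict_to_def \<zeta>_def)
    then show "(\<Sum>x\<in>verts G. t * mass G x * z' x * ?f x) = total_variation G ?f"
      unfolding pair tv by (simp add: vertex_volume_def)
  qed
qed

text \<open>In a balanced component a minimising pair may be replaced by the switched indicator of its union,
  which has no larger total variation.\<close>

lemma eigenvalue_of_minimal_admissible:
  assumes PQ: "(P, Q) \<in> admissible_pairs G" and t: "admissible_bound G (signed_beta G P Q)"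
  shows "eigenvalue G (signed_beta G P Q)"
proof -
  obtain K where K: "K \<in> component_sets G" "P \<union> Q \<subseteq> K" and disj: "P \<inter> Q = {}" and ne: "P \<union> Q \<noteq> {}"
    and sub: "P \<subseteq> verts G" "Q \<subseteq> verts G"
    and bal: "balanced (induced G K) \<Longrightarrow> 2 * vertex_volume G (P \<union> Q) \<le> vertex_volume G K"
    by (rule admissible_pairE[OF PQ]) (rule that; blast)
  let ?t = "signed_beta G P Q"
  have pos: "0 < ?t" by (rule signed_beta_pos_of_admissible[OF PQ])
  have "0 < vertex_volume G (P \<union> Q)" using volume_pos ne sub by simp
  then have tv: "total_variation G (signed_indicator P Q) = ?t * vertex_volume G (P \<union> Q)"
    by (simp add: signed_beta_eq[OF sub disj])
  show ?thesis
  proof (cases "balanced (induced G K)")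
    case False
    then show ?thesis by (intro eigenvalue_of_minimal_unbalanced[OF t pos K disj ne _ tv])
  next
    case True
    then obtain \<tau> where \<tau>: "switching G K \<tau>" using balanced_iff_switching[OF K(1)] by blast
    have "total_variation G (restrict_to (P \<union> Q) \<tau>) = ?t * vertex_volume G (P \<union> Q)"
      using admissible_bound_cut[OF t K(1) \<tau> K(2) bal[OF True]]
        total_variation_switching_le[OF K(1) \<tau> K(2) disj] tv by simp
    then show ?thesis
      by (rule eigenvalue_of_minimal_balanced[OF t pos K(1) \<tau> K(2) ne bal[OF True]])
  qed
qed

end

section \<open>Signed Cheeger constants and admissible pairs\<close>

lemma cheeger_le_pairs:
  assumes "m \<ge> 1"
    and "\<And>i. i \<in> {1..m} \<Longrightarrow> S i \<subseteq> verts G \<and> T i \<subseteq> verts G \<and> S i \<inter> T i = {} \<and> S i \<union> T i \<noteq> {}"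
    and "\<And>i j. i \<in> {1..m} \<Longrightarrow> j \<in> {1..m} \<Longrightarrow> i \<noteq> j \<Longrightarrow> (S i \<union> T i) \<inter> (S j \<union> T j) = {}"
    and b: "\<And>i. i \<in> {1..m} \<Longrightarrow> signed_beta G (S i) (T i) \<le> b"
  shows "cheeger G m \<le> ereal b"
proof -
  \<comment> \<open>Pair \<open>i\<close> occupies the positions \<open>2 * i - 1\<close> and \<open>2 * i\<close>.\<close>
  define U where "U n = (if odd n then S ((n + 1) div 2) else T (n div 2))" for n
  have U: "U (2 * i - 1) = S i" "U (2 * i) = T i" if "i \<in> {1..m}" for i
    using that by (auto simp: U_def)
  have "U n \<subseteq> verts G" if "n \<in> {1..2 * m}" for n
  proof (cases "odd n")
    case True
    then have "(n + 1) div 2 \<in> {1..m}" using that by (auto elim!: oddE)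
    then show ?thesis using assms(2) True by (simp add: U_def)
  next
    case False
    then have "n div 2 \<in> {1..m}" using that by (auto elim!: evenE)
    then show ?thesis using assms(2) False by (simp add: U_def)
  qed
  then have "U \<in> cheeger_families G m"
    unfolding cheeger_families_def using U assms(2,3) by simp
  then have "cheeger G m \<le> ereal (MAX i\<in>{1..m}. signed_beta G (U (2 * i - 1)) (U (2 * i)))"
    unfolding cheeger_def by (rule INF_lower)
  also have "\<dots> \<le> ereal b"
    using assms(1) U b by (simp del: One_nat_def)
  finally show ?thesis .
qed

context weighted_signed_graph
begin

text \<open>The complement of \<open>P \<union> Q\<close> has the same boundary and at least the same volume.\<close>

lemma switching_complement_beta_le:
  assumes K: "K \<in> component_sets G" and \<tau>: "switching G K \<tau>" and PQ: "P \<union> Q \<subseteq> K" "P \<inter> Q = {}" "P \<union> Q \<noteq> {}"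
    and half: "2 * vertex_volume G (P \<union> Q) \<le> vertex_volume G K"
  shows "signed_beta G {x \<in> K - (P \<union> Q). \<tau> x = 1} {x \<in> K - (P \<union> Q). \<tau> x = -1} \<le> signed_beta G P Q"
proof -
  let ?B = "K - (P \<union> Q)"
  have KV: "K \<subseteq> verts G" by (rule component_subset[OF K])
  have eq: "{x \<in> ?B. \<tau> x = 1} \<union> {x \<in> ?B. \<tau> x = -1} = ?B"
    using switching_cases[OF \<tau>] by auto
  have "vertex_volume G ?B = vertex_volume G K - vertex_volume G (P \<union> Q)" using PQ KV by (intro volume_Diff)
  moreover have volA: "0 < vertex_volume G (P \<union> Q)" using PQ KV by (intro volume_pos) auto
  ultimately have vol: "vertex_volume G (P \<union> Q) \<le> vertex_volume G ?B" using half by simp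
  have "signed_beta G {x \<in> ?B. \<tau> x = 1} {x \<in> ?B. \<tau> x = -1} = total_variation G (restrict_to ?B \<tau>) / vertex_volume G ?B"
    unfolding restrict_switching_eq_indicator[OF \<tau> Diff_subset] using KV
    by (subst signed_beta_eq) (auto simp only: eq)
  also have "\<dots> \<le> total_variation G (signed_indicator P Q) / vertex_volume G (P \<union> Q)"
    using vol volA total_variation_nonneg total_variation_switching_le[OF K \<tau> PQ(1,2)]
    by (intro frac_le) (simp_all add: total_variation_switching_complement[OF K \<tau> PQ(1)])
  also have "\<dots> = signed_beta G P Q"
    using PQ KV by (subst signed_beta_eq) auto
  finally show ?thesis .
qed

lemma switching_split_beta:
  assumes K: "K \<in> component_sets G" and \<tau>: "switching G K \<tau>"
  shows "signed_beta G {x \<in> K. \<tau> x = 1} {x \<in> K. \<tau> x = -1} = 0"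
proof -
  have KV: "K \<subseteq> verts G" by (rule component_subset[OF K])
  have "signed_beta G {x \<in> K. \<tau> x = 1} {x \<in> K. \<tau> x = -1}
      = total_variation G (restrict_to K \<tau>) / vertex_volume G ({x \<in> K. \<tau> x = 1} \<union> {x \<in> K. \<tau> x = -1})"
    unfolding restrict_switching_eq_indicator[OF \<tau> order_refl] using KV
    by (intro signed_beta_eq) auto
  then show ?thesis by (simp add: total_variation_switching_component[OF K \<tau>])
qed

text \<open>The family consists of the given pair and of the sets \<open>K i - (P \<union> Q)\<close>, each split by its switching
  function. These sets are whole components of quotient \<open>0\<close>, except for the one that contains the pair,
  if that component is balanced.\<close>

lemma cheeger_le_admissible:
  assumes K: "\<And>i. i \<in> {1..k} \<Longrightarrow> K i \<in> component_sets G" and inj: "inj_on K {1..k}"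
    and \<tau>: "\<And>i. i \<in> {1..k} \<Longrightarrow> switching G (K i) (\<tau> i)"
    and PQ: "(P, Q) \<in> admissible_pairs G"
  shows "cheeger G (k + 1) \<le> ereal (signed_beta G P Q)"
proof -
  obtain L where L: "L \<in> component_sets G" "P \<union> Q \<subseteq> L" and disj: "P \<inter> Q = {}" and ne: "P \<union> Q \<noteq> {}"
    and sub: "P \<subseteq> verts G" "Q \<subseteq> verts G"
    and bal: "balanced (induced G L) \<Longrightarrow> 2 * vertex_volume G (P \<union> Q) \<le> vertex_volume G L"
    by (rule admissible_pairE[OF PQ]) (rule that; blast)
  \<comment> \<open>Index \<open>k + 1\<close> carries the given pair.\<close>
  let ?B = "\<lambda>i. K i - (P \<union> Q)"
  define S where "S i = (if i \<in> {1..k} then {x \<in> ?B i. \<tau> i x = 1} else P)" for i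
  define T where "T i = (if i \<in> {1..k} then {x \<in> ?B i. \<tau> i x = -1} else Q)" for i
  have ST: "S i \<union> T i = (if i \<in> {1..k} then ?B i else P \<union> Q)" for i
    using switching_cases[OF \<tau>, of i] by (auto simp: S_def T_def)
  have other: "?B i = K i" if "i \<in> {1..k}" "K i \<noteq> L" for i
    using components_disjoint[OF K[OF that(1)] L(1) that(2)] L(2) by blast
  have halfL: "2 * vertex_volume G (P \<union> Q) \<le> vertex_volume G L" if "i \<in> {1..k}" "K i = L" for i
    using bal balanced_iff_switching[OF L(1)] \<tau>[OF that(1)] that(2) by auto
  show ?thesis
  proof (rule cheeger_le_pairs[of _ S _ T])
    show "1 \<le> k + 1" by simp
  next
    fix i assume "i \<in> {1..k + 1}"
    have "S i \<union> T i \<noteq> {}"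
    proof (cases "i \<in> {1..k}")
      case True
      have "?B i \<noteq> {}"
      proof (cases "K i = L")
        case False
        then show ?thesis using other[OF True] component_nonempty[OF K[OF True]] by simp
      next
        case eq: True
        have "0 < vertex_volume G (P \<union> Q)" using volume_pos ne sub by simp
        then have "P \<union> Q \<noteq> L" using halfL[OF True eq] by auto
        then show ?thesis using L(2) eq by blast
      qed
      then show ?thesis using ST True by simp
    next
      case False
      then have "S i \<union> T i = P \<union> Q" using ST[of i] by (simp only: if_False)
      then show ?thesis using ne by (rule ssubst)
    qed
    moreover have "S i \<inter> T i = {}" using disj by (auto simp: S_def T_def)
    moreover have "S i \<union> T i \<subseteq> verts G"
    proof (cases "i \<in> {1..k}")
      case True
      then have "S i \<union> T i = ?B i" using ST[of i] by simp
      then show ?thesis using component_subset[OF K[OF True]] by blast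
    next
      case False
      then have "S i \<union> T i = P \<union> Q" using ST[of i] by (simp only: if_False)
      then show ?thesis using sub by blast
    qed
    ultimately show "S i \<subseteq> verts G \<and> T i \<subseteq> verts G \<and> S i \<inter> T i = {} \<and> S i \<union> T i \<noteq> {}" by blast
  next
    fix i j assume ij: "i \<in> {1..k + 1}" "j \<in> {1..k + 1}" "i \<noteq> j"
    have out: "S n \<union> T n = P \<union> Q" if "n \<notin> {1..k}" for n
      using ST[of n] that by (simp only: if_False)
    have inside: "S n \<union> T n = ?B n" if "n \<in> {1..k}" for n
      using ST[of n] that by simp
    consider "i \<in> {1..k}" "j \<in> {1..k}" | "i \<in> {1..k}" "j \<notin> {1..k}" | "i \<notin> {1..k}" "j \<in> {1..k}"
      using ij by fastforce
    then show "(S i \<union> T i) \<inter> (S j \<union> T j) = {}"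
    proof cases
      case 1
      have "K i \<noteq> K j" using inj_onD[OF inj _ 1] ij(3) by blast
      then have "K i \<inter> K j = {}" by (rule components_disjoint[OF K[OF 1(1)] K[OF 1(2)]])
      then show ?thesis unfolding inside[OF 1(1)] inside[OF 1(2)] by blast
    next
      case 2
      show ?thesis unfolding inside[OF 2(1)] out[OF 2(2)] by blast
    next
      case 3
      show ?thesis unfolding out[OF 3(1)] inside[OF 3(2)] by blast
    qed
  next
    fix i assume "i \<in> {1..k + 1}"
    show "signed_beta G (S i) (T i) \<le> signed_beta G P Q"
    proof (cases "i \<in> {1..k}")
      case True
      show ?thesis
      proof (cases "K i = L")
        case False
        have "S i = {x \<in> K i. \<tau> i x = 1}" "T i = {x \<in> K i. \<tau> i x = -1}"
          using other[OF True False] True by (simp_all add: S_def T_def)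
        then show ?thesis
          using switching_split_beta[OF K[OF True] \<tau>[OF True]] signed_beta_pos_of_admissible[OF PQ] by simp
      next
        case eq: True
        then show ?thesis
          using switching_complement_beta_le[OF L(1) _ L(2) disj ne halfL[OF True eq], of "\<tau> i"] \<tau>[OF True] True
          by (simp add: S_def T_def)
      qed
    next
      case False
      then have "S i = P" "T i = Q" unfolding S_def T_def by (rule if_not_P)+
      then show ?thesis by (simp only: order_refl)
    qed
  qed
qed

lemma signed_beta_induced:
  assumes K: "K \<in> component_sets G" and P: "P \<subseteq> K" and Q: "Q \<subseteq> K"
  shows "signed_beta (induced G K) P Q = signed_beta G P Q"
proof -
  have nbrs: "nbrs (induced G K) x = nbrs G x" if "x \<in> K" for x
    using component_closed[OF K that] that by (auto simp: nbrs_def induced_def arcs_def)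
  have edge: "edge_vol (induced G K) s U W = edge_vol G s U W" if "U \<subseteq> K" for s U W
    unfolding edge_vol_def
    by (intro sum.cong refl) (use that nbrs in \<open>auto simp: induced_def subset_iff\<close>)
  have boundary: "boundary_vol (induced G K) U = boundary_vol G U" if "U \<subseteq> K" for U
    unfolding boundary_vol_def
    by (intro sum.cong refl) (use that nbrs in \<open>auto simp: induced_def subset_iff\<close>)
  show ?thesis
    using P Q by (simp add: signed_beta_def edge boundary) (simp add: induced_def)
qed

lemma component_cheeger_le_admissible:
  assumes PQ: "(P, Q) \<in> admissible_pairs G"
  obtains K where "K \<in> component_sets G"
    "cheeger (induced G K) (if balanced (induced G K) then 2 else 1) \<le> ereal (signed_beta G P Q)"
proof -
  obtain K where K: "K \<in> component_sets G" "P \<union> Q \<subseteq> K" and disj: "P \<inter> Q = {}" and ne: "P \<union> Q \<noteq> {}"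
    and sub: "P \<subseteq> verts G" "Q \<subseteq> verts G"
    and bal: "balanced (induced G K) \<Longrightarrow> 2 * vertex_volume G (P \<union> Q) \<le> vertex_volume G K"
    by (rule admissible_pairE[OF PQ]) (rule that; blast)
  have [simp]: "verts (induced G K) = K" by (simp add: induced_def)
  show thesis
  proof (cases "balanced (induced G K)")
    case False
    have "cheeger (induced G K) 1 \<le> ereal (signed_beta G P Q)"
      by (rule cheeger_le_pairs[of _ "\<lambda>_. P" _ "\<lambda>_. Q"])
         (use K disj ne in \<open>auto simp: signed_beta_induced[OF K(1)]\<close>)
    then show thesis using that[OF K(1)] False by simp
  next
    case True
    then obtain \<tau> where \<tau>: "switching G K \<tau>" using balanced_iff_switching[OF K(1)] by blast
    let ?B = "K - (P \<union> Q)"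
    have eq: "{x \<in> ?B. \<tau> x = 1} \<union> {x \<in> ?B. \<tau> x = -1} = ?B"
      using switching_cases[OF \<tau>] by auto
    have "0 < vertex_volume G (P \<union> Q)" using volume_pos ne sub by simp
    then have "P \<union> Q \<noteq> K" using bal[OF True] by auto
    then have B: "?B \<noteq> {}" using K(2) by blast
    define S where "S i = (if i = 1 then P else {x \<in> ?B. \<tau> x = 1})" for i :: nat
    define T where "T i = (if i = 1 then Q else {x \<in> ?B. \<tau> x = -1})" for i :: nat
    have ST: "S i \<union> T i = (if i = 1 then P \<union> Q else ?B)" for i
      using eq by (simp add: S_def T_def)
    have "cheeger (induced G K) 2 \<le> ereal (signed_beta G P Q)"
    proof (rule cheeger_le_pairs[of _ S _ T])
      fix i :: nat
      have "S i \<union> T i \<subseteq> K" "S i \<union> T i \<noteq> {}" unfolding ST using K(2) ne B by simp_all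
      moreover have "S i \<inter> T i = {}" using disj by (auto simp: S_def T_def)
      ultimately show "S i \<subseteq> verts (induced G K) \<and> T i \<subseteq> verts (induced G K) \<and> S i \<inter> T i = {} \<and> S i \<union> T i \<noteq> {}"
        by simp
      have "signed_beta (induced G K) (S i) (T i) = signed_beta G (S i) (T i)"
        using \<open>S i \<union> T i \<subseteq> K\<close> by (intro signed_beta_induced[OF K(1)]) auto
      also have "\<dots> \<le> signed_beta G P Q"
        using switching_complement_beta_le[OF K(1) \<tau> K(2) disj ne bal[OF True]]
        by (simp add: S_def T_def)
      finally show "signed_beta (induced G K) (S i) (T i) \<le> signed_beta G P Q" .
    next
      fix i j :: nat assume "i \<in> {1..2}" "j \<in> {1..2}" "i \<noteq> j"
      then show "(S i \<union> T i) \<inter> (S j \<union> T j) = {}" unfolding ST by auto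
    qed simp
    then show thesis using that[OF K(1)] True by simp
  qed
qed

text \<open>Any pair in an unbalanced component is admissible; of two disjoint pairs in a balanced component one
  has at most half of its volume.\<close>

lemma INF_admissible_le_component_cheeger:
  assumes K: "K \<in> component_sets G"
  shows "(INF (P, Q)\<in>admissible_pairs G. ereal (signed_beta G P Q))
    \<le> cheeger (induced G K) (if balanced (induced G K) then 2 else 1)"
  unfolding cheeger_def
proof (rule INF_greatest)
  define m :: nat where "m = (if balanced (induced G K) then 2 else 1)"
  fix U assume "U \<in> cheeger_families (induced G K) (if balanced (induced G K) then 2 else 1)"
  then have U: "U \<in> cheeger_families (induced G K) m" by (simp add: m_def)
  have KV: "K \<subseteq> verts G" by (rule component_subset[OF K])
  let ?P = "\<lambda>i. U (2 * i - 1)" and ?Q = "\<lambda>i. U (2 * i)"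
  have sub: "?P i \<union> ?Q i \<subseteq> K" if "i \<in> {1..m}" for i
  proof -
    have "2 * i - 1 \<in> {1..2 * m}" "2 * i \<in> {1..2 * m}" using that by auto
    then show ?thesis using U unfolding cheeger_families_def by (simp add: induced_def)
  qed
  have ne: "?P i \<inter> ?Q i = {}" "?P i \<union> ?Q i \<noteq> {}" if "i \<in> {1..m}" for i
    using U that unfolding cheeger_families_def by auto
  have disj: "(?P i \<union> ?Q i) \<inter> (?P j \<union> ?Q j) = {}" if "i \<in> {1..m}" "j \<in> {1..m}" "i \<noteq> j" for i j
    using U that unfolding cheeger_families_def by blast
  have "\<exists>i\<in>{1..m}. (?P i, ?Q i) \<in> admissible_pairs G"
  proof (cases "balanced (induced G K)")
    case False
    then have "1 \<in> {1..m}" by (simp add: m_def)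
    then show ?thesis
      using False K sub[of 1] ne[of 1] unfolding admissible_pairs_def by blast
  next
    case True
    then have m: "1 \<in> {1..m}" "2 \<in> {1..m}" by (simp_all add: m_def)
    have "finite K" by (rule finite_component[OF K])
    have "vertex_volume G (?P 1 \<union> ?Q 1) + vertex_volume G (?P 2 \<union> ?Q 2) = vertex_volume G ((?P 1 \<union> ?Q 1) \<union> (?P 2 \<union> ?Q 2))"
      unfolding vertex_volume_def
      using finite_subset[OF sub[OF m(1)]] finite_subset[OF sub[OF m(2)]] disj[OF m] \<open>finite K\<close>
      by (intro sum.union_disjoint[symmetric]) auto
    also have "\<dots> \<le> vertex_volume G K"
      using sub[OF m(1)] sub[OF m(2)] KV by (intro volume_mono) auto
    finally have "2 * vertex_volume G (?P 1 \<union> ?Q 1) \<le> vertex_volume G K \<or> 2 * vertex_volume G (?P 2 \<union> ?Q 2) \<le> vertex_volume G K"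
      by linarith
    then obtain i where i: "i \<in> {1..m}" "2 * vertex_volume G (?P i \<union> ?Q i) \<le> vertex_volume G K"
      using m by blast
    then show ?thesis
      using K sub[OF i(1)] ne[OF i(1)] unfolding admissible_pairs_def by blast
  qed
  then obtain i where i: "i \<in> {1..m}" "(?P i, ?Q i) \<in> admissible_pairs G" by blast
  have "(INF (P, Q)\<in>admissible_pairs G. ereal (signed_beta G P Q)) \<le> ereal (signed_beta G (?P i) (?Q i))"
    using INF_lower[OF i(2), of "\<lambda>(P, Q). ereal (signed_beta G P Q)"] by simp
  also have "signed_beta G (?P i) (?Q i) = signed_beta (induced G K) (?P i) (?Q i)"
    using sub[OF i(1)] by (intro signed_beta_induced[OF K, symmetric]) auto
  also have "\<dots> \<le> (MAX i\<in>{1..m}. signed_beta (induced G K) (?P i) (?Q i))"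
    using i(1) by (intro Max_ge) auto
  finally show "(INF (P, Q)\<in>admissible_pairs G. ereal (signed_beta G P Q))
      \<le> ereal (MAX i\<in>{1..(if balanced (induced G K) then 2 else 1)}. signed_beta (induced G K) (?P i) (?Q i))"
    unfolding m_def by simp
qed

end

section \<open>The variational eigenvalue\<close>

lemma continuous_on_Max_family:
  fixes g :: "'i \<Rightarrow> 'a :: topological_space \<Rightarrow> real"
  assumes "finite I" "I \<noteq> {}" "\<And>i. i \<in> I \<Longrightarrow> continuous_on A (g i)"
  shows "continuous_on A (\<lambda>a. Max ((\<lambda>i. g i a) ` I))"
  using assms
proof (induction I rule: finite_ne_induct)
  case (insert i I)
  then show ?case by (simp add: continuous_on_max)
qed simp

lemma continuous_on_Min_family:
  fixes g :: "'i \<Rightarrow> 'a :: topological_space \<Rightarrow> real"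
  assumes "finite I" "I \<noteq> {}" "\<And>i. i \<in> I \<Longrightarrow> continuous_on A (g i)"
  shows "continuous_on A (\<lambda>a. Min ((\<lambda>i. g i a) ` I))"
  using assms
proof (induction I rule: finite_ne_induct)
  case (insert i I)
  then show ?case by (simp add: continuous_on_min)
qed simp

text \<open>The sets that carry at least half of the volume. Writing the smallest weighted median of \<open>u\<close> as a
  minimum of maxima over this fixed family makes its continuity in \<open>u\<close> evident.\<close>

definition half_sets :: "'v signed_graph \<Rightarrow> 'v set \<Rightarrow> 'v set set" where
  "half_sets G K = {S. S \<subseteq> K \<and> vertex_volume G K \<le> 2 * vertex_volume G S}"

definition lower_median :: "'v signed_graph \<Rightarrow> 'v set \<Rightarrow> ('v \<Rightarrow> real) \<Rightarrow> real" where
  "lower_median G K u = Min ((\<lambda>S. Max (u ` S)) ` half_sets G K)"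

context weighted_signed_graph
begin

lemma total_variation_combination_le:
  fixes c :: "'i \<Rightarrow> real"
  assumes "finite I"
  shows "total_variation G (\<lambda>v. \<Sum>i\<in>I. c i * s i v) \<le> (\<Sum>i\<in>I. \<bar>c i\<bar> * total_variation G (s i))"
proof -
  have "\<bar>tension G (\<lambda>v. \<Sum>i\<in>I. c i * s i v) e\<bar> \<le> (\<Sum>i\<in>I. \<bar>c i\<bar> * \<bar>tension G (s i) e\<bar>)" for e
  proof -
    have "tension G (\<lambda>v. \<Sum>i\<in>I. c i * s i v) e = (\<Sum>i\<in>I. c i * tension G (s i) e)"
      by (simp add: tension_def case_prod_unfold algebra_simps sum_subtractf sum_distrib_left)
    then show ?thesis
      using sum_abs[of "\<lambda>i. c i * tension G (s i) e" I] by (simp add: abs_mult)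
  qed
  then have "(\<Sum>e\<in>arcs G. arc_weight G e * \<bar>tension G (\<lambda>v. \<Sum>i\<in>I. c i * s i v) e\<bar>)
      \<le> (\<Sum>e\<in>arcs G. arc_weight G e * (\<Sum>i\<in>I. \<bar>c i\<bar> * \<bar>tension G (s i) e\<bar>))"
    by (intro sum_mono mult_left_mono less_imp_le[OF arc_weight_pos])
  also have "\<dots> = (\<Sum>i\<in>I. \<bar>c i\<bar> * (\<Sum>e\<in>arcs G. arc_weight G e * \<bar>tension G (s i) e\<bar>))"
    unfolding sum_distrib_left by (subst sum.swap) (simp add: mult_ac)
  also have "\<dots> = 2 * (\<Sum>i\<in>I. \<bar>c i\<bar> * total_variation G (s i))"
    unfolding total_variation_def sum_distrib_left[of 2] by (intro sum.cong refl) simp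
  finally show ?thesis
    by (simp add: total_variation_def[of G "\<lambda>v. \<Sum>i\<in>I. c i * s i v"])
qed

lemma total_variation_scale: "total_variation G (\<lambda>v. f v / c) = total_variation G f / \<bar>c\<bar>"
proof -
  have "\<bar>tension G (\<lambda>v. f v / c) e\<bar> = \<bar>tension G f e\<bar> / \<bar>c\<bar>" for e
    by (simp add: tension_def case_prod_unfold flip: abs_divide diff_divide_distrib)
  then show ?thesis
    by (simp add: total_variation_def sum_divide_distrib mult.commute)
qed

lemma mass_norm_scale: "mass_norm G (\<lambda>v. f v / c) = mass_norm G f / \<bar>c\<bar>"
  by (simp add: mass_norm_def sum_divide_distrib abs_divide)

text \<open>The functions \<open>1\<^sub>P - 1\<^sub>Q\<close> of the \<open>k + 1\<close> pairs have disjoint supports, so the mass norm is additive on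
  their combinations while the total variation is subadditive. The normalised combinations therefore
  form an odd image \<open>\<psi>\<close> of the sphere of dimension \<open>k\<close> on which the Rayleigh quotient is at most \<open>b\<close>.\<close>

lemma var_eigenvalue_le:
  fixes b :: real
  assumes sub: "\<And>i. i \<le> k \<Longrightarrow> P i \<union> Q i \<subseteq> verts G"
    and ne: "\<And>i. i \<le> k \<Longrightarrow> P i \<inter> Q i = {} \<and> P i \<union> Q i \<noteq> {}"
    and disj: "\<And>i j. i \<le> k \<Longrightarrow> j \<le> k \<Longrightarrow> i \<noteq> j \<Longrightarrow> (P i \<union> Q i) \<inter> (P j \<union> Q j) = {}"
    and b: "\<And>i. i \<le> k \<Longrightarrow> total_variation G (signed_indicator (P i) (Q i)) \<le> b * vertex_volume G (P i \<union> Q i)"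
  shows "var_eigenvalue G (Suc k) \<le> ereal b"
proof -
  define s where "s i = signed_indicator (P i) (Q i)" for i
  define \<nu> where "\<nu> i = vertex_volume G (P i \<union> Q i)" for i
  define comb where "comb x v = (\<Sum>i\<le>k. x i * s i v)" for x :: "nat \<Rightarrow> real" and v
  define M where "M x = (\<Sum>i\<le>k. \<bar>x i\<bar> * \<nu> i)" for x :: "nat \<Rightarrow> real"
  define \<psi> where "\<psi> x v = comb x v / M x" for x v
  have \<nu>: "0 < \<nu> i" if "i \<le> k" for i
    unfolding \<nu>_def using sub[OF that] ne[OF that] by (intro volume_pos) auto
  have abs_comb: "\<bar>comb x v\<bar> = (\<Sum>i\<le>k. \<bar>x i\<bar> * \<bar>s i v\<bar>)" for x v
  proof (cases "\<exists>i\<le>k. v \<in> P i \<union> Q i")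
    case True
    then obtain i where i: "i \<le> k" "v \<in> P i \<union> Q i" by blast
    have zero: "s j v = 0" if "j \<le> k" "j \<noteq> i" for j
      using disj[OF that(1) i(1) that(2)] i(2) by (auto simp: s_def signed_indicator_def)
    have "comb x v = x i * s i v"
      unfolding comb_def using i(1) zero by (subst sum.remove[of _ i]) (auto intro: sum.neutral)
    moreover have "(\<Sum>i\<le>k. \<bar>x i\<bar> * \<bar>s i v\<bar>) = \<bar>x i\<bar> * \<bar>s i v\<bar>"
      using i(1) zero by (subst sum.remove[of _ i]) (auto intro: sum.neutral)
    ultimately show ?thesis by (simp add: abs_mult)
  next
    case False
    then have "s i v = 0" if "i \<le> k" for i
      using that by (auto simp: s_def signed_indicator_def)
    then show ?thesis by (simp add: comb_def)
  qed
  have norm_s: "mass_norm G (s i) = \<nu> i" if "i \<le> k" for i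
    unfolding mass_norm_def \<nu>_def vertex_volume_def using sub[OF that] ne[OF that]
    by (intro sum.mono_neutral_cong_right) (auto simp: finite_verts s_def signed_indicator_def)
  have norm_comb: "mass_norm G (comb x) = M x" for x
  proof -
    have "mass_norm G (comb x) = (\<Sum>i\<le>k. \<bar>x i\<bar> * mass_norm G (s i))"
      unfolding mass_norm_def abs_comb sum_distrib_left by (subst sum.swap) (simp add: mult_ac)
    then show ?thesis by (simp add: M_def norm_s)
  qed
  have Mpos: "0 < M x" if "x \<in> topspace (nsphere k)" for x
  proof -
    have "\<exists>i\<le>k. x i \<noteq> 0"
    proof (rule ccontr)
      assume "\<not> (\<exists>i\<le>k. x i \<noteq> 0)"
      then have "(\<Sum>i\<le>k. (x i)\<^sup>2) = 0" by simp
      then show False using that by (simp add: nsphere)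
    qed
    then obtain i where i: "i \<le> k" "x i \<noteq> 0" by blast
    show ?thesis
      unfolding M_def
      by (rule sum_pos2[of _ i]) (use i \<nu> in \<open>auto intro!: mult_nonneg_nonneg less_imp_le[OF \<nu>]\<close>)
  qed
  have tv: "total_variation G (comb x) \<le> b * M x" for x
  proof -
    have "total_variation G (comb x) \<le> (\<Sum>i\<le>k. \<bar>x i\<bar> * total_variation G (s i))"
      unfolding comb_def[abs_def] by (rule total_variation_combination_le) simp
    also have "\<dots> \<le> (\<Sum>i\<le>k. \<bar>x i\<bar> * (b * \<nu> i))"
      using b by (intro sum_mono mult_left_mono) (auto simp: s_def \<nu>_def)
    finally show ?thesis by (simp add: M_def sum_distrib_left mult_ac)
  qed
  define A where "A = \<psi> ` topspace (nsphere k)"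
  have odd: "\<psi> (neg_fun x) = (\<lambda>v. - \<psi> x v)" for x
    by (simp add: \<psi>_def[abs_def] comb_def M_def neg_fun_def sum_negf)
  have M0: "(\<Sum>i\<le>k. \<bar>x i\<bar> * \<nu> i) \<noteq> 0" if "x \<in> topspace (nsphere k)" for x
    using Mpos[OF that] by (simp add: M_def)
  have cont: "continuous_map (nsphere k) euclidean \<psi>"
    unfolding euclidean_product_topology[symmetric] continuous_map_componentwise_UNIV \<psi>_def comb_def M_def
    by (intro allI continuous_intros continuous_map_nsphere_projection)
       (simp_all add: M0)
  have A_sym: "A \<in> sym_sets G (Suc k)"
    unfolding sym_sets_def
  proof (intro CollectI conjI)
    show "A \<subseteq> unit_sphere G"
    proof
      fix f assume "f \<in> A"
      then obtain x where x: "x \<in> topspace (nsphere k)" "f = \<psi> x" by (auto simp: A_def)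
      have "s i v = 0" if "v \<notin> verts G" "i \<le> k" for i v
        using sub[OF that(2)] that(1) by (auto simp: s_def signed_indicator_def)
      then have "comb x v = 0" if "v \<notin> verts G" for v
        unfolding comb_def using that by (intro sum.neutral) simp
      then have "f \<in> vfuns G" by (simp add: vfuns_def x \<psi>_def)
      moreover have "mass_norm G f = 1"
        using Mpos[OF x(1)] mass_norm_scale[of "comb x" "M x"] by (simp add: x \<psi>_def[abs_def] norm_comb)
      ultimately show "f \<in> unit_sphere G" by (simp add: unit_sphere_def mass_norm_def)
    qed
    have "compactin euclidean A"
      unfolding A_def by (rule image_compactin[OF compactin_nsphere cont])
    then show "compact A" by simp
    have neg: "neg_fun x \<in> topspace (nsphere k)" if "x \<in> topspace (nsphere k)" for x
      using continuous_map_image_subset_topspace[OF continuous_map_neg_fun, of k] that by blast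
    have negA: "(\<lambda>v. - f v) \<in> A" if "f \<in> A" for f
    proof -
      obtain x where x: "x \<in> topspace (nsphere k)" "f = \<psi> x" using \<open>f \<in> A\<close> by (auto simp: A_def)
      have "(\<lambda>v. - f v) = \<psi> (neg_fun x)" unfolding odd x(2) ..
      moreover have "\<psi> (neg_fun x) \<in> A" unfolding A_def by (rule imageI) (rule neg[OF x(1)])
      ultimately show ?thesis by (simp only:)
    qed
    show "(\<lambda>f x. - f x) ` A = A"
    proof (intro equalityI subsetI)
      fix f assume "f \<in> (\<lambda>f x. - f x) ` A"
      then obtain g where "f = (\<lambda>x. - g x)" "g \<in> A" by (rule imageE)
      then show "f \<in> A" by (simp only: negA[OF \<open>g \<in> A\<close>])
    next
      fix f assume "f \<in> A"
      show "f \<in> (\<lambda>f x. - f x) ` A"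
        by (rule image_eqI[where x = "\<lambda>v. - f v", OF _ negA[OF \<open>f \<in> A\<close>]]) simp
    qed
    have "continuous_map (nsphere k) (top_of_set A) \<psi>"
      using cont by (auto simp: continuous_map_in_subtopology A_def)
    then show "enat (Suc k) \<le> genus A"
      by (rule genus_of_sphere_image) (rule odd)
  qed
  have "Suc k \<le> card (verts G)"
  proof -
    define pick where "pick i = (SOME v. v \<in> P i \<union> Q i)" for i
    have pick: "pick i \<in> P i \<union> Q i" if "i \<le> k" for i
      unfolding pick_def by (rule someI_ex) (use ne[OF that] in blast)
    have "card {..k} \<le> card (verts G)"
    proof (rule card_inj_on_le[OF _ _ finite_verts])
      show "inj_on pick {..k}"
      proof (intro inj_onI, rule ccontr)
        fix i j assume ij: "i \<in> {..k}" "j \<in> {..k}" "pick i = pick j" "i \<noteq> j"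
        then have "(P i \<union> Q i) \<inter> (P j \<union> Q j) = {}" by (intro disj) simp_all
        then show False using pick[of i] pick[of j] ij by (simp only: atMost_iff) blast
      qed
      show "pick ` {..k} \<subseteq> verts G"
      proof (rule image_subsetI)
        fix i assume "i \<in> {..k}"
        then have "i \<le> k" by simp
        then show "pick i \<in> verts G" using pick[of i] sub[of i] by blast
      qed
    qed
    then show ?thesis by simp
  qed
  then have "var_eigenvalue G (Suc k) \<le> (SUP f\<in>A. ereal (rayleigh G f))"
    unfolding var_eigenvalue_def by (simp only: if_True) (rule INF_lower[OF A_sym])
  also have "(SUP f\<in>A. ereal (rayleigh G f)) \<le> ereal b"
  proof (rule SUP_least)
    fix f assume "f \<in> A"
    then obtain x where x: "x \<in> topspace (nsphere k)" "f = \<psi> x" by (auto simp: A_def)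
    have "rayleigh G f = total_variation G (comb x) / M x"
      using Mpos[OF x(1)] unfolding rayleigh_eq x(2) \<psi>_def[abs_def] total_variation_scale mass_norm_scale
      by (simp add: norm_comb)
    also have "\<dots> \<le> b" using tv Mpos[OF x(1)] by (simp add: pos_divide_le_eq)
    finally show "ereal (rayleigh G f) \<le> ereal b" by simp
  qed
  finally show ?thesis .
qed

lemma var_eigenvalue_le_cheeger: "var_eigenvalue G (k + 1) \<le> cheeger G (k + 1)"
  unfolding cheeger_def
proof (rule INF_greatest)
  fix U assume U: "U \<in> cheeger_families G (k + 1)"
  let ?P = "\<lambda>i. U (2 * i - 1)" and ?Q = "\<lambda>i. U (2 * i)"
  define b where "b = (MAX i\<in>{1..k + 1}. signed_beta G (?P i) (?Q i))"
  have fam: "?P i \<union> ?Q i \<subseteq> verts G" "?P i \<inter> ?Q i = {}" "?P i \<union> ?Q i \<noteq> {}"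
    if "i \<in> {1..k + 1}" for i
  proof -
    have "2 * i - 1 \<in> {1..2 * (k + 1)}" "2 * i \<in> {1..2 * (k + 1)}" using that by auto
    then show "?P i \<union> ?Q i \<subseteq> verts G" using U unfolding cheeger_families_def by blast
    show "?P i \<inter> ?Q i = {}" "?P i \<union> ?Q i \<noteq> {}"
      using U that unfolding cheeger_families_def by blast+
  qed
  have disj: "(?P i \<union> ?Q i) \<inter> (?P j \<union> ?Q j) = {}" if "i \<in> {1..k + 1}" "j \<in> {1..k + 1}" "i \<noteq> j" for i j
    using U that unfolding cheeger_families_def by blast
  have "var_eigenvalue G (Suc k) \<le> ereal b"
  proof (rule var_eigenvalue_le[of k "\<lambda>i. ?P (Suc i)" "\<lambda>i. ?Q (Suc i)"])
    fix i assume "i \<le> k"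
    then have i: "Suc i \<in> {1..k + 1}" by simp
    show "?P (Suc i) \<union> ?Q (Suc i) \<subseteq> verts G" by (rule fam[OF i])
    show "?P (Suc i) \<inter> ?Q (Suc i) = {} \<and> ?P (Suc i) \<union> ?Q (Suc i) \<noteq> {}" using fam[OF i] by blast
    have "(\<lambda>i. signed_beta G (?P i) (?Q i)) (Suc i) \<le> b"
      unfolding b_def by (intro Max_ge imageI i) simp
    moreover have "0 < vertex_volume G (?P (Suc i) \<union> ?Q (Suc i))"
      using fam[OF i] by (intro volume_pos)
    ultimately show "total_variation G (signed_indicator (?P (Suc i)) (?Q (Suc i)))
        \<le> b * vertex_volume G (?P (Suc i) \<union> ?Q (Suc i))"
      using fam[OF i] by (simp add: signed_beta_eq pos_divide_le_eq)
  next
    fix i j assume "i \<le> k" "j \<le> k" "i \<noteq> j"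
    then show "(?P (Suc i) \<union> ?Q (Suc i)) \<inter> (?P (Suc j) \<union> ?Q (Suc j)) = {}"
      by (intro disj) auto
  qed
  then show "var_eigenvalue G (k + 1) \<le> ereal (MAX i\<in>{1..k + 1}. signed_beta G (?P i) (?Q i))"
    by (simp add: b_def)
qed

lemma half_sets_properties:
  assumes "K \<subseteq> verts G" "K \<noteq> {}"
  shows "finite (half_sets G K)" "K \<in> half_sets G K"
    "\<And>S. S \<in> half_sets G K \<Longrightarrow> S \<subseteq> K \<and> finite S \<and> S \<noteq> {}"
proof -
  have fin: "finite K" by (rule finite_subset[OF assms(1) finite_verts])
  then show "finite (half_sets G K)"
    using finite_subset[of "half_sets G K" "Pow K"] by (auto simp: half_sets_def)
  have pos: "0 < vertex_volume G K" using assms by (intro volume_pos)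
  then show "K \<in> half_sets G K" by (simp add: half_sets_def)
  show "S \<subseteq> K \<and> finite S \<and> S \<noteq> {}" if "S \<in> half_sets G K" for S
  proof -
    have "S \<subseteq> K" "vertex_volume G K \<le> 2 * vertex_volume G S" using that by (auto simp: half_sets_def)
    then show ?thesis using pos finite_subset[OF _ fin, of S] by (auto simp: vertex_volume_def)
  qed
qed

lemma lower_median_le_iff:
  assumes K: "K \<subseteq> verts G" "K \<noteq> {}"
  shows "lower_median G K u \<le> c \<longleftrightarrow> vertex_volume G K \<le> 2 * vertex_volume G {x \<in> K. u x \<le> c}"
proof
  note half = half_sets_properties[OF K]
  assume "lower_median G K u \<le> c"
  then obtain S where S: "S \<in> half_sets G K" "Max (u ` S) \<le> c"
    unfolding lower_median_def using half(1,2) by (subst (asm) Min_le_iff) auto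
  have fS: "finite S" "S \<subseteq> K" using half(3)[OF S(1)] by blast+
  have "u x \<le> c" if "x \<in> S" for x
    using Max_ge[OF finite_imageI[OF fS(1)] imageI[OF that], of u] S(2) by linarith
  then have "S \<subseteq> {x \<in> K. u x \<le> c}"
    using fS(2) by blast
  then have "vertex_volume G S \<le> vertex_volume G {x \<in> K. u x \<le> c}"
    using K by (intro volume_mono) auto
  then show "vertex_volume G K \<le> 2 * vertex_volume G {x \<in> K. u x \<le> c}"
    using S(1) by (simp add: half_sets_def)
next
  note half = half_sets_properties[OF K]
  let ?S = "{x \<in> K. u x \<le> c}"
  assume "vertex_volume G K \<le> 2 * vertex_volume G ?S"
  then have S: "?S \<in> half_sets G K" by (auto simp: half_sets_def)
  have "lower_median G K u \<le> Max (u ` ?S)"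
    unfolding lower_median_def using half(1) S by (intro Min_le) auto
  also have "\<dots> \<le> c"
    using half(3)[OF S] by (subst Max_le_iff) auto
  finally show "lower_median G K u \<le> c" .
qed

text \<open>The smallest median of \<open>- u\<close> is minus the largest median of \<open>u\<close>. Hence the hypothesis says that the
  medians of \<open>u\<close> form an interval around \<open>0\<close>.\<close>

lemma zero_is_median_if_symmetric:
  assumes K: "K \<subseteq> verts G" "K \<noteq> {}"
    and sym: "lower_median G K u = lower_median G K (\<lambda>x. - u x)"
  shows "zero_is_median G K u"
proof -
  have compl: "vertex_volume G (K - B) = vertex_volume G K - vertex_volume G B" if "B \<subseteq> K" for B
    by (rule volume_Diff[OF that K(1)])
  have "{x \<in> K. 0 < u x} = K - {x \<in> K. u x \<le> 0}" by auto
  then have pos: "vertex_volume G {x \<in> K. 0 < u x} = vertex_volume G K - vertex_volume G {x \<in> K. u x \<le> 0}"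
    using compl[of "{x \<in> K. u x \<le> 0}"] by (simp only: Collect_subset)
  have "{x \<in> K. u x < 0} = K - {x \<in> K. - u x \<le> 0}" by auto
  then have neg: "vertex_volume G {x \<in> K. u x < 0} = vertex_volume G K - vertex_volume G {x \<in> K. - u x \<le> 0}"
    using compl[of "{x \<in> K. - u x \<le> 0}"] by (simp only: Collect_subset)
  note le_iff = lower_median_le_iff[OF K, where c = 0]
  show ?thesis
  proof (cases "lower_median G K u \<le> 0")
    case True
    then have "lower_median G K (\<lambda>x. - u x) \<le> 0" using sym by linarith
    from this[unfolded le_iff] True[unfolded le_iff] show ?thesis
      unfolding zero_is_median_def pos neg by simp
  next
    case False
    then have "\<not> lower_median G K (\<lambda>x. - u x) \<le> 0" using sym by linarith
    from this[unfolded le_iff] False[unfolded le_iff]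
    have "vertex_volume G K < vertex_volume G {x \<in> K. 0 < u x} + vertex_volume G {x \<in> K. u x < 0}"
      unfolding pos neg by linarith
    also have "\<dots> = vertex_volume G ({x \<in> K. 0 < u x} \<union> {x \<in> K. u x < 0})"
    proof -
      have fin: "finite B" if "B \<subseteq> K" for B
        using finite_subset[OF subset_trans[OF that K(1)] finite_verts] .
      have "{x \<in> K. 0 < u x} \<inter> {x \<in> K. u x < 0} = {}" by auto
      from sum.union_disjoint[OF fin[OF Collect_subset] fin[OF Collect_subset] this]
      show ?thesis unfolding vertex_volume_def by (rule HOL.sym)
    qed
    also have "\<dots> \<le> vertex_volume G K"
      by (rule volume_mono[OF _ K(1)]) auto
    finally show ?thesis by simp
  qed
qed

lemma continuous_on_lower_median:
  assumes K: "K \<subseteq> verts G" "K \<noteq> {}"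
  shows "continuous_on A (\<lambda>f. lower_median G K (\<lambda>x. c x * f x))"
  unfolding lower_median_def
proof (rule continuous_on_Min_family)
  note half = half_sets_properties[OF K]
  show "finite (half_sets G K)" "half_sets G K \<noteq> {}" using half by auto
  fix S assume "S \<in> half_sets G K"
  then have S: "finite S" "S \<noteq> {}" using half(3) by auto
  have coord: "continuous_on A (\<lambda>f. c x * f x)" for x
    by (intro continuous_intros continuous_on_subset[OF continuous_on_product_coordinates subset_UNIV])
  show "continuous_on A (\<lambda>f. Max ((\<lambda>x. c x * f x) ` S))"
    by (rule continuous_on_Max_family[OF S coord])
qed

text \<open>The sum of the smallest and the largest median depends continuously and oddly on \<open>f\<close>. If the \<open>k\<close> sums
  had no common zero on \<open>A\<close>, they would show that the genus of \<open>A\<close> is at most \<open>k\<close>. For \<open>k = 0\<close> the claim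
  is only that \<open>A\<close> is nonempty.\<close>

lemma sym_set_contains_median:
  assumes A: "A \<in> sym_sets G (k + 1)"
    and K: "\<And>i. i \<in> {1..k} \<Longrightarrow> K i \<in> component_sets G"
  shows "\<exists>f\<in>A. \<forall>i\<in>{1..k}. zero_is_median G (K i) (\<lambda>x. \<tau> i x * f x)"
proof -
  have KV: "K i \<subseteq> verts G" "K i \<noteq> {}" if "i \<in> {1..k}" for i
    using component_subset component_nonempty K[OF that] by auto
  have genus: "enat (k + 1) \<le> genus A" and sym: "(\<lambda>f x. - f x) ` A = A"
    using A by (auto simp: sym_sets_def)
  have "A \<noteq> {}" using genus by (auto simp: genus_def zero_enat_def)
  \<comment> \<open>Smallest plus largest median: the smallest median of \<open>- \<tau> f\<close> is minus the largest one of \<open>\<tau> f\<close>.\<close>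
  define med where "med i f = lower_median G (K i) (\<lambda>x. \<tau> i x * f x)
      - lower_median G (K i) (\<lambda>x. - \<tau> i x * f x)" for i f
  define \<phi> where "\<phi> f j = (if j < k then med (Suc j) f else 0)" for f j
  have "\<exists>f\<in>A. \<forall>i\<in>{1..k}. med i f = 0"
  proof (cases "k = 0")
    case True
    then show ?thesis using \<open>A \<noteq> {}\<close> by auto
  next
    case False
    show ?thesis
    proof (rule ccontr)
      assume no: "\<not> ?thesis"
      have "continuous_on A (\<lambda>f. med i f)" if "i \<in> {1..k}" for i
        unfolding med_def by (intro continuous_on_diff continuous_on_lower_median KV[OF that])
      then have "continuous_on A (\<lambda>f. \<phi> f j)" for j
        unfolding \<phi>_def by (cases "j < k") auto
      then have "continuous_map (top_of_set A) (Euclidean_space k) \<phi>"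
        unfolding Euclidean_space_def continuous_map_in_subtopology continuous_map_componentwise_UNIV
          continuous_map_iff_continuous
        by (intro conjI allI funcsetI) (simp_all add: \<phi>_def)
      moreover have "\<phi> f \<noteq> (\<lambda>_. 0)" if "f \<in> A" for f
      proof
        assume zero: "\<phi> f = (\<lambda>_. 0)"
        have "med i f = 0" if "i \<in> {1..k}" for i
        proof -
          have "i - 1 < k" "Suc (i - 1) = i" using that by auto
          then show ?thesis using fun_cong[OF zero, of "i - 1"] by (simp add: \<phi>_def)
        qed
        then show False using no that by blast
      qed
      moreover have "\<phi> (\<lambda>x. - f x) = (\<lambda>i. - \<phi> f i)" for f
        by (auto simp: \<phi>_def med_def fun_eq_iff)
      ultimately have "enat k \<in> {enat k |k. 0 < k \<and> (\<exists>\<phi>. continuous_map (top_of_set A) (Euclidean_space k) \<phi> \<and>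
          (\<forall>f\<in>A. \<phi> f \<noteq> (\<lambda>_. 0)) \<and> (\<forall>f\<in>A. \<phi> (\<lambda>x. - f x) = (\<lambda>i. - \<phi> f i)))}"
        using False by blast
      then have "genus A \<le> enat k"
        unfolding genus_def using \<open>A \<noteq> {}\<close> by (simp only: if_False) (rule Inf_lower)
      with genus have "enat (k + 1) \<le> enat k" by (rule order_trans)
      then show False by simp
    qed
  qed
  then obtain f where f: "f \<in> A" "\<And>i. i \<in> {1..k} \<Longrightarrow> med i f = 0" by blast
  show ?thesis
  proof (intro bexI[OF _ f(1)] ballI)
    fix i assume i: "i \<in> {1..k}"
    show "zero_is_median G (K i) (\<lambda>x. \<tau> i x * f x)"
      by (rule zero_is_median_if_symmetric[OF KV[OF i]]) (use f(2)[OF i] in \<open>simp add: med_def\<close>)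
  qed
qed

end

section \<open>The smallest positive eigenvalue\<close>

theorem proposition4p2:
  fixes G :: "'v signed_graph"
    and C :: "nat \<Rightarrow> 'v signed_graph"
    and k l :: nat
  assumes "wf_signed_graph G"
    and "bij_betw C {1..k + l} (conn_components G)"
    and "\<And>i. i \<in> {1..k} \<Longrightarrow> balanced (C i)"
    and "\<And>j. j \<in> {k + 1..k + l} \<Longrightarrow> \<not> balanced (C j)"
  shows "is_smallest_pos_eigenvalue G (var_eigenvalue G (k + 1))
    \<and> var_eigenvalue G (k + 1) = cheeger G (k + 1)
    \<and> cheeger G (k + 1) =
        min (INF i\<in>{1..k}. cheeger (C i) 2) (INF j\<in>{k + 1..k + l}. cheeger (C j) 1)"
proof -
  interpret weighted_signed_graph G
    by (rule weighted_signed_graph.intro[OF assms(1)])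
  define K where "K i = verts (C i)" for i
  have conn: "conn_components G = induced G ` component_sets G"
    by (simp add: conn_components_def component_sets_def)
  have verts_induced: "verts (induced G L) = L" for L
    by (simp add: induced_def)
  have K: "K i \<in> component_sets G" "C i = induced G (K i)" if "i \<in> {1..k + l}" for i
  proof -
    have "C i \<in> induced G ` component_sets G"
      using bij_betwE[OF assms(2)] that conn by auto
    then show "K i \<in> component_sets G" "C i = induced G (K i)"
      by (auto simp: K_def verts_induced)
  qed
  have onto: "\<exists>i\<in>{1..k + l}. K i = L" if "L \<in> component_sets G" for L
  proof -
    have "induced G L \<in> C ` {1..k + l}"
      using bij_betw_imp_surj_on[OF assms(2)] that conn by auto
    then obtain i where i: "induced G L = C i" "i \<in> {1..k + l}" by (rule imageE)
    have "K i = L" unfolding K_def i(1)[symmetric] by (rule verts_induced)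
    then show ?thesis using i(2) by blast
  qed
  have injK: "inj_on K {1..k}"
  proof (rule inj_onI)
    fix i j assume "i \<in> {1..k}" "j \<in> {1..k}" and eq: "K i = K j"
    then have ij: "i \<in> {1..k + l}" "j \<in> {1..k + l}" by auto
    have "C i = C j" using K(2)[OF ij(1)] K(2)[OF ij(2)] eq by (simp only:)
    then show "i = j" by (rule inj_onD[OF bij_betw_imp_inj_on[OF assms(2)] _ ij])
  qed
  have Kk: "K i \<in> component_sets G" if "i \<in> {1..k}" for i
    using K(1)[of i] that by simp
  have "\<exists>\<tau>. switching G (K i) \<tau>" if "i \<in> {1..k}" for i
    using assms(3)[OF that] K(2)[of i] balanced_iff_switching[OF Kk[OF that]] that by simp
  then obtain \<tau> where \<tau>: "\<And>i. i \<in> {1..k} \<Longrightarrow> switching G (K i) (\<tau> i)"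
    by metis
  have balanced_index: "\<exists>i\<in>{1..k}. K i = L" if L: "L \<in> component_sets G" "balanced (induced G L)" for L
  proof -
    obtain i where i: "i \<in> {1..k + l}" "K i = L" using onto[OF L(1)] by blast
    then have "i \<notin> {k + 1..k + l}" using assms(4)[of i] K(2)[OF i(1)] L(2) by auto
    then show ?thesis using i by auto
  qed
  define \<eta> where "\<eta> = (INF (P, Q)\<in>admissible_pairs G. ereal (signed_beta G P Q))"
  define H where "H = min (INF i\<in>{1..k}. cheeger (C i) 2) (INF j\<in>{k + 1..k + l}. cheeger (C j) 1)"

  have "admissible_pairs G \<subseteq> Pow (verts G) \<times> Pow (verts G)"
  proof clarify
    fix P Q assume "(P, Q) \<in> admissible_pairs G"
    then show "P \<in> Pow (verts G) \<and> Q \<in> Pow (verts G)" by (rule admissible_pairE) blast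
  qed
  then have fin: "finite (admissible_pairs G)"
    by (rule finite_subset) (simp add: finite_verts)
  have attained: "\<exists>P Q. (P, Q) \<in> admissible_pairs G \<and> admissible_bound G (signed_beta G P Q)"
    if ne: "admissible_pairs G \<noteq> {}"
  proof -
    let ?B = "(\<lambda>(P, Q). signed_beta G P Q) ` admissible_pairs G"
    have B: "finite ?B" "?B \<noteq> {}" using fin ne by simp_all
    obtain P Q where PQ: "(P, Q) \<in> admissible_pairs G" "Min ?B = signed_beta G P Q"
      using Min_in[OF B] by auto
    have "Min ?B \<le> signed_beta G P' Q'" if "(P', Q') \<in> admissible_pairs G" for P' Q'
      using Min_le[OF B(1) imageI[OF that]] by simp
    then have "admissible_bound G (signed_beta G P Q)"
      unfolding admissible_bound_def PQ(2)[symmetric] by blast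
    with PQ(1) show ?thesis by blast
  qed
  have \<eta>_attained: "\<eta> = ereal (signed_beta G P Q)"
    if PQ: "(P, Q) \<in> admissible_pairs G" and bound: "admissible_bound G (signed_beta G P Q)" for P Q
    unfolding \<eta>_def
  proof (rule antisym)
    show "(INF (P, Q)\<in>admissible_pairs G. ereal (signed_beta G P Q)) \<le> ereal (signed_beta G P Q)"
      using INF_lower[OF PQ, of "\<lambda>(P, Q). ereal (signed_beta G P Q)"] by simp
    show "ereal (signed_beta G P Q) \<le> (INF (P, Q)\<in>admissible_pairs G. ereal (signed_beta G P Q))"
      using bound by (intro INF_greatest) (auto simp: admissible_bound_def)
  qed
  have \<eta>_empty: "\<eta> = \<infinity>" if "admissible_pairs G = {}"
    by (simp add: \<eta>_def that top_ereal_def)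
  \<comment> \<open>Without admissible pairs every real number is an admissible bound. This rules out positive eigenvalues
    and symmetric sets of genus at least \<open>k + 1\<close>.\<close>
  have bound_empty: "admissible_bound G t" if "admissible_pairs G = {}" for t
    by (simp add: admissible_bound_def that)

  have smallest: "is_smallest_pos_eigenvalue G \<eta>"
  proof (cases "admissible_pairs G = {}")
    case True
    have "\<not> (0 < ev \<and> eigenvalue G ev)" for ev
      using eigenvalue_ge_admissible_bound[OF bound_empty[OF True, of "ev + 1"]] by fastforce
    then show ?thesis
      by (simp add: is_smallest_pos_eigenvalue_def is_minimum_def \<eta>_empty[OF True])
  next
    case False
    then obtain P Q where PQ: "(P, Q) \<in> admissible_pairs G" "admissible_bound G (signed_beta G P Q)"
      using attained by blast
    show ?thesis
      unfolding is_smallest_pos_eigenvalue_def is_minimum_def \<eta>_attained[OF PQ]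
      using signed_beta_pos_of_admissible[OF PQ(1)] eigenvalue_of_minimal_admissible[OF PQ]
        eigenvalue_ge_admissible_bound[OF PQ(2)] by blast
  qed

  have "cheeger G (k + 1) \<le> \<eta>"
    unfolding \<eta>_def using cheeger_le_admissible[OF Kk injK \<tau>] by (intro INF_greatest) auto
  moreover have "\<eta> \<le> var_eigenvalue G (k + 1)"
  proof (cases "k + 1 \<le> card (verts G)")
    case True
    have "\<eta> \<le> (SUP f\<in>A. ereal (rayleigh G f))" if A: "A \<in> sym_sets G (k + 1)" for A
    proof -
      have "\<exists>f\<in>A. \<forall>i\<in>{1..k}. zero_is_median G (K i) (\<lambda>x. \<tau> i x * f x)"
        by (rule sym_set_contains_median[OF A]) (rule Kk)
      then obtain f where f: "f \<in> A" and med: "\<And>i. i \<in> {1..k} \<Longrightarrow> zero_is_median G (K i) (\<lambda>x. \<tau> i x * f x)"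
        by blast
      have "mass_norm G f = 1"
        using A f by (auto simp: sym_sets_def unit_sphere_def mass_norm_def)
      have bound: "t \<le> rayleigh G f" if t: "admissible_bound G t" for t
      proof -
        have "t * mass_norm G f \<le> total_variation G f"
        proof (rule mass_norm_le_total_variation_median[OF t])
          fix L assume "L \<in> component_sets G" "balanced (induced G L)"
          then obtain i where "i \<in> {1..k}" "K i = L" using balanced_index by blast
          then show "\<exists>\<tau>. switching G L \<tau> \<and> zero_is_median G L (\<lambda>x. \<tau> x * f x)"
            using \<tau> med by blast
        qed
        then show ?thesis by (simp add: rayleigh_eq \<open>mass_norm G f = 1\<close>)
      qed
      have "\<eta> \<le> ereal (rayleigh G f)"
      proof (cases "admissible_pairs G = {}")
        case True
        then show ?thesis using bound[OF bound_empty[OF True, of "rayleigh G f + 1"]] by simp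
      next
        case False
        then obtain P Q where PQ: "(P, Q) \<in> admissible_pairs G" "admissible_bound G (signed_beta G P Q)"
          using attained by blast
        show ?thesis unfolding \<eta>_attained[OF PQ] using bound[OF PQ(2)] by simp
      qed
      also have "\<dots> \<le> (SUP f\<in>A. ereal (rayleigh G f))" by (rule SUP_upper[OF f])
      finally show ?thesis .
    qed
    then have "\<eta> \<le> (INF A\<in>sym_sets G (k + 1). SUP f\<in>A. ereal (rayleigh G f))"
      by (rule INF_greatest)
    then show ?thesis
      unfolding var_eigenvalue_def using True by (simp only: if_True)
  qed (simp add: var_eigenvalue_def)
  moreover have "var_eigenvalue G (k + 1) \<le> cheeger G (k + 1)"
    by (rule var_eigenvalue_le_cheeger)
  ultimately have eq: "cheeger G (k + 1) = \<eta>" "var_eigenvalue G (k + 1) = \<eta>"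
    by auto

  have "\<eta> \<le> H"
    unfolding H_def
  proof (intro min.boundedI INF_greatest)
    fix i assume i: "i \<in> {1..k}"
    show "\<eta> \<le> cheeger (C i) 2"
      using INF_admissible_le_component_cheeger[OF Kk[OF i]] assms(3)[OF i] K(2)[of i] i
      by (simp add: \<eta>_def)
  next
    fix j assume j: "j \<in> {k + 1..k + l}"
    then have "j \<in> {1..k + l}" by simp
    then show "\<eta> \<le> cheeger (C j) 1"
      using INF_admissible_le_component_cheeger[OF K(1)[of j]] assms(4)[OF j] K(2)[of j]
      by (simp add: \<eta>_def)
  qed
  moreover have "H \<le> \<eta>"
    unfolding \<eta>_def
  proof (intro INF_greatest, clarify)
    fix P Q assume PQ: "(P, Q) \<in> admissible_pairs G"
    obtain L where L: "L \<in> component_sets G"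
      and le: "cheeger (induced G L) (if balanced (induced G L) then 2 else 1) \<le> ereal (signed_beta G P Q)"
      by (rule component_cheeger_le_admissible[OF PQ])
    obtain i where i: "i \<in> {1..k + l}" "K i = L" using onto[OF L] by blast
    have Ci: "C i = induced G L" using K(2)[OF i(1)] i(2) by simp
    have "H \<le> cheeger (C i) (if balanced (C i) then 2 else 1)"
    proof (cases "i \<in> {1..k}")
      case True
      have "H \<le> (INF i\<in>{1..k}. cheeger (C i) 2)"
        unfolding H_def by (rule min.cobounded1)
      also have "\<dots> \<le> cheeger (C i) 2" by (rule INF_lower[OF True])
      finally show ?thesis using assms(3)[OF True] by simp
    next
      case False
      then have j: "i \<in> {k + 1..k + l}" using i(1) by auto
      have "H \<le> (INF j\<in>{k + 1..k + l}. cheeger (C j) 1)"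
        unfolding H_def by (rule min.cobounded2)
      also have "\<dots> \<le> cheeger (C i) 1" by (rule INF_lower[OF j])
      finally show ?thesis using assms(4)[OF j] by simp
    qed
    then show "H \<le> ereal (signed_beta G P Q)"
      using le Ci by simp
  qed
  ultimately have "\<eta> = H" by (rule antisym)
  then show ?thesis
    using smallest eq unfolding H_def by simp
qed

end
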